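(* Let $\Bbbk$ be a field of characteristic $0$. With $U(W_+)$, $R$, $S$, $\phi: U(W_+)\to S$ and $\lambda_a: U(W_+)\to R$ ($a\in\Bbbk$) as in the context, the following hold. (a) If $a\in\{0,1\}$, then $\ker\lambda_a$ is the two-sided ideal $(e_1e_3-e_2^2-e_4)$ of $U(W_+)$. If $a\neq 0,1$, then $\ker\lambda_a$ is the two-sided ideal of $U(W_+)$ generated by the three elements (one of degree 5, two of degree 6) $$h_1=e_1e_2^2-e_1^2e_3-2a\,e_2e_3+(1+2a)e_1e_4-(a^2+a)e_5,$$ $$h_2=e_1e_5-4e_2e_4+3e_3^2+2e_6,$$ $$h_3=-4e_1^2e_2^2-4e_2^3+4e_1^3e_3+(20a^2+14a-7)e_3^2-(16a^2+18a+5)e_1e_5+(16a^3+36a^2+16a-2)e_6.$$ (b) The image $\lambda_a(U(W_+))$ is equal to $\Bbbk+uR$ if $a=0$; is equal to $\Bbbk+Ru$ if $a=1$; and contains $R_{\geq 4}$ if $a\neq 0,1$. For all $a\in\Bbbk$, the ring $\lambda_a(U(W_+))$ is (left and right) noetherian. (c) $\ker\phi$ is the two-sided ideal $(e_1e_5-4e_2e_4+3e_3^2+2e_6)$ of $U(W_+)$.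
   Context: The positive Witt algebra $W_+$ is the Lie algebra over $\Bbbk$ with basis $\{e_n\}_{n\geq 1}$ and bracket $[e_n,e_m]=(m-n)e_{n+m}$; $U(W_+)$ is its universal enveloping algebra, graded by $\deg e_n=n$. $S$ is the $\Bbbk$-algebra generated by $u,v,w$ subject to $uv-vu-v^2=0$, $uw-wu-vw=0$, $vw-wv=0$. $R$ (the Jordan plane) is the $\Bbbk$-algebra generated by $u,v$ subject to $uv-vu-v^2=0$. Both are graded with generators in degree 1; $R_{\geq 4}=\bigoplus_{n\ge 4}R_n$. $\phi: U(W_+)\to S$ is the (well-defined) algebra homomorphism with $\phi(e_n)=(u-(n-1)w)v^{n-1}$ for all $n\ge1$. For $a\in\Bbbk$, $\lambda_a: U(W_+)\to R$ is the (well-defined) algebra homomorphism with $\lambda_a(e_n)=(u-(n-1)av)v^{n-1}$ for all $n\ge 1$. $(r)$ denotes the two-sided ideal generated by $r$. *)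

theory Defs
  imports Complex_Main "HOL-Library.Poly_Mapping"
begin

section \<open>Ideals and Noetherian subrings of noncommutative rings\<close>

definition two_sided_ideal :: "'a::ring_1 set \<Rightarrow> bool" where
  "two_sided_ideal I \<longleftrightarrow> 0 \<in> I \<and> (\<forall>x\<in>I. \<forall>y\<in>I. x + y \<in> I) \<and> (\<forall>r. \<forall>x\<in>I. r * x \<in> I \<and> x * r \<in> I)"

definition ideal_gen :: "'a::ring_1 set \<Rightarrow> 'a set" where
  "ideal_gen X = two_sided_ideal hull X"

definition subring :: "'a::ring_1 set \<Rightarrow> bool" where
  "subring A \<longleftrightarrow> 1 \<in> A \<and> (\<forall>x\<in>A. \<forall>y\<in>A. x - y \<in> A \<and> x * y \<in> A)"

text \<open>One-sided ideals of a subring \<open>A\<close> of the ambient ring.\<close>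

definition left_ideal_of :: "'a::ring_1 set \<Rightarrow> 'a set \<Rightarrow> bool" where
  "left_ideal_of A I \<longleftrightarrow> I \<subseteq> A \<and> 0 \<in> I \<and> (\<forall>x\<in>I. \<forall>y\<in>I. x + y \<in> I) \<and> (\<forall>r\<in>A. \<forall>x\<in>I. r * x \<in> I)"

definition right_ideal_of :: "'a::ring_1 set \<Rightarrow> 'a set \<Rightarrow> bool" where
  "right_ideal_of A I \<longleftrightarrow> I \<subseteq> A \<and> 0 \<in> I \<and> (\<forall>x\<in>I. \<forall>y\<in>I. x + y \<in> I) \<and> (\<forall>r\<in>A. \<forall>x\<in>I. x * r \<in> I)"

definition left_noetherian :: "'a::ring_1 set \<Rightarrow> bool" where
  "left_noetherian A \<longleftrightarrow> subring A \<and>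
     (\<forall>I. left_ideal_of A I \<longrightarrow> (\<exists>F. finite F \<and> F \<subseteq> I \<and> I = left_ideal_of A hull F))"

definition right_noetherian :: "'a::ring_1 set \<Rightarrow> bool" where
  "right_noetherian A \<longleftrightarrow> subring A \<and>
     (\<forall>I. right_ideal_of A I \<longrightarrow> (\<exists>F. finite F \<and> F \<subseteq> I \<and> I = right_ideal_of A hull F))"

lemma two_sided_ideal_ideal_gen: "two_sided_ideal (ideal_gen X)"
  unfolding ideal_gen_def by (rule hull_in) (auto simp: two_sided_ideal_def)

lemma ideal_gen_inc: "x \<in> X \<Longrightarrow> x \<in> ideal_gen X"
  unfolding ideal_gen_def by (rule hull_inc)

lemma ideal_gen_0 [simp]: "0 \<in> ideal_gen X"
  and ideal_gen_add: "x \<in> ideal_gen X \<Longrightarrow> y \<in> ideal_gen X \<Longrightarrow> x + y \<in> ideal_gen X"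
  and ideal_gen_lmult: "x \<in> ideal_gen X \<Longrightarrow> r * x \<in> ideal_gen X"
  and ideal_gen_rmult: "x \<in> ideal_gen X \<Longrightarrow> x * r \<in> ideal_gen X"
  using two_sided_ideal_ideal_gen[of X] by (auto simp: two_sided_ideal_def)

lemma ideal_gen_minus: "x \<in> ideal_gen X \<Longrightarrow> - x \<in> ideal_gen X"
  using ideal_gen_lmult[of x X "-1"] by simp

lemma ideal_gen_minimal: "X \<subseteq> I \<Longrightarrow> two_sided_ideal I \<Longrightarrow> ideal_gen X \<subseteq> I"
  unfolding ideal_gen_def by (rule hull_minimal)

definition ideal_rel :: "'a::ring_1 set \<Rightarrow> 'a \<Rightarrow> 'a \<Rightarrow> bool" where
  "ideal_rel X x y \<longleftrightarrow> x - y \<in> ideal_gen X"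

lemma ideal_rel_refl [simp]: "ideal_rel X x x"
  by (simp add: ideal_rel_def)

lemma ideal_rel_eqI: "x = y \<Longrightarrow> ideal_rel X x y"
  by simp

lemma equivp_ideal_rel: "equivp (ideal_rel X)"
proof (rule equivpI)
  show "reflp (ideal_rel X)" by (simp add: reflp_def)
  show "symp (ideal_rel X)"
    unfolding symp_def ideal_rel_def using ideal_gen_minus by fastforce
  show "transp (ideal_rel X)"
  proof (rule transpI)
    fix x y z assume "ideal_rel X x y" "ideal_rel X y z"
    then have "(x - y) + (y - z) \<in> ideal_gen X"
      unfolding ideal_rel_def by (rule ideal_gen_add)
    then show "ideal_rel X x z" by (simp add: ideal_rel_def)
  qed
qed

lemma ideal_rel_add: "ideal_rel X a b \<Longrightarrow> ideal_rel X c d \<Longrightarrow> ideal_rel X (a + c) (b + d)"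
  unfolding ideal_rel_def using ideal_gen_add[of "a - b" X "c - d"] by (simp add: algebra_simps)

lemma ideal_rel_minus: "ideal_rel X a b \<Longrightarrow> ideal_rel X (- a) (- b)"
  unfolding ideal_rel_def using ideal_gen_minus[of "a - b" X] by simp

lemma ideal_rel_diff: "ideal_rel X a b \<Longrightarrow> ideal_rel X c d \<Longrightarrow> ideal_rel X (a - c) (b - d)"
  using ideal_rel_add[OF _ ideal_rel_minus, of X a b c d] by simp

lemma ideal_rel_mult: "ideal_rel X a b \<Longrightarrow> ideal_rel X c d \<Longrightarrow> ideal_rel X (a * c) (b * d)"
proof -
  assume "ideal_rel X a b" "ideal_rel X c d"
  then have "(a - b) * c + b * (c - d) \<in> ideal_gen X"
    unfolding ideal_rel_def by (intro ideal_gen_add ideal_gen_lmult ideal_gen_rmult)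
  then show ?thesis by (simp add: ideal_rel_def algebra_simps)
qed


section \<open>Algebras over a field and free algebras\<close>

text \<open>
  The scalar structure of a unital \<open>'k\<close>-algebra is given by its structure map \<open>c\<close>,
  a ring homomorphism from \<open>'k\<close> into the centre; scalar multiplication is \<open>\<lambda>r x. c r * x\<close>.
\<close>

definition algebra_over :: "('k::field \<Rightarrow> 'a::ring_1) \<Rightarrow> bool" where
  "algebra_over c \<longleftrightarrow> c 1 = 1 \<and> (\<forall>r s. c (r + s) = c r + c s) \<and> (\<forall>r s. c (r * s) = c r * c s)
     \<and> (\<forall>r x. c r * x = x * c r)"

definition algebra_hom ::
    "('k::field \<Rightarrow> 'a::ring_1) \<Rightarrow> ('k \<Rightarrow> 'b::ring_1) \<Rightarrow> ('a \<Rightarrow> 'b) \<Rightarrow> bool" where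
  "algebra_hom c d f \<longleftrightarrow> f 1 = 1 \<and> (\<forall>x y. f (x + y) = f x + f y) \<and> (\<forall>x y. f (x * y) = f x * f y)
     \<and> (\<forall>r. f (c r) = d r)"

definition span_over :: "('k::field \<Rightarrow> 'a::ring_1) \<Rightarrow> 'a set \<Rightarrow> 'a set" where
  "span_over c = module.span (\<lambda>r x. c r * x)"

text \<open>
  Words form the free monoid, written additively because convolution on \<open>poly_mapping\<close> uses the
  addition of the index type. So \<open>'g list \<Rightarrow>\<^sub>0 'k\<close>, a ring by the library instances, is the free
  \<open>'k\<close>-algebra on \<open>'g\<close>.
\<close>

instantiation list :: (type) monoid_add
begin
definition zero_list :: "'a list" where "zero_list = []"
definition plus_list :: "'a list \<Rightarrow> 'a list \<Rightarrow> 'a list" where "plus_list = (@)"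
instance by standard (simp_all add: zero_list_def plus_list_def)
end

definition gen :: "'g \<Rightarrow> 'g list \<Rightarrow>\<^sub>0 'k::field" where
  "gen g = Poly_Mapping.single [g] 1"

definition const :: "'k::field \<Rightarrow> 'g list \<Rightarrow>\<^sub>0 'k" where
  "const r = Poly_Mapping.single [] r"

definition lincomb :: "('k::field \<Rightarrow> 'a::ring_1) \<Rightarrow> ('i \<Rightarrow> 'a) \<Rightarrow> ('i \<Rightarrow>\<^sub>0 'k) \<Rightarrow> 'a" where
  "lincomb c t p = (\<Sum>i\<in>Poly_Mapping.keys p. c (Poly_Mapping.lookup p i) * t i)"

text \<open>The algebra homomorphism from the free algebra extending a map on the generators.\<close>

definition free_eval :: "('k::field \<Rightarrow> 'a::ring_1) \<Rightarrow> ('g \<Rightarrow> 'a) \<Rightarrow> ('g list \<Rightarrow>\<^sub>0 'k) \<Rightarrow> 'a" where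
  "free_eval c f = lincomb c (\<lambda>ws. prod_list (map f ws))"

lemma algebra_overD:
  assumes "algebra_over c"
  shows "c 1 = 1" "c (r + s) = c r + c s" "c (r * s) = c r * c s" "c r * x = x * c r"
    "c 0 = 0" "c (- r) = - c r" "c (r - s) = c r - c s"
proof -
  show 1: "c 1 = 1" "c (r + s) = c r + c s" "c (r * s) = c r * c s" "c r * x = x * c r" for r s x
    using assms unfolding algebra_over_def by blast+
  show 0: "c 0 = 0" using 1(2)[of 0 0] by simp
  show m: "c (- r) = - c r" for r
    using minus_unique[of "c r" "c (- r)"] 1(2)[of r "- r"] 0 by (metis add.right_inverse)
  show "c (r - s) = c r - c s" using 1(2)[of r "- s"] unfolding m by simp
qed

lemma algebra_over_of_nat: "algebra_over c \<Longrightarrow> c (of_nat n) = of_nat n"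
  by (induction n) (simp_all add: algebra_overD(1,2,5))

lemma algebra_over_vector_space: "algebra_over c \<Longrightarrow> vector_space (\<lambda>r x. c r * x)"
  by unfold_locales (simp_all add: algebra_overD(1-3) distrib_left distrib_right mult.assoc)

lemma lincomb_superset:
  assumes "algebra_over c" "finite K" "Poly_Mapping.keys p \<subseteq> K"
  shows "lincomb c t p = (\<Sum>i\<in>K. c (Poly_Mapping.lookup p i) * t i)"
  unfolding lincomb_def using assms
  by (intro sum.mono_neutral_left) (auto simp: in_keys_iff algebra_overD(5))

lemma lincomb_add:
  assumes "algebra_over c"
  shows "lincomb c t (p + q) = lincomb c t p + lincomb c t q"
proof -
  let ?K = "Poly_Mapping.keys p \<union> Poly_Mapping.keys q"
  have K: "finite ?K" "Poly_Mapping.keys p \<subseteq> ?K" "Poly_Mapping.keys q \<subseteq> ?K"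
    "Poly_Mapping.keys (p + q) \<subseteq> ?K"
    by (simp_all add: Poly_Mapping.keys_add)
  show ?thesis
    unfolding lincomb_superset[OF assms K(1,2)] lincomb_superset[OF assms K(1,3)]
      lincomb_superset[OF assms K(1,4)]
    by (simp only: lookup_add algebra_overD(2)[OF assms] distrib_right sum.distrib)
qed

lemma lincomb_single:
  assumes "algebra_over c"
  shows "lincomb c t (Poly_Mapping.single i r) = c r * t i"
  by (subst lincomb_superset[OF assms, of "{i}"]) auto

lemma lincomb_0 [simp]: "lincomb c t 0 = 0"
  by (simp add: lincomb_def)

lemma lincomb_diff:
  assumes "algebra_over c"
  shows "lincomb c t (p - q) = lincomb c t p - lincomb c t q"
  unfolding eq_diff_eq lincomb_add[OF assms, symmetric] by simp

lemma lincomb_sum: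
  assumes "algebra_over c"
  shows "lincomb c t (\<Sum>x\<in>A. g x) = (\<Sum>x\<in>A. lincomb c t (g x))"
  by (induction A rule: infinite_finite_induct) (auto simp: lincomb_add[OF assms])

lemma poly_mapping_sum_single:
  "p = (\<Sum>i\<in>Poly_Mapping.keys p. Poly_Mapping.single i (Poly_Mapping.lookup p i))"
proof (rule poly_mapping_eqI)
  fix k
  have "(\<Sum>i\<in>Poly_Mapping.keys p. Poly_Mapping.lookup p i when i = k) = Poly_Mapping.lookup p k"
    by (cases "k \<in> Poly_Mapping.keys p") (auto simp: when_def in_keys_iff)
  then show "Poly_Mapping.lookup p k = Poly_Mapping.lookup
      (\<Sum>i\<in>Poly_Mapping.keys p. Poly_Mapping.single i (Poly_Mapping.lookup p i)) k"
    by (simp add: lookup_sum lookup_single)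
qed

lemma free_eval_mult:
  assumes c: "algebra_over c"
  shows "free_eval c f (p * q) = free_eval c f p * free_eval c f q"
proof -
  let ?P = "Poly_Mapping.lookup p" and ?Q = "Poly_Mapping.lookup q"
  have "p * q = (\<Sum>i\<in>Poly_Mapping.keys p. \<Sum>j\<in>Poly_Mapping.keys q.
      Poly_Mapping.single (i @ j) (?P i * ?Q j))"
    by (subst (1) poly_mapping_sum_single[of p], subst (1) poly_mapping_sum_single[of q])
      (simp add: sum_product mult_single plus_list_def)
  also have "free_eval c f \<dots> = (\<Sum>i\<in>Poly_Mapping.keys p. \<Sum>j\<in>Poly_Mapping.keys q.
      (c (?P i) * prod_list (map f i)) * (c (?Q j) * prod_list (map f j)))"
    unfolding free_eval_def lincomb_sum[OF c] lincomb_single[OF c]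
  proof (intro sum.cong refl)
    fix i j
    have "c (?Q j) * prod_list (map f i) = prod_list (map f i) * c (?Q j)"
      using algebra_overD(4)[OF c] .
    then show "c (?P i * ?Q j) * prod_list (map f (i @ j)) =
        c (?P i) * prod_list (map f i) * (c (?Q j) * prod_list (map f j))"
      by (simp add: algebra_overD(3)[OF c] mult.assoc) (simp flip: mult.assoc)
  qed
  also have "\<dots> = free_eval c f p * free_eval c f q"
    by (simp add: free_eval_def lincomb_def sum_product)
  finally show ?thesis .
qed

lemma single_Nil_eq: "Poly_Mapping.single [] r = (Poly_Mapping.single 0 r :: 'g list \<Rightarrow>\<^sub>0 'k::zero)"
  by (simp add: zero_list_def)

lemma algebra_over_const: "algebra_over (const :: 'k::field \<Rightarrow> 'g list \<Rightarrow>\<^sub>0 'k)"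
proof -
  have "const r * x = x * const r" for r and x :: "'g list \<Rightarrow>\<^sub>0 'k"
    by (subst (1 2) poly_mapping_sum_single[of x])
      (simp add: sum_distrib_left sum_distrib_right const_def single_Nil_eq mult_single mult.commute)
  then show ?thesis
    by (simp add: algebra_over_def const_def single_add single_Nil_eq mult_single)
qed

lemma free_eval_simps:
  assumes c: "algebra_over c"
  shows "free_eval c f 1 = 1" "free_eval c f 0 = 0"
    "free_eval c f (p + q) = free_eval c f p + free_eval c f q"
    "free_eval c f (p - q) = free_eval c f p - free_eval c f q"
    "free_eval c f (p * q) = free_eval c f p * free_eval c f q"
    "free_eval c f (const r) = c r" "free_eval c f (gen g) = f g"
proof -
  show const: "free_eval c f (const r) = c r" for r
    by (simp add: free_eval_def const_def lincomb_single[OF c])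
  show "free_eval c f 1 = 1"
    using const[of 1] algebra_overD(1)[OF c] algebra_overD(1)[OF algebra_over_const] by metis
  show "free_eval c f 0 = 0" by (simp add: free_eval_def)
  show "free_eval c f (gen g) = f g"
    by (simp add: free_eval_def gen_def lincomb_single[OF c] algebra_overD(1)[OF c])
qed (use c in \<open>simp_all add: free_eval_mult, simp_all add: free_eval_def lincomb_add lincomb_diff\<close>)

lemma free_eval_ideal_rel:
  assumes c: "algebra_over c" and X: "\<And>x. x \<in> X \<Longrightarrow> free_eval c f x = 0"
    and "ideal_rel X p q"
  shows "free_eval c f p = free_eval c f q"
proof -
  have "ideal_gen X \<subseteq> {x. free_eval c f x = 0}"
    by (rule ideal_gen_minimal) (use X in \<open>auto simp: two_sided_ideal_def free_eval_simps[OF c]\<close>)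
  then have "free_eval c f (p - q) = 0"
    using assms(3) by (auto simp: ideal_rel_def)
  then show ?thesis by (simp add: free_eval_simps[OF c])
qed

text \<open>The augmentation shows that relations without constant term give nonzero quotients.\<close>

lemma algebra_over_id: "algebra_over (id :: 'k::field \<Rightarrow> 'k)"
  by (simp add: algebra_over_def)

lemma not_ideal_rel_0_1:
  assumes "\<And>x. x \<in> X \<Longrightarrow> free_eval (id :: 'k::field \<Rightarrow> 'k) (\<lambda>_. 0) x = 0"
  shows "\<not> ideal_rel X 0 1"
proof
  assume "ideal_rel X 0 1"
  from free_eval_ideal_rel[OF algebra_over_id assms this]
  show False by (simp add: free_eval_simps[OF algebra_over_id])
qed


text \<open>Below only the quotient types are to be lifted, with \<open>poly_mapping\<close> kept abstract.\<close>

lifting_forget poly_mapping.lifting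

section \<open>The Jordan plane \<open>R\<close>\<close>

datatype jgen = Ju | Jv

definition jordan_rels :: "(jgen list \<Rightarrow>\<^sub>0 'k::field) set" where
  "jordan_rels = {gen Ju * gen Jv - gen Jv * gen Ju - gen Jv ^ 2}"

quotient_type (overloaded) 'k jordan = "jgen list \<Rightarrow>\<^sub>0 'k::field" / "ideal_rel jordan_rels"
  by (rule equivp_ideal_rel)

instantiation jordan :: (field) ring_1
begin
lift_definition zero_jordan :: "'a jordan" is 0 .
lift_definition one_jordan :: "'a jordan" is 1 .
lift_definition plus_jordan :: "'a jordan \<Rightarrow> 'a jordan \<Rightarrow> 'a jordan" is "(+)" by (rule ideal_rel_add)
lift_definition minus_jordan :: "'a jordan \<Rightarrow> 'a jordan \<Rightarrow> 'a jordan" is "(-)" by (rule ideal_rel_diff)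
lift_definition uminus_jordan :: "'a jordan \<Rightarrow> 'a jordan" is uminus by (rule ideal_rel_minus)
lift_definition times_jordan :: "'a jordan \<Rightarrow> 'a jordan \<Rightarrow> 'a jordan" is "(*)" by (rule ideal_rel_mult)
instance
proof
  have "\<not> ideal_rel jordan_rels 0 (1 :: jgen list \<Rightarrow>\<^sub>0 'a)"
    by (rule not_ideal_rel_0_1)
      (auto simp: jordan_rels_def free_eval_simps[OF algebra_over_id] power2_eq_square)
  then show "(0 :: 'a jordan) \<noteq> 1" by transfer
qed (transfer, rule ideal_rel_eqI, simp add: algebra_simps)+
end

lift_definition R_const :: "'k::field \<Rightarrow> 'k jordan" is const .
lift_definition R_u :: "'k::field jordan" is "gen Ju" .
lift_definition R_v :: "'k::field jordan" is "gen Jv" .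

text \<open>Homogeneous components and \<open>R\<^bsub>\<ge>m\<^esub>\<close>.\<close>

definition R_comp :: "nat \<Rightarrow> 'k::field jordan set" where
  "R_comp n = span_over R_const {prod_list xs | xs. set xs \<subseteq> {R_u, R_v} \<and> length xs = n}"

definition R_ge :: "nat \<Rightarrow> 'k::field jordan set" where
  "R_ge m = span_over R_const (\<Union>n\<in>{m..}. R_comp n)"

lemma algebra_over_R: "algebra_over (R_const :: 'k::field \<Rightarrow> 'k jordan)"
  unfolding algebra_over_def
  by (intro conjI allI; transfer; rule ideal_rel_eqI)
    (rule algebra_overD[OF algebra_over_const])+

lemma R_relation: "R_u * R_v - R_v * R_u - R_v ^ 2 = (0 :: 'k::field jordan)"
  unfolding power2_eq_square
  by transfer (simp add: ideal_rel_def, rule ideal_gen_inc, simp add: jordan_rels_def power2_eq_square)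


section \<open>The algebra \<open>S\<close>\<close>

datatype sgen = Su | Sv | Sw

definition S_rels :: "(sgen list \<Rightarrow>\<^sub>0 'k::field) set" where
  "S_rels = {gen Su * gen Sv - gen Sv * gen Su - gen Sv ^ 2,
             gen Su * gen Sw - gen Sw * gen Su - gen Sv * gen Sw,
             gen Sv * gen Sw - gen Sw * gen Sv}"

quotient_type (overloaded) 'k salg = "sgen list \<Rightarrow>\<^sub>0 'k::field" / "ideal_rel S_rels"
  by (rule equivp_ideal_rel)

instantiation salg :: (field) ring_1
begin
lift_definition zero_salg :: "'a salg" is 0 .
lift_definition one_salg :: "'a salg" is 1 .
lift_definition plus_salg :: "'a salg \<Rightarrow> 'a salg \<Rightarrow> 'a salg" is "(+)" by (rule ideal_rel_add)
lift_definition minus_salg :: "'a salg \<Rightarrow> 'a salg \<Rightarrow> 'a salg" is "(-)" by (rule ideal_rel_diff)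
lift_definition uminus_salg :: "'a salg \<Rightarrow> 'a salg" is uminus by (rule ideal_rel_minus)
lift_definition times_salg :: "'a salg \<Rightarrow> 'a salg \<Rightarrow> 'a salg" is "(*)" by (rule ideal_rel_mult)
instance
proof
  have "\<not> ideal_rel S_rels 0 (1 :: sgen list \<Rightarrow>\<^sub>0 'a)"
    by (rule not_ideal_rel_0_1)
      (auto simp: S_rels_def free_eval_simps[OF algebra_over_id] power2_eq_square)
  then show "(0 :: 'a salg) \<noteq> 1" by transfer
qed (transfer, rule ideal_rel_eqI, simp add: algebra_simps)+
end

lift_definition S_const :: "'k::field \<Rightarrow> 'k salg" is const .
lift_definition S_u :: "'k::field salg" is "gen Su" .
lift_definition S_v :: "'k::field salg" is "gen Sv" .
lift_definition S_w :: "'k::field salg" is "gen Sw" .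

lemma algebra_over_S: "algebra_over (S_const :: 'k::field \<Rightarrow> 'k salg)"
  unfolding algebra_over_def
  by (intro conjI allI; transfer; rule ideal_rel_eqI)
    (rule algebra_overD[OF algebra_over_const])+

lemma S_relations:
  "S_u * S_v - S_v * S_u - S_v ^ 2 = (0 :: 'k::field salg)"
  "S_u * S_w - S_w * S_u - S_v * S_w = (0 :: 'k::field salg)"
  "S_v * S_w - S_w * S_v = (0 :: 'k::field salg)"
  unfolding power2_eq_square
  by (transfer, simp add: ideal_rel_def, rule ideal_gen_inc, simp add: S_rels_def power2_eq_square)+


section \<open>The positive Witt algebra and its universal enveloping algebra\<close>

text \<open>
  Coordinates are shifted: index \<open>i\<close> belongs to the basis vector \<open>e\<^sub>n\<close> with \<open>n = i + 1\<close>, so that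
  the index type \<open>nat\<close> enumerates exactly the basis \<open>{e\<^sub>n}\<close>, \<open>n \<ge> 1\<close>.
\<close>

type_synonym 'k witt = "nat \<Rightarrow>\<^sub>0 'k"

definition witt_e :: "nat \<Rightarrow> 'k::field witt" where
  "witt_e n = Poly_Mapping.single (n - 1) 1"

definition witt_scale :: "'k::field \<Rightarrow> 'k witt \<Rightarrow> 'k witt" where
  "witt_scale r = Poly_Mapping.map ((*) r)"

definition witt_bracket :: "'k::field witt \<Rightarrow> 'k witt \<Rightarrow> 'k witt" where
  "witt_bracket x y = (\<Sum>i\<in>Poly_Mapping.keys x. \<Sum>j\<in>Poly_Mapping.keys y.
     Poly_Mapping.single (i + j + 1)
       ((of_nat j - of_nat i) * (Poly_Mapping.lookup x i * Poly_Mapping.lookup y j)))"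

lemma witt_bracket_e:
  assumes "n \<ge> 1" "m \<ge> 1"
  shows "witt_bracket (witt_e n) (witt_e m) =
    witt_scale (of_nat m - of_nat n) (witt_e (n + m) :: 'k::field witt)"
proof -
  obtain i j where "n = Suc i" "m = Suc j"
    using assms by (metis Suc_diff_1 less_eq_Suc_le One_nat_def)
  then show ?thesis
    by (simp add: witt_bracket_def witt_e_def witt_scale_def)
qed

text \<open>
  For a Lie algebra \<open>L\<close>, the free algebra on the underlying set of \<open>L\<close> modulo the first two
  families of relations is the tensor algebra \<open>T(L)\<close>; the third family cuts out \<open>U(L)\<close>.
\<close>

definition uea_rels ::
    "('k \<Rightarrow> 'l \<Rightarrow> 'l) \<Rightarrow> ('l \<Rightarrow> 'l \<Rightarrow> 'l) \<Rightarrow> ('l::ab_group_add list \<Rightarrow>\<^sub>0 'k::field) set" where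
  "uea_rels scl br =
     {gen (x + y) - (gen x + gen y) | x y. True} \<union>
     {gen (scl r x) - const r * gen x | r x. True} \<union>
     {gen x * gen y - gen y * gen x - gen (br x y) | x y. True}"

quotient_type (overloaded) 'k UW = "'k::field witt list \<Rightarrow>\<^sub>0 'k" /
    "ideal_rel (uea_rels witt_scale witt_bracket)"
  by (rule equivp_ideal_rel)

instantiation UW :: (field) ring_1
begin
lift_definition zero_UW :: "'a UW" is 0 .
lift_definition one_UW :: "'a UW" is 1 .
lift_definition plus_UW :: "'a UW \<Rightarrow> 'a UW \<Rightarrow> 'a UW" is "(+)" by (rule ideal_rel_add)
lift_definition minus_UW :: "'a UW \<Rightarrow> 'a UW \<Rightarrow> 'a UW" is "(-)" by (rule ideal_rel_diff)
lift_definition uminus_UW :: "'a UW \<Rightarrow> 'a UW" is uminus by (rule ideal_rel_minus)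
lift_definition times_UW :: "'a UW \<Rightarrow> 'a UW \<Rightarrow> 'a UW" is "(*)" by (rule ideal_rel_mult)
instance
proof
  have "\<not> ideal_rel (uea_rels witt_scale witt_bracket) 0 (1 :: 'a witt list \<Rightarrow>\<^sub>0 'a)"
    by (rule not_ideal_rel_0_1)
      (auto simp: uea_rels_def free_eval_simps[OF algebra_over_id])
  then show "(0 :: 'a UW) \<noteq> 1" by transfer
qed (transfer, rule ideal_rel_eqI, simp add: algebra_simps)+
end

lift_definition U_const :: "'k::field \<Rightarrow> 'k UW" is const .
lift_definition U_inj :: "'k::field witt \<Rightarrow> 'k UW" is gen .

definition e :: "nat \<Rightarrow> 'k::field UW" where
  "e n = U_inj (witt_e n)"

definition U_comp :: "nat \<Rightarrow> 'k::field UW set" where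
  "U_comp n = span_over U_const {prod_list (map e ns) | ns. (\<forall>i\<in>set ns. i \<ge> 1) \<and> sum_list ns = n}"

lemma algebra_over_U: "algebra_over (U_const :: 'k::field \<Rightarrow> 'k UW)"
  unfolding algebra_over_def
  by (intro conjI allI; transfer; rule ideal_rel_eqI)
    (rule algebra_overD[OF algebra_over_const])+

lemma U_inj_relations:
  fixes x y :: "'k::field witt"
  shows "U_inj (x + y) = U_inj x + U_inj y"
    "U_inj (witt_scale r x) = U_const r * U_inj x"
    "U_inj x * U_inj y - U_inj y * U_inj x = U_inj (witt_bracket x y)"
  by (transfer, unfold ideal_rel_def, rule ideal_gen_inc, unfold uea_rels_def, blast)+

lemma e_commutator:
  assumes "n \<ge> 1" "m \<ge> 1"
  shows "e n * e m - e m * e n = U_const (of_nat m - of_nat n) * (e (n + m) :: 'k::field UW)"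
  unfolding e_def U_inj_relations(3) witt_bracket_e[OF assms] U_inj_relations(2) ..

text \<open>
  A sequence \<open>t\<close> in an algebra satisfying the Witt relations extends to a homomorphism from
  the enveloping algebra; \<open>t i\<close> is the image of \<open>e\<^sub>n\<close> with \<open>n = i + 1\<close>.
\<close>

lemma uea_lift_respects:
  fixes c :: "'k::field \<Rightarrow> 'a::ring_1"
  assumes c: "algebra_over c"
    and t: "\<And>i j. t i * t j - t j * t i = c (of_nat j - of_nat i) * t (i + j + 1)"
    and rel: "ideal_rel (uea_rels witt_scale witt_bracket) p q"
  shows "free_eval c (lincomb c t) p = free_eval c (lincomb c t) q"
proof (rule free_eval_ideal_rel[OF c _ rel])
  note [simp] = free_eval_simps[OF c] lincomb_add[OF c]
  have scl: "lincomb c t (witt_scale r x) = c r * lincomb c t x" for r x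
  proof -
    have "lincomb c t (witt_scale r x) =
        (\<Sum>i\<in>Poly_Mapping.keys x. c (Poly_Mapping.lookup (witt_scale r x) i) * t i)"
      by (rule lincomb_superset[OF c]) (auto simp: witt_scale_def in_keys_iff map.rep_eq when_def)
    also have "\<dots> = c r * lincomb c t x"
      unfolding lincomb_def sum_distrib_left
      by (rule sum.cong) (auto simp: witt_scale_def map.rep_eq in_keys_iff when_def algebra_overD(3)[OF c] mult.assoc)
    finally show ?thesis .
  qed
  have br: "lincomb c t (witt_bracket x y) =
      lincomb c t x * lincomb c t y - lincomb c t y * lincomb c t x" for x y
  proof -
    let ?X = "Poly_Mapping.lookup x" and ?Y = "Poly_Mapping.lookup y"
    have "(c (?X i) * t i) * (c (?Y j) * t j) - (c (?Y j) * t j) * (c (?X i) * t i) =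
        c ((of_nat j - of_nat i) * (?X i * ?Y j)) * t (i + j + 1)" for i j
    proof -
      have swap: "(c r * x) * (c s * y) = c (r * s) * (x * y)" for r s x y
      proof -
        have "(c r * x) * (c s * y) = c r * (x * c s) * y" by (simp only: mult.assoc)
        also have "x * c s = c s * x" by (rule algebra_overD(4)[OF c, symmetric])
        finally show ?thesis by (simp only: algebra_overD(3)[OF c] mult.assoc)
      qed
      have "(c (?X i) * t i) * (c (?Y j) * t j) - (c (?Y j) * t j) * (c (?X i) * t i) =
          c (?X i * ?Y j) * (t i * t j - t j * t i)"
        by (simp only: swap mult.commute[of "?Y j" "?X i"] right_diff_distrib)
      also have "\<dots> = c ((?X i * ?Y j) * (of_nat j - of_nat i)) * t (i + j + 1)"
        unfolding t by (simp only: algebra_overD(3)[OF c] mult.assoc)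
      finally show ?thesis by (simp only: mult.commute[of "?X i * ?Y j"])
    qed
    moreover have "lincomb c t y * lincomb c t x =
       (\<Sum>i\<in>Poly_Mapping.keys x. \<Sum>j\<in>Poly_Mapping.keys y. (c (?Y j) * t j) * (c (?X i) * t i))"
      unfolding lincomb_def sum_product by (rule sum.swap)
    ultimately show ?thesis
      unfolding witt_bracket_def lincomb_sum[OF c] lincomb_single[OF c]
      by (simp add: lincomb_def sum_product flip: sum_subtractf)
  qed
  fix z :: "'k witt list \<Rightarrow>\<^sub>0 'k" assume "z \<in> uea_rels witt_scale witt_bracket"
  then show "free_eval c (lincomb c t) z = 0"
    by (auto simp: uea_rels_def scl br)
qed

text \<open>
  One computation makes all the maps below well defined: \<open>\<lambda>\<^sub>a\<close> is the case \<open>w = a v\<close> inside \<open>R\<close>.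
\<close>

lemma witt_relations:
  fixes u v w :: "'a::ring_1"
  assumes uv: "u * v - v * u - v ^ 2 = 0" and uw: "u * w - w * u - v * w = 0"
    and vw: "v * w - w * v = 0"
  defines "t \<equiv> \<lambda>i::nat. (u - of_nat i * w) * v ^ i"
  shows "t i * t j - t j * t i = (of_nat j - of_nat i) * t (i + j + 1)"
proof -
  have vw': "v ^ i * w = w * v ^ i" for i
    using vw by (simp add: power_commuting_commutes)
  have vu: "v ^ i * u = u * v ^ i - of_nat i * v ^ Suc i" for i
  proof (induction i)
    case (Suc i)
    have "v ^ Suc i * u = v * (v ^ i * u)" by (simp add: mult.assoc)
    also have "\<dots> = (v * u) * v ^ i - of_nat i * v ^ Suc (Suc i)"
    proof -
      have "v * (of_nat i * v ^ Suc i) = of_nat i * v ^ Suc (Suc i)"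
        by (metis mult.assoc mult_of_nat_commute power_Suc)
      then show ?thesis by (simp only: Suc right_diff_distrib mult.assoc)
    qed
    also have "v * u = u * v - v * v" using uv by (simp add: power2_eq_square algebra_simps)
    finally show ?case by (simp add: algebra_simps)
  qed simp
  have tt: "t i * t j = ((u - of_nat i * w) * (u - of_nat j * w - of_nat i * v)) * v ^ (i + j)" for i j
  proof -
    have "v ^ i * (u - of_nat j * w) = (u - of_nat j * w - of_nat i * v) * v ^ i"
    proof -
      have "v ^ i * (of_nat j * w) = of_nat j * w * v ^ i"
        using vw'[of i] by (metis mult.assoc mult_of_nat_commute)
      then show ?thesis by (simp add: algebra_simps vu)
    qed
    then have "t i * t j = (u - of_nat i * w) * ((u - of_nat j * w - of_nat i * v) * v ^ i) * v ^ j"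
      unfolding t_def by (metis mult.assoc)
    then show ?thesis by (simp add: mult.assoc power_add)
  qed
  define I J where "I = (of_nat i :: 'a)" and "J = (of_nat j :: 'a)"
  have comm0: "x * I = I * x" "x * J = J * x" for x
    unfolding I_def J_def by (rule mult_of_nat_commute[symmetric])+
  have comm1: "x * (I * y) = I * (x * y)" "x * (J * y) = J * (x * y)" for x y
    by (metis comm0 mult.assoc)+
  note comm = comm0[of u] comm0[of v] comm0[of w] comm0(1)[of J]
    comm1[of u] comm1[of v] comm1[of w] comm1(1)[of J]
  have uw': "u * w = w * u + w * v" and vw'': "v * w = w * v" and uv': "u * v = v * u + v * v"
    using uw vw uv by (simp_all add: algebra_simps power2_eq_square)
  have key: "(u - I * w) * (u - J * w - I * v) - (u - J * w) * (u - I * w - J * v) =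
      (J - I) * (u - (I + J + 1) * w) * v"
    by (simp add: left_diff_distrib right_diff_distrib distrib_left distrib_right mult.assoc comm uw' vw'' uv')
  have "t i * t j - t j * t i =
      ((u - I * w) * (u - J * w - I * v) - (u - J * w) * (u - I * w - J * v)) * v ^ (i + j)"
    unfolding tt I_def J_def by (simp add: left_diff_distrib add.commute[of j i])
  also have "\<dots> = (J - I) * t (i + j + 1)"
    unfolding key t_def by (simp add: I_def J_def mult.assoc add_ac)
  finally show ?thesis unfolding I_def J_def .
qed

lift_definition phi :: "'k::field UW \<Rightarrow> 'k salg" is
  "free_eval S_const (lincomb S_const (\<lambda>i. (S_u - of_nat i * S_w) * S_v ^ i))"
  by (rule uea_lift_respects[OF algebra_over_S])
    (simp_all only: witt_relations[OF S_relations] algebra_overD(7)[OF algebra_over_S]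
      algebra_over_of_nat[OF algebra_over_S])

lemma lam_relations:
  fixes a :: "'k::field"
  defines "t \<equiv> \<lambda>i. (R_u - of_nat i * (R_const a * R_v)) * R_v ^ i"
  shows "t i * t j - t j * t i = R_const (of_nat j - of_nat i) * t (i + j + 1)"
proof -
  have c: "x * (R_const a * y) = R_const a * (x * y)" for x y :: "'k jordan"
    using algebra_overD(4)[OF algebra_over_R, of a x] by (simp flip: mult.assoc)
  have "R_u * (R_const a * R_v) - (R_const a * R_v) * R_u - R_v * (R_const a * R_v) =
      R_const a * (R_u * R_v - R_v * R_u - R_v ^ 2)"
    unfolding c by (simp only: right_diff_distrib power2_eq_square mult.assoc)
  then have 1: "R_u * (R_const a * R_v) - (R_const a * R_v) * R_u - R_v * (R_const a * R_v) = 0"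
    by (simp only: R_relation mult_zero_right)
  have 2: "R_v * (R_const a * R_v) - (R_const a * R_v) * R_v = 0"
    unfolding c by (simp only: mult.assoc diff_self)
  show ?thesis
    unfolding t_def witt_relations[OF R_relation 1 2]
    by (simp only: algebra_overD(7)[OF algebra_over_R] algebra_over_of_nat[OF algebra_over_R])
qed

lift_definition lam :: "'k::field \<Rightarrow> 'k UW \<Rightarrow> 'k jordan" is
  "\<lambda>a. free_eval R_const (lincomb R_const (\<lambda>i. (R_u - of_nat i * (R_const a * R_v)) * R_v ^ i))"
  by (rule uea_lift_respects[OF algebra_over_R lam_relations])

lemma algebra_hom_phi: "algebra_hom U_const S_const (phi :: 'k::field UW \<Rightarrow> 'k salg)"
proof -
  note [simp] = free_eval_simps[OF algebra_over_S]
  have "phi (x + y) = phi x + phi y" for x y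
    by (induct x rule: UW.abs_induct, induct y rule: UW.abs_induct) (simp add: plus_UW.abs_eq phi.abs_eq)
  moreover have "phi (x * y) = phi x * phi y" for x y
    by (induct x rule: UW.abs_induct, induct y rule: UW.abs_induct) (simp add: times_UW.abs_eq phi.abs_eq)
  moreover have "phi 1 = 1" "phi (U_const r) = S_const r" for r
    by (simp_all add: one_UW.abs_eq U_const.abs_eq phi.abs_eq)
  ultimately show ?thesis by (simp only: algebra_hom_def) blast
qed

lemma phi_e: "n \<ge> 1 \<Longrightarrow> phi (e n :: 'k::field UW) = (S_u - of_nat (n - 1) * S_w) * S_v ^ (n - 1)"
  by (simp only: e_def witt_e_def U_inj.abs_eq phi.abs_eq free_eval_simps[OF algebra_over_S]
      lincomb_single[OF algebra_over_S] algebra_overD(1)[OF algebra_over_S] mult_1_left)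

lemma algebra_hom_lam: "algebra_hom U_const R_const (lam a :: 'k::field UW \<Rightarrow> 'k jordan)"
proof -
  note [simp] = free_eval_simps[OF algebra_over_R]
  have "lam a (x + y) = lam a x + lam a y" for x y
    by (induct x rule: UW.abs_induct, induct y rule: UW.abs_induct) (simp add: plus_UW.abs_eq lam.abs_eq)
  moreover have "lam a (x * y) = lam a x * lam a y" for x y
    by (induct x rule: UW.abs_induct, induct y rule: UW.abs_induct) (simp add: times_UW.abs_eq lam.abs_eq)
  moreover have "lam a 1 = 1" "lam a (U_const r) = R_const r" for r
    by (simp_all add: one_UW.abs_eq U_const.abs_eq lam.abs_eq)
  ultimately show ?thesis by (simp only: algebra_hom_def) blast
qed

lemma lam_e: "n \<ge> 1 \<Longrightarrow> lam a (e n :: 'k::field UW) = (R_u - of_nat (n - 1) * R_const a * R_v) * R_v ^ (n - 1)"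
  by (simp only: e_def witt_e_def U_inj.abs_eq lam.abs_eq free_eval_simps[OF algebra_over_R]
      lincomb_single[OF algebra_over_R] algebra_overD(1)[OF algebra_over_R] mult_1_left mult.assoc)

section \<open>The kernel generators\<close>

definition h1 :: "'k::field \<Rightarrow> 'k UW" where
  "h1 a = e 1 * e 2 ^ 2 - e 1 ^ 2 * e 3 - U_const (2 * a) * e 2 * e 3
     + U_const (1 + 2 * a) * e 1 * e 4 - U_const (a ^ 2 + a) * e 5"

definition h2 :: "'k::field UW" where
  "h2 = e 1 * e 5 - 4 * e 2 * e 4 + 3 * e 3 ^ 2 + 2 * e 6"

definition h3 :: "'k::field \<Rightarrow> 'k UW" where
  "h3 a = - 4 * e 1 ^ 2 * e 2 ^ 2 - 4 * e 2 ^ 3 + 4 * e 1 ^ 3 * e 3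
     + U_const (20 * a ^ 2 + 14 * a - 7) * e 3 ^ 2
     - U_const (16 * a ^ 2 + 18 * a + 5) * e 1 * e 5
     + U_const (16 * a ^ 3 + 36 * a ^ 2 + 16 * a - 2) * e 6"

end

theory Submission
  imports Defs "HOL-Computational_Algebra.Polynomial"
begin

text \<open>
  Write \<open>x\<^sub>i = e\<^bsub>i+1\<^esub>\<close> and \<open>G i j = x\<^sub>i x\<^sub>j - x\<^sub>0 x\<^bsub>i+j\<^esub> + i x\<^bsub>i+j+1\<^esub>\<close>. Under \<open>\<phi>\<close> the element \<open>G i j\<close> goes to
  \<open>i j (w\<^sup>2 - w v) v\<^bsup>i+j\<^esup>\<close>, hence under \<open>\<lambda>\<^sub>a\<close> to \<open>i j a (a - 1) v\<^bsup>i+j+2\<^esup>\<close>. The derivations \<open>ad x\<^sub>0\<close> and \<open>ad x\<^sub>1\<close>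
  preserve the span of the \<open>G i j\<close>, so a single quadratic relation in low degree propagates to all
  degrees: \<open>G 1 1\<close> forces all \<open>G i j\<close>, and \<open>h\<^sub>2 = 3 G 2 2 - 4 G 1 3\<close> forces \<open>(n - 1) G i j = i j G 1 (n - 1)\<close>
  for \<open>i + j = n\<close>. For \<open>a \<noteq> 0, 1\<close>, the elements \<open>h\<^sub>1\<close> and \<open>h\<^sub>3\<close> express \<open>x\<^sub>0 G 1 1\<close> and \<open>x\<^sub>1 G 1 1\<close> by shorter
  words, and this propagates likewise. Modulo the relations, \<open>U(W\<^sub>+)\<close> is therefore spanned by a small
  family of monomials; their images are linearly independent because, in the representations on
  sequences where \<open>e\<^sub>n\<close> acts by \<open>(e\<^sub>n g)(m) = (X - m - (n-1) Y) g(m + n)\<close>, they give polynomials of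
  pairwise distinct degrees in each weight.

  For the noetherian property, the Jordan plane is noetherian by the Hilbert basis argument, and the
  annihilator of \<open>u\<close> in a finitely generated \<open>R\<close>-module is finite-dimensional in characteristic 0; this
  controls the one-sided ideals of \<open>k + uR\<close> and \<open>k + Ru\<close>. For \<open>a \<noteq> 0, 1\<close> the image has finite codimension.
\<close>

section \<open>Quadratic relations in the enveloping algebra\<close>

text \<open>In characteristic 0 the algebra is generated by \<open>x 0\<close> and
  \<open>x 1\<close>; hence only the derivations and the left multiplications of these two elements
  have to be controlled. The case distinction on \<open>a\<close> comes from the factor
  \<open>a (a - 1)\<close> in the image of \<open>G i j\<close>. When it vanishes, all
  \<open>G i j\<close> are relations. Otherwise they survive as multiples of powers of
  \<open>v\<close>, and the quadratic relations alone do not reduce products such as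
  \<open>x 0 * G 1 1\<close>. The elements \<open>h1\<close> and \<open>h3\<close> are the cubic and
  quartic relations that do this, with coefficients found by matching images in \<open>R\<close>.

  For the noetherian property the obstacle is that a left ideal of \<open>k + uR\<close> or
  \<open>k + Ru\<close> is not an ideal of \<open>R\<close>: generators over \<open>R\<close> come
  with coefficients outside the subring. A factor \<open>u\<close> forces the coefficients into the
  subring, and the annihilator bound shows that cancelling this \<open>u\<close> again costs only
  finitely many dimensions. Right ideals are handled in the opposite ring, which is again a Jordan
  plane with \<open>- v\<close> in the role of \<open>v\<close>.\<close>

abbreviation scl :: "'k::field \<Rightarrow> 'k UW \<Rightarrow> 'k UW"  (infixr "\<cdot>" 75) where
  "r \<cdot> z \<equiv> U_const r * z"

abbreviation x :: "nat \<Rightarrow> 'k::field UW" where "x i \<equiv> e (Suc i)"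

section \<open>Derivations and the quadratic elements \<open>G\<close>\<close>

definition ad :: "'a::ring_1 \<Rightarrow> 'a \<Rightarrow> 'a" where "ad a b = a * b - b * a"

lemma ad_simps:
  "ad a (b + d) = ad a b + ad a d" "ad a (b - d) = ad a b - ad a d"
  "ad a (b * d) = ad a b * d + b * ad a d" 
  for a b d :: "'a::ring_1"
  by (simp_all add: ad_def algebra_simps)

lemmas U_const_simps = algebra_overD(1,2,5,6,7)[OF algebra_over_U]
lemmas U_comm = algebra_overD(4)[OF algebra_over_U, symmetric]

lemma U_comm2: "z * (U_const r * y) = U_const r * (z * y)"
  by (metis U_comm mult.assoc)

lemma ad_scl: "ad z (r \<cdot> y) = r \<cdot> ad z y"
  by (simp add: ad_def right_diff_distrib U_comm2 mult.assoc)

lemma ad_U_const: "ad z (U_const r) = 0"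
  by (simp add: ad_def U_comm)

lemma ad_x: "ad (x i) (x j) = (of_nat j - of_nat i) \<cdot> x (i + j + 1)"
  using e_commutator[of "Suc i" "Suc j"] by (simp add: ad_def)

lemma U_scale_simps:
  "e n * U_const r = r \<cdot> e n" "e n * (r \<cdot> z) = r \<cdot> (e n * z)"
  "U_const r * U_const s = U_const (r * s)" "r \<cdot> (s \<cdot> z) = (r * s) \<cdot> z"
  by (rule U_comm U_comm2)+ (simp_all only: algebra_overD(3)[OF algebra_over_U] mult.assoc)

text \<open>The linear term is the one that makes \<open>G i j\<close> symmetric, by absorbing the
  commutator of \<open>x i\<close> and \<open>x j\<close>. It also gives \<open>G 0 j = 0\<close>,
  so \<open>G i j\<close> measures how far \<open>x i * x j\<close> is from being expressed through
  \<open>x 0 * x (i + j)\<close>.\<close>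

definition G :: "nat \<Rightarrow> nat \<Rightarrow> 'k::field UW" where
  "G i j = x i * x j - x 0 * x (i + j) + of_nat i \<cdot> x (i + j + 1)"

lemma ad_x0_G: "ad (x 0) (G i j) = of_nat i \<cdot> G (Suc i) j + of_nat j \<cdot> G i (Suc j)"
  by (simp add: G_def ad_simps(1,2) ad_scl ad_simps(3) ad_U_const ad_x U_scale_simps U_const_simps algebra_simps)

lemma scl_two: "(r * 2) \<cdot> z = r \<cdot> z + r \<cdot> z" "2 \<cdot> z = z + z"
proof -
  show *: "(r * 2) \<cdot> z = r \<cdot> z + r \<cdot> z" for r and z :: "'a UW"
    unfolding numeral_Bit0 numeral_One by (simp only: distrib_left distrib_right mult_1_right U_const_simps)
  show "2 \<cdot> z = z + z" using *[of 1 z] by (simp add: U_const_simps)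
qed

text \<open>The last summand comes from the fixed factor \<open>x 0\<close> inside \<open>G\<close>:
  \<open>ad (x 1) (x 0) = - x 2\<close> leaves the product \<open>x 2 * x (i + j)\<close>, whatever
  \<open>i\<close> and \<open>j\<close> are.\<close>

lemma ad_x1_G: "ad (x 1) (G i j) = (of_nat i - 1) \<cdot> G (i + 2) j + (of_nat j - 1) \<cdot> G i (j + 2)
   + G 2 (i + j)"
  by (simp add: G_def ad_simps(1,2) ad_scl ad_simps(3) ad_U_const ad_x U_scale_simps U_const_simps algebra_simps
    scl_two eval_nat_numeral)

lemma G_0_left: "G 0 j = 0" by (simp add: G_def U_const_simps)

lemma G_sym: "G i j = G j i"
proof -
  have "G i j - G j i = ad (x i) (x j) + (of_nat i - of_nat j) \<cdot> x (i + j + 1)"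
    by (simp add: G_def ad_def U_const_simps algebra_simps)
  also have "\<dots> = 0" unfolding ad_x by (simp add: U_const_simps algebra_simps)
  finally show ?thesis by simp
qed

lemma numeral_mult_expand: "2 * z = z + z" "3 * z = z + z + z" "4 * z = z + z + z + z" for z :: "'a::ring_1"
  by (simp_all only: numeral_Bit0 numeral_Bit1 numeral_One distrib_right mult_1_left add.assoc)

lemma U_const_numeral: "U_const (numeral k) = numeral k"
  using algebra_over_of_nat[OF algebra_over_U, of "numeral k"] by simp

lemma h2_G: "h2 = 3 * G 2 2 - 4 * G 1 3"
  by (simp add: G_def h2_def U_const_numeral numeral_mult_expand algebra_simps power2_eq_square eval_nat_numeral U_const_simps)

text \<open>Linear identities between fixed elements \<open>gs\<close> are checked on coefficient lists.\<close>

lemma coefficient_lists: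
  fixes gs :: "'k::field UW list"
  obtains V :: "'k list \<Rightarrow> 'k UW"
  where "\<And>as bs. length as = length bs \<Longrightarrow> V as + V bs = V (map2 (+) as bs)"
    "\<And>as bs. length as = length bs \<Longrightarrow> V as - V bs = V (map2 (-) as bs)"
    "\<And>r as. r \<cdot> V as = V (map ((*) r) as)"
    "\<And>k. k < length gs \<Longrightarrow> gs ! k = V (map (\<lambda>l. if l = k then 1 else 0) [0..<length gs])"
proof
  define V where "V as = (\<Sum>k<length gs. (if k < length as then as ! k else 0) \<cdot> gs ! k)" for as :: "'k list"
  show "V as + V bs = V (map2 (+) as bs)" "V as - V bs = V (map2 (-) as bs)" if "length as = length bs" for as bs
    unfolding V_def using that
    by (auto simp flip: sum.distrib sum_subtractf simp: U_const_simps algebra_simps intro!: sum.cong)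
  show "r \<cdot> V as = V (map ((*) r) as)" for r as
    unfolding V_def sum_distrib_left by (auto intro!: sum.cong simp: U_scale_simps U_const_simps)
  show "gs ! k = V (map (\<lambda>l. if l = k then 1 else 0) [0..<length gs])" if "k < length gs" for k
  proof -
    have "V (map (\<lambda>l. if l = k then 1 else 0) [0..<length gs]) = (\<Sum>l<length gs. if l = k then gs ! l else 0)"
      unfolding V_def by (rule sum.cong) (auto simp: U_const_simps)
    then show ?thesis using that by simp
  qed
qed

lemma coefficient_lists_4:
  fixes g1 g2 g3 g4 :: "'k::field UW"
  obtains V :: "'k list \<Rightarrow> 'k UW"
  where "\<And>as bs. length as = length bs \<Longrightarrow> V as + V bs = V (map2 (+) as bs)"
    "\<And>as bs. length as = length bs \<Longrightarrow> V as - V bs = V (map2 (-) as bs)"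
    "\<And>r as. r \<cdot> V as = V (map ((*) r) as)"
    "g1 = V [1,0,0,0]" "g2 = V [0,1,0,0]" "g3 = V [0,0,1,0]" "g4 = V [0,0,0,1]"
proof -
  obtain V :: "'k list \<Rightarrow> 'k UW" where V: "\<And>as bs. length as = length bs \<Longrightarrow> V as + V bs = V (map2 (+) as bs)"
    "\<And>as bs. length as = length bs \<Longrightarrow> V as - V bs = V (map2 (-) as bs)"
    "\<And>r as. r \<cdot> V as = V (map ((*) r) as)"
    and g: "\<And>k. k < length [g1,g2,g3,g4] \<Longrightarrow> [g1,g2,g3,g4] ! k = V (map (\<lambda>l. if l = k then 1 else 0) [0..<length [g1,g2,g3,g4]])"
    by (rule coefficient_lists[of "[g1,g2,g3,g4]"]) blast
  show thesis
    by (rule that[OF V]) (use g[of 0] g[of 1] g[of 2] g[of 3] in \<open>simp_all add: upt_rec numeral_2_eq_2 numeral_3_eq_3\<close>)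
qed

text \<open>Read \<open>N\<close> as \<open>n\<close> and \<open>g1\<close>, ..., \<open>g4\<close>
  as \<open>G k (n - k)\<close>. The first two relations arise from \<open>ad (x 0)\<close> on the
  index pairs \<open>(2, n - 3)\<close> and \<open>(3, n - 4)\<close>, the third from
  \<open>ad (x 1)\<close> on \<open>(2, n - 4)\<close>. The multipliers are chosen to cancel
  \<open>g3\<close> and \<open>g4\<close>, which leaves a relation between \<open>g2\<close> and
  \<open>g1\<close> alone.\<close>

lemma eliminate_higher_G:
  fixes g1 g2 g3 g4 :: "'k::field UW" and N :: 'k
  shows "(- (N-4)*(N-3)) \<cdot> ((N-2) \<cdot> (2 \<cdot> g3 + (N-3) \<cdot> g2) - (2*(N-3)) \<cdot> (g2 + (N-2) \<cdot> g1)) +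
     (2*(N-3)) \<cdot> ((N-2) \<cdot> (3 \<cdot> g4 + (N-4) \<cdot> g3) - (3*(N-4)) \<cdot> (g2 + (N-2) \<cdot> g1)) -
     (6*(N-2)) \<cdot> ((N-3) \<cdot> (g4 + (N-5) \<cdot> g2 + g2) - (2*(N-4)) \<cdot> ((N-4) \<cdot> g1 + g2)) =
     (- (N-4)*(N^2-3*N-6)) \<cdot> ((N-1) \<cdot> g2 - (2*(N-2)) \<cdot> g1)"
proof -
  obtain V :: "'k list \<Rightarrow> 'k UW" where V:
    "\<And>as bs. length as = length bs \<Longrightarrow> V as + V bs = V (map2 (+) as bs)"
    "\<And>as bs. length as = length bs \<Longrightarrow> V as - V bs = V (map2 (-) as bs)"
    "\<And>r as. r \<cdot> V as = V (map ((*) r) as)"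
    and g: "g1 = V [1,0,0,0]" "g2 = V [0,1,0,0]" "g3 = V [0,0,1,0]" "g4 = V [0,0,0,1]"
    by (rule coefficient_lists_4[of g1 g2 g3 g4]) blast
  show ?thesis unfolding g
    by (simp only: V(1-3) list.map zip.simps list.case prod.case length_Cons list.size refl)
      (simp add: algebra_simps power2_eq_square)
qed

text \<open>Induction step on the first index: read \<open>A = G (i + 1) (n - i - 1)\<close>,
  \<open>B = G i (n - i)\<close>, \<open>C = G 2 (n - 2)\<close>, \<open>D = G 1 (n - 1)\<close>.
  The relation produced by \<open>ad (x 0)\<close> involves all four; the known relations of
  \<open>B\<close> and of \<open>C\<close> with \<open>D\<close> remove \<open>B\<close> and
  \<open>C\<close>.\<close>

lemma combine_G_relations:
  fixes A B C D :: "'k::field UW" and N :: 'k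
  shows "(N-1) \<cdot> ((N - 2) \<cdot> (i \<cdot> A + (N-1-i) \<cdot> B) - (i * (N-1-i)) \<cdot> (C + (N - 2) \<cdot> D))
      - ((N-2)*(N-1-i)) \<cdot> ((N - 1) \<cdot> B - (i * (N - i)) \<cdot> D)
      + (i * (N-1-i)) \<cdot> ((N-1) \<cdot> C - (2*(N-2)) \<cdot> D) =
    ((N - 2) * i) \<cdot> ((N-1) \<cdot> A - ((i + 1) * (N-1-i)) \<cdot> D)"
proof -
  obtain V :: "'k list \<Rightarrow> 'k UW" where V:
    "\<And>as bs. length as = length bs \<Longrightarrow> V as + V bs = V (map2 (+) as bs)"
    "\<And>as bs. length as = length bs \<Longrightarrow> V as - V bs = V (map2 (-) as bs)"
    "\<And>r as. r \<cdot> V as = V (map ((*) r) as)"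
    and g: "A = V [1,0,0,0]" "B = V [0,1,0,0]" "C = V [0,0,1,0]" "D = V [0,0,0,1]"
    by (rule coefficient_lists_4[of A B C D]) blast
  show ?thesis unfolding g
    by (simp only: V(1-3) list.map zip.simps list.case prod.case length_Cons list.size refl)
      (simp add: algebra_simps power2_eq_square)
qed

section \<open>Propagation of quadratic relations to all index sums\<close>

lemma ideal_closed:
  assumes "two_sided_ideal I"
  shows "0 \<in> I" "a \<in> I \<Longrightarrow> b \<in> I \<Longrightarrow> a + b \<in> I" "a \<in> I \<Longrightarrow> r * a \<in> I" "a \<in> I \<Longrightarrow> a * r \<in> I"
    "a \<in> I \<Longrightarrow> - a \<in> I"  "a \<in> I \<Longrightarrow> b \<in> I \<Longrightarrow> a - b \<in> I" "a \<in> I \<Longrightarrow> ad r a \<in> I"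
proof -
  show 1: "0 \<in> I" "a \<in> I \<Longrightarrow> b \<in> I \<Longrightarrow> a + b \<in> I" "a \<in> I \<Longrightarrow> r * a \<in> I" "a \<in> I \<Longrightarrow> a * r \<in> I" for a b r
    using assms by (auto simp: two_sided_ideal_def)
  show 2: "a \<in> I \<Longrightarrow> - a \<in> I" for a using 1(3)[of a "-1"] by simp
  show 3: "a \<in> I \<Longrightarrow> b \<in> I \<Longrightarrow> a - b \<in> I" for a b using 1(2)[of a "- b"] 2 by simp
  show "a \<in> I \<Longrightarrow> ad r a \<in> I" unfolding ad_def by (intro 3 1)
qed

lemma ideal_scl_cancel:
  assumes "two_sided_ideal I" "r \<cdot> a \<in> I" "r \<noteq> 0"
  shows "a \<in> I"
proof -
  have "inverse r \<cdot> (r \<cdot> a) \<in> I" using assms(1,2) by (rule ideal_closed)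
  then show ?thesis using assms(3) by (simp add: U_scale_simps U_const_simps)
qed

lemma G_0_right: "G i 0 = 0" by (subst G_sym) (rule G_0_left)

text \<open>Strong induction on the index sum \<open>n\<close>. Since \<open>G\<close> is symmetric
  and vanishes at index 0, nothing is to be shown when an index is at most 1; below
  \<open>n = 5\<close> this leaves only the pair \<open>(2, 2)\<close>, where the claim is
  \<open>h2\<close> itself. From \<open>n = 5\<close> on, the pair \<open>(2, n - 2)\<close> is
  settled first by elimination, and larger first indices follow one by one.\<close>

lemma G_multiple_mem:
  fixes I :: "'k::field_char_0 UW set"
  assumes I: "two_sided_ideal I" and h2: "h2 \<in> I" and "i + j = n" "n \<ge> 2"
  shows "(of_nat n - 1) \<cdot> G i j - (of_nat i * of_nat j) \<cdot> G 1 (n - 1) \<in> I"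
  using assms(3-)
proof (induction n arbitrary: i j rule: less_induct)
  case (less n)
  note cl = ideal_closed[OF I]
  have triv: "(of_nat n - 1) \<cdot> G i j - (of_nat i * of_nat j) \<cdot> G 1 (n - 1) \<in> I"
    if "i + j = n" "i \<le> 1 \<or> j \<le> 1" for i j
  proof -
    have "i = 0 \<or> j = 0 \<or> i = 1 \<or> j = 1" using that by linarith
    moreover have "G (n - 1) 1 = (G 1 (n - 1) :: 'k UW)" by (rule G_sym)
    ultimately show ?thesis
      using that \<open>2 \<le> n\<close> cl(1) by (elim disjE) (auto simp: G_0_left G_0_right U_const_simps of_nat_diff)
  qed
  have stepE: "(of_nat n - 2) \<cdot> (of_nat i \<cdot> G (Suc i) j + of_nat j \<cdot> G i (Suc j)) - (of_nat i * of_nat j) \<cdot>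
      (G 2 (n - 2) + (of_nat n - 2) \<cdot> G 1 (n - 1)) \<in> I" if "i + j = n - 1" "n \<ge> 3" for i j
  proof -
    have 1: "ad (x 0) ((of_nat (n - 1) - 1) \<cdot> G i j - (of_nat i * of_nat j) \<cdot> G 1 (n - 1 - 1)) \<in> I"
      by (rule cl(7), rule less.IH) (use that in auto)
    have n: "n - 1 - 1 = n - 2" "Suc (n - 2) = n - 1" "Suc 1 = 2" "of_nat (n - 1) - 1 = (of_nat n - 2 :: 'k)"
      "of_nat (n - 2) = (of_nat n - 2 :: 'k)" using that by (auto simp: of_nat_diff)
    show ?thesis using 1
      by (simp only: ad_simps(1,2) ad_scl ad_x0_G n of_nat_1 U_const_simps(1) mult_1_left)
  qed
  show ?case
  proof (cases "n \<ge> 5")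
    case True
    let ?N = "of_nat n :: 'k"
    have m1: "(?N-2) \<cdot> (2 \<cdot> G 3 (n-3) + (?N-3) \<cdot> G 2 (n-2)) - (2*(?N-3)) \<cdot> (G 2 (n-2) + (?N-2) \<cdot> G 1 (n-1)) \<in> I"
    proof -
      have "Suc (n - 3) = n - 2" using True by simp
      then show ?thesis using stepE[of 2 "n-3"] True by (simp add: of_nat_diff eval_nat_numeral)
    qed
    have m2: "(?N-2) \<cdot> (3 \<cdot> G 4 (n-4) + (?N-4) \<cdot> G 3 (n-3)) - (3*(?N-4)) \<cdot> (G 2 (n-2) + (?N-2) \<cdot> G 1 (n-1)) \<in> I"
    proof -
      have "Suc (n - 4) = n - 3" using True by simp
      then show ?thesis using stepE[of 3 "n-4"] True by (simp add: of_nat_diff eval_nat_numeral)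
    qed
    have m3: "(?N-3) \<cdot> (G 4 (n-4) + (?N-5) \<cdot> G 2 (n-2) + G 2 (n-2)) - (2*(?N-4)) \<cdot> ((?N-4) \<cdot> G 1 (n-1) + G 2 (n-2)) \<in> I"
    proof -
      have 1: "ad (x 1) ((of_nat (n - 2) - 1) \<cdot> G 2 (n - 4) - (of_nat 2 * of_nat (n - 4)) \<cdot> G 1 (n - 2 - 1)) \<in> I"
        by (rule cl(7), rule less.IH) (use True in auto)
      have n: "n - 4 + 2 = n - 2" "n - 3 + 2 = n - 1" "n - 2 - 1 = n - 3" "2 + (n - 4) = n - 2"
        "1 + (n - 3) = n - 2" "2 + 2 = (4::nat)" using True by auto
      have 2: "of_nat (n - 2) = ?N - 2" "of_nat (n - 3) = ?N - 3" "of_nat (n - 4) = ?N - 4"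
        "?N - 3 - 1 = ?N - 4" "?N - 2 - 1 = ?N - 3" "?N - 4 - 1 = ?N - 5" "of_nat 2 = (2::'k)" "of_nat 1 = (1 :: 'k)" "2 - 1 = (1::'k)" "1 - 1 = (0::'k)" using True
        by (simp_all add: of_nat_diff)
      from 1 show ?thesis
        by (simp only: ad_simps(1,2) ad_scl ad_x1_G n 2) (simp add: U_const_simps)
    qed
    have "(- (?N-4)*(?N^2-3*?N-6)) \<cdot> ((?N-1) \<cdot> G 2 (n-2) - (2*(?N-2)) \<cdot> G 1 (n-1)) \<in> I"
      unfolding eliminate_higher_G[of ?N "G 3 (n-3)" "G 2 (n-2)" "G 1 (n-1)" "G 4 (n-4)", symmetric]
      by (intro cl(2) cl(6) cl(3) m1 m2 m3)
    \<comment> \<open>Both factors are nonzero integers: \<open>n * (n - 3)\<close> is at least 10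
      for \<open>n\<close> at least 5, so the quadratic factor is positive, and characteristic 0
      carries this over to the field.\<close>
    moreover have "- (?N-4)*(?N^2-3*?N-6) \<noteq> 0"
    proof -
      have "int n * (int n - 3) \<ge> 5 * 2" using True by (intro mult_mono) auto
      then have "int n ^ 2 - 3 * int n - 6 \<noteq> 0" by (simp add: algebra_simps power2_eq_square)
      then have "(of_int (int n ^ 2 - 3 * int n - 6) :: 'k) \<noteq> 0" by (simp only: of_int_eq_0_iff not_False_eq_True)
      moreover have "(of_int (int n - 4) :: 'k) \<noteq> 0" using True by (simp only: of_int_eq_0_iff)
      ultimately show ?thesis by simp
    qed
    ultimately have E2: "(?N-1) \<cdot> G 2 (n-2) - (2*(?N-2)) \<cdot> G 1 (n-1) \<in> I"
      by (rule ideal_scl_cancel[OF I])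
    have E: "(?N - 1) \<cdot> G i (n-i) - (of_nat i * of_nat (n-i)) \<cdot> G 1 (n - 1) \<in> I" if "i \<ge> 1" "i \<le> n" for i
      using that
    proof (induction i rule: dec_induct)
      case base then show ?case using triv[of 1 "n-1"] True by simp
    next
      case (step i)
      let ?i = "of_nat i :: 'k"
      have n: "i + (n - Suc i) = n - 1" "n \<ge> 3" "Suc (n - Suc i) = n - i" "of_nat (n - Suc i) = ?N - 1 - ?i"
        "of_nat (n - i) = ?N - ?i"
        using True step by (simp_all add: of_nat_diff)
      note M = stepE[OF n(1,2), unfolded n(3,4)]
      have IH: "(?N - 1) \<cdot> G i (n-i) - (?i * (?N - ?i)) \<cdot> G 1 (n - 1) \<in> I"
        using step by (simp add: n(5))
      have "((?N - 2) * ?i) \<cdot> ((?N-1) \<cdot> G (Suc i) (n-Suc i) - ((?i + 1) * (?N-1-?i)) \<cdot> G 1 (n-1)) \<in> I"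
        unfolding combine_G_relations[symmetric, of ?N ?i "G (Suc i) (n-Suc i)" "G 1 (n-1)" "G i (n-i)" "G 2 (n-2)"]
        by (intro cl(2) cl(6) cl(3) M IH E2)
      moreover have "(?N - 2) * ?i \<noteq> 0"
      proof -
        have "?N \<noteq> of_nat 2" using True by (simp only: of_nat_eq_iff)
        then show ?thesis using step by simp
      qed
      ultimately have "(?N-1) \<cdot> G (Suc i) (n-Suc i) - ((?i + 1) * (?N-1-?i)) \<cdot> G 1 (n-1) \<in> I"
        by (rule ideal_scl_cancel[OF I])
      then show ?case by (simp add: n(4) add.commute)
    qed
    show ?thesis
    proof (cases "i \<le> 1")
      case True then show ?thesis using triv less.prems by blast
    next
      case False
      have "n - i = j" using less.prems by simp
      then show ?thesis using E[of i] False less.prems by simp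
    qed
  next
    case False
    show ?thesis
    proof (cases "i \<le> 1 \<or> j \<le> 1")
      case True then show ?thesis using triv less.prems by blast
    next
      case F: False
      then have [simp]: "i = 2" "j = 2" "n = 4" using False less.prems by auto
      show ?thesis using h2 by (simp add: h2_G U_const_numeral)
    qed
  qed
qed

text \<open>For \<open>n\<close> at least 4, \<open>ad (x 0)\<close> on \<open>G 1 (n - 2)\<close>
  and \<open>ad (x 1)\<close> on \<open>G 1 (n - 3)\<close> both yield \<open>G 2 (n - 2)\<close>
  plus a multiple of \<open>G 1 (n - 1)\<close>, with factors \<open>n - 2\<close> and
  \<open>n - 4\<close>; the difference isolates \<open>2 G 1 (n - 1)\<close>. For
  \<open>n = 3\<close>, symmetry turns the \<open>ad (x 0)\<close> relation into
  \<open>2 G 1 2\<close>. The first index is then raised by \<open>ad (x 0)\<close>.\<close>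

lemma G_mem:
  fixes I :: "'k::field_char_0 UW set"
  assumes I: "two_sided_ideal I" and G11: "G 1 1 \<in> I"
  shows "G i j \<in> I"
proof -
  note cl = ideal_closed[OF I]
  have "G i j \<in> I" if "i + j = n" "n \<ge> 2" for n i j
    using that
  proof (induction n arbitrary: i j rule: less_induct)
    case (less n)
    have assms_step: "of_nat i \<cdot> G (Suc i) j + of_nat j \<cdot> G i (Suc j) \<in> I" if "i + j = n - 1" "n \<ge> 3" for i j
      unfolding ad_x0_G[symmetric] by (rule cl(7), rule less.IH) (use that in auto)
    have G1: "G 1 (n-1) \<in> I"
    proof -
      consider "n = 2" | "n = 3" | "n \<ge> 4" using less.prems by linarith
      then show ?thesis
      proof cases
        case 1 then show ?thesis using G11 by simp
      next
        case 2
        have "G 2 1 = (G 1 2 :: 'k UW)" by (rule G_sym)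
        then have "2 \<cdot> G 1 2 \<in> I" using assms_step[of 1 1] 2 by (simp add: U_const_simps U_const_numeral mult_2 eval_nat_numeral)
        then have "G 1 2 \<in> I" by (rule ideal_scl_cancel[OF I]) simp
        then show ?thesis using 2 by (simp add: eval_nat_numeral)
      next
        case 3
        let ?N = "of_nat n :: 'k"
        have n: "Suc (n - 2) = n - 1" "n - 3 + 2 = n - 1" "1 + (n - 3) = n - 2"  using 3 by auto
        have 1: "G 2 (n-2) + (?N-2) \<cdot> G 1 (n-1) \<in> I"
          using assms_step[of 1 "n-2"] 3 n by (simp add: of_nat_diff eval_nat_numeral U_const_simps)
        have "ad (x 1) (G 1 (n-3)) \<in> I" by (rule cl(7), rule less.IH[of "n-2"]) (use 3 in auto)
        then have "(?N-4) \<cdot> G 1 (n-1) + G 2 (n-2) \<in> I"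
          unfolding ad_x1_G n using 3 by (simp add: of_nat_diff U_const_simps)
        from cl(6)[OF 1 this] have "2 \<cdot> G 1 (n-1) \<in> I"
          by (simp add: U_const_simps U_const_numeral algebra_simps numeral_mult_expand)
        then show ?thesis by (rule ideal_scl_cancel[OF I]) simp
      qed
    qed
    have *: "G i (n - i) \<in> I" if "i \<ge> 1" "i \<le> n" for i
      using that
    proof (induction i rule: dec_induct)
      case base show ?case by (rule G1)
    next
      case (step i)
      show ?case
      proof (cases "Suc i < n")
      case False then show ?thesis using cl(1) by (simp add: G_0_right)
      next
      case True
      have n: "i + (n - Suc i) = n - 1" "n \<ge> 3" "Suc (n - Suc i) = n - i" using step True by auto
      have "of_nat i \<cdot> G (Suc i) (n - Suc i) + of_nat (n - Suc i) \<cdot> G i (n - i) - of_nat (n - Suc i) \<cdot> G i (n - i) \<in> I"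
        using assms_step[OF n(1,2)] step unfolding n(3) by (intro cl(6) cl(3)) auto
      then have "of_nat i \<cdot> G (Suc i) (n - Suc i) \<in> I" by simp
      then show ?thesis by (rule ideal_scl_cancel[OF I]) (use step in auto)
      qed
    qed
    show ?case
    proof (cases "i = 0")
      case False
      have "n - i = j" using less.prems by simp
      then show ?thesis using *[of i] False less.prems by simp
    qed (use cl(1) in \<open>simp add: G_0_left\<close>)
  qed
  moreover have "G i j \<in> I" if "i + j < 2"
  proof -
    have "i = 0 \<or> j = 0" using that by linarith
    then show ?thesis using cl(1) by (auto simp: G_0_left G_0_right)
  qed
  ultimately show ?thesis by (meson not_less)
qed

section \<open>Spanning monomials modulo an ideal\<close>

text \<open>Division by \<open>Suc i\<close> is where characteristic 0 makes \<open>x 0\<close> and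
  \<open>x 1\<close> generate the whole algebra.\<close>

lemma x_rec: "x (i + 2) = inverse (of_nat (Suc i)) \<cdot> (x 0 * x (Suc i) - x (Suc i) * (x 0 :: 'k::field_char_0 UW))"
proof -
  have "ad (x 0) (x (Suc i)) = of_nat (Suc i) \<cdot> (x (i + 2) :: 'k UW)"
    by (simp add: ad_x)
  then show ?thesis by (simp add: ad_def U_scale_simps U_const_simps del: of_nat_Suc)
qed

lemma U_inj_expand:
  fixes g :: "'k::field witt"
  shows "U_inj g = (\<Sum>i\<in>Poly_Mapping.keys g. Poly_Mapping.lookup g i \<cdot> x i)"
proof -
  have U0: "U_inj 0 = (0 :: 'k UW)" using U_inj_relations(1)[of 0 "0::'k witt"] by simp
  have sum: "U_inj (\<Sum>i\<in>A. f i) = (\<Sum>i\<in>A. U_inj (f i) :: 'k UW)" for A and f :: "nat \<Rightarrow> 'k witt"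
    by (induction A rule: infinite_finite_induct) (simp_all add: U0 U_inj_relations)
  have "U_inj (Poly_Mapping.single i r) = r \<cdot> (x i :: 'k UW)" for i r
  proof -
    have "Poly_Mapping.single i r = witt_scale r (witt_e (Suc i))"
      by (simp add: witt_scale_def witt_e_def)
    then show ?thesis by (simp add: U_inj_relations e_def)
  qed
  then show ?thesis by (subst poly_mapping_sum_single[of g]) (simp add: sum)
qed

text \<open>The presentation has every vector of the Lie algebra as a generator; each is a finite
  combination of basis vectors, so left multiplication by the \<open>x i\<close> is enough.\<close>

lemma UW_induct:
  fixes z :: "'k::field UW"
  assumes 1: "P 1" and add: "\<And>y z. P y \<Longrightarrow> P z \<Longrightarrow> P (y + z)" and scl: "\<And>r z. P z \<Longrightarrow> P (r \<cdot> z)"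
    and mult: "\<And>i z. P z \<Longrightarrow> P (x i * z)"
  shows "P z"
proof -
  have 0: "P 0" using scl[OF 1, of 0] by (simp add: U_const_simps)
  have sum: "P (\<Sum>i\<in>A. f i)" if "\<And>i. P (f i)" for f :: "'i \<Rightarrow> 'k UW" and A
    using that by (induction A rule: infinite_finite_induct) (auto intro: 0 add)
  have inj: "P (U_inj g * z)" if "P z" for g z
    unfolding U_inj_expand sum_distrib_right mult.assoc by (intro sum scl mult that)
  have single: "P (abs_UW (Poly_Mapping.single ws r))" for ws and r :: 'k
  proof (induction ws)
    case Nil
    have "abs_UW (Poly_Mapping.single [] r) = r \<cdot> 1" by (simp add: U_const.abs_eq const_def)
    then show ?case using scl[OF 1] by simp
  next
    case (Cons g ws)
    have "Poly_Mapping.single (g # ws) r = gen g * Poly_Mapping.single ws r"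
      by (simp add: gen_def mult_single plus_list_def)
    then have "abs_UW (Poly_Mapping.single (g # ws) r) = U_inj g * abs_UW (Poly_Mapping.single ws r)"
      by (simp add: U_inj.abs_eq times_UW.abs_eq)
    then show ?case using inj[OF Cons] by simp
  qed
  have abs_sum: "abs_UW (\<Sum>i\<in>A. f i) = (\<Sum>i\<in>A. abs_UW (f i))" for A and f :: "'k witt list \<Rightarrow> _"
    by (induction A rule: infinite_finite_induct) (simp_all flip: zero_UW.abs_eq plus_UW.abs_eq)
  show "P z"
  proof (induction z rule: UW.abs_induct)
    case (1 p)
    show ?case by (subst poly_mapping_sum_single[of p]) (unfold abs_sum, intro sum single)
  qed
qed

interpretation U: vector_space "\<lambda>r z :: 'k::field UW. r \<cdot> z"
  by (rule algebra_over_vector_space[OF algebra_over_U])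

lemma U_span_mult: "z \<in> U.span T \<Longrightarrow> (\<And>t. t \<in> T \<Longrightarrow> w * t \<in> U.span S) \<Longrightarrow> w * z \<in> U.span S"
proof (induction z rule: U.span_induct_alt)
  case base show ?case by (simp add: U.span_zero)
next
  case (step r t z)
  then show ?case by (simp add: distrib_left U_comm2 U.span_add U.span_scale)
qed

text \<open>Left multiplication by \<open>x (i + 2)\<close> is a scaled commutator of those by
  \<open>x 0\<close> and \<open>x (i + 1)\<close>, so stability under two generators makes the span
  a left ideal, and it contains 1.\<close>

lemma span_UNIV:
  fixes S :: "'k::field_char_0 UW set"
  assumes 1: "1 \<in> U.span S" and 0: "\<And>t. t \<in> S \<Longrightarrow> x 0 * t \<in> U.span S"
    and x1: "\<And>t. t \<in> S \<Longrightarrow> x 1 * t \<in> U.span S"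
  shows "z \<in> U.span S"
proof -
  have cl: "x i * y \<in> U.span S" if "y \<in> U.span S" for i y
    using that
  proof (induction i arbitrary: y rule: less_induct)
    case (less i)
    consider "i = 0" | "i = 1" | j where "i = j + 2" by (metis One_nat_def add_2_eq_Suc' not0_implies_Suc)
    then show ?case
    proof cases
      case 1 then show ?thesis using U_span_mult[OF less.prems] 0 by blast
    next
      case 2 then show ?thesis using U_span_mult[OF less.prems] x1 by blast
    next
      case (3 j)
      have "x 0 * (x (Suc j) * y) - x (Suc j) * (x 0 * y) \<in> U.span S"
        by (intro U.span_diff less) (use 3 in auto)
      then show ?thesis unfolding 3 x_rec by (simp add: mult.assoc left_diff_distrib U.span_scale)
    qed
  qed
  show ?thesis
    by (induction z rule: UW_induct) (auto intro: 1 cl U.span_add U.span_scale)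
qed

section \<open>Normal forms modulo the relation \<open>h2\<close>\<close>

lemma x_mult: "x i * x j = G i j + x 0 * x (i + j) - of_nat i \<cdot> x (i + j + 1)"
  by (simp add: G_def)

lemma x_swap: "x i * (x j * z) = x j * (x i * z) + (of_nat j - of_nat i) \<cdot> (x (i + j + 1) * z)"
proof -
  have "x i * x j = x j * x i + (of_nat j - of_nat i) \<cdot> x (i + j + 1)"
    using ad_x[of i j] unfolding ad_def diff_eq_eq by (subst add.commute)
  then have "(x i * x j) * z = (x j * x i + (of_nat j - of_nat i) \<cdot> x (i + j + 1)) * z" by (rule arg_cong)
  then show ?thesis by (simp only: distrib_right mult.assoc)
qed

text \<open>The bound \<open>d\<close> on the number of factors before the last one is the induction
  measure for straightening. The side condition excludes \<open>x 1 ^ b * x 0\<close> with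
  \<open>b > 0\<close>, whose factors stand in the wrong order.\<close>

definition S_mons :: "nat \<Rightarrow> 'k::field UW set" where
  "S_mons d = {x 0 ^ a * (x 1 ^ b * x m) | a b m. a + b \<le> d \<and> (b = 0 \<or> m \<ge> 1)}"

lemma S_monsI: "a + b \<le> d \<Longrightarrow> b = 0 \<or> m \<ge> 1 \<Longrightarrow> x 0 ^ a * (x 1 ^ b * x m) \<in> S_mons d"
  unfolding S_mons_def by blast

lemma S_mons_mono:
  assumes "d \<le> d'" "z \<in> U.span (S_mons d \<union> I)"
  shows "z \<in> U.span (S_mons d' \<union> I)"
proof (rule subsetD[OF U.span_mono assms(2)])
  show "S_mons d \<union> I \<subseteq> S_mons d' \<union> I" using assms(1) unfolding S_mons_def by fastforce
qed

lemma S_mons_x0: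
  assumes "two_sided_ideal I" "z \<in> U.span (S_mons d \<union> I)"
  shows "x 0 * z \<in> U.span (S_mons (Suc d) \<union> I)"
proof (rule U_span_mult[OF assms(2)])
  fix t assume "t \<in> S_mons d \<union> I"
  then show "x 0 * t \<in> U.span (S_mons (Suc d) \<union> I)"
  proof
    assume "t \<in> S_mons d"
    then obtain a b m where t: "t = x 0 ^ a * (x 1 ^ b * x m)" "a + b \<le> d" "b = 0 \<or> m \<ge> 1"
      unfolding S_mons_def by blast
    have "x 0 ^ Suc a * (x 1 ^ b * x m) \<in> S_mons (Suc d)" by (rule S_monsI) (use t in auto)
    then show ?thesis unfolding t by (auto intro: U.span_base simp: mult.assoc)
  next
    assume "t \<in> I" then show ?thesis using ideal_closed[OF assms(1)] by (auto intro: U.span_base)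
  qed
qed

text \<open>Modulo the ideal, each \<open>G i j\<close> with \<open>i + j >= 2\<close> is a multiple
  of \<open>G 1 (i + j - 1)\<close>, and this element involves only \<open>x 1 * x m\<close> with
  \<open>m >= 1\<close>, \<open>x 0 * x m\<close> and single generators.\<close>

lemma x_mult_mem:
  fixes I :: "'k::field_char_0 UW set"
  assumes I: "two_sided_ideal I" and h2: "h2 \<in> I"
  shows "x i * x j \<in> U.span (S_mons 1 \<union> I)"
proof -
  have base: "x m \<in> U.span (S_mons 1 \<union> I)" "x 0 * x m \<in> U.span (S_mons 1 \<union> I)"
    "m \<ge> 1 \<Longrightarrow> x 1 * x m \<in> U.span (S_mons 1 \<union> I)" for m
    using S_monsI[of 0 0 1 m] S_monsI[of 1 0 1 m] S_monsI[of 0 1 1 m] by (auto intro: U.span_base)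
  have "G i j \<in> U.span (S_mons 1 \<union> I)"
  proof (cases "i + j \<ge> 2")
    case True
    let ?n = "i + j"
    have 1: "G 1 (?n - 1) \<in> U.span (S_mons 1 \<union> I)"
      unfolding G_def by (intro U.span_add U.span_diff U.span_scale base) (use True in auto)
    have 2: "(of_nat ?n - 1) \<cdot> G i j - (of_nat i * of_nat j) \<cdot> G 1 (?n - 1) \<in> U.span (S_mons 1 \<union> I)"
      by (intro U.span_base UnI2 G_multiple_mem I h2 refl True)
    have "(of_nat ?n - 1) \<cdot> G i j \<in> U.span (S_mons 1 \<union> I)"
      using U.span_add[OF 2 U.span_scale[OF 1, of "of_nat i * of_nat j"]] by (simp only: diff_add_cancel)
    then have "inverse (of_nat ?n - 1) \<cdot> ((of_nat ?n - 1) \<cdot> G i j) \<in> U.span (S_mons 1 \<union> I)" by (rule U.span_scale)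
    moreover have "(of_nat ?n - 1 :: 'k) \<noteq> 0"
      using True of_nat_eq_1_iff[of ?n, where 'a='k] by simp
    ultimately show ?thesis by (simp add: U_scale_simps U_const_simps(1) del: of_nat_add)
  next
    case False
    then have "i = 0 \<or> j = 0" by linarith
    then show ?thesis by (auto simp: G_0_left G_0_right U.span_zero)
  qed
  then show ?thesis by (subst x_mult) (intro U.span_add U.span_diff U.span_scale base)
qed

text \<open>Straightening: \<open>x i\<close> is moved past the leading \<open>x 0\<close> or
  \<open>x 1\<close>. The commutator term is a single generator times a shorter monomial and falls
  under the induction hypothesis.\<close>

lemma x_mult_S_mons:
  fixes I :: "'k::field_char_0 UW set"
  assumes I: "two_sided_ideal I" and h2: "h2 \<in> I"
  shows "t \<in> S_mons d \<Longrightarrow> x i * t \<in> U.span (S_mons (Suc d) \<union> I)"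
proof (induction d arbitrary: i t)
  case 0
  then obtain m where "t = x m" unfolding S_mons_def by auto
  then show ?case using x_mult_mem[OF I h2, of i m] by simp
next
  case (Suc d)
  let ?N = "\<lambda>d. U.span (S_mons d \<union> I)"
  have A: "x i * (x 0 ^ a * (x 1 ^ b * x m)) \<in> ?N (Suc (Suc d))"
    if "a + b \<le> Suc d" "b = 0 \<or> m \<ge> 1" "a > 0" for i a b m
  proof -
    obtain a' where a: "a = Suc a'" using \<open>a > 0\<close> gr0_implies_Suc by blast
    have y: "x 0 ^ a' * (x 1 ^ b * x m) \<in> S_mons d" by (rule S_monsI) (use that a in auto)
    show ?thesis unfolding a power_Suc mult.assoc x_swap[of i 0]
      by (intro U.span_add U.span_scale S_mons_x0[OF I] Suc.IH y S_mons_mono[OF _ Suc.IH[OF y]]) simp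
  qed
  \<comment> \<open>Moving \<open>x i\<close> past a leading \<open>x 1\<close> leaves
    \<open>x 1\<close> in front of a combination of monomials with bound \<open>Suc d\<close>; hence
    multiplication by \<open>x 1\<close> must be settled at this bound before the general
    \<open>x i\<close>.\<close>
  have B: "x 1 * z \<in> ?N (Suc (Suc d))" if "z \<in> ?N (Suc d)" for z
  proof (rule U_span_mult[OF that])
    fix t assume "t \<in> S_mons (Suc d) \<union> I"
    then show "x 1 * t \<in> ?N (Suc (Suc d))"
    proof
      assume "t \<in> S_mons (Suc d)"
      then obtain a b m where t: "t = x 0 ^ a * (x 1 ^ b * x m)" "a + b \<le> Suc d" "b = 0 \<or> m \<ge> 1"
        unfolding S_mons_def by blast
      consider "a > 0" | "a = 0" "m \<ge> 1" | "a = 0" "b = 0" using t by auto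
      then show ?thesis
      proof cases
        case 1 then show ?thesis unfolding t(1) by (intro A t)
      next
        case 2
        have "x 0 ^ 0 * (x 1 ^ Suc b * x m) \<in> S_mons (Suc (Suc d))" by (rule S_monsI) (use t 2 in auto)
        then show ?thesis unfolding t using 2 by (auto intro: U.span_base simp: mult.assoc)
      next
        case 3
        have "x 1 * t \<in> ?N 1" unfolding t using 3 x_mult_mem[OF I h2] by simp
        then show ?thesis by (rule S_mons_mono[rotated]) simp
      qed
    next
      assume "t \<in> I" then show ?thesis using ideal_closed[OF I] by (auto intro: U.span_base)
    qed
  qed
  obtain a b m where t: "t = x 0 ^ a * (x 1 ^ b * x m)" "a + b \<le> Suc d" "b = 0 \<or> m \<ge> 1"
    using Suc.prems unfolding S_mons_def by blast
  show ?case
  proof (cases "a > 0")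
    case True then show ?thesis unfolding t(1) by (intro A t)
  next
    case False
    show ?thesis
    proof (cases b)
      case 0
      have "x i * t \<in> ?N 1" unfolding t using 0 False x_mult_mem[OF I h2] by simp
      then show ?thesis by (rule S_mons_mono[rotated]) simp
    next
      case (Suc b')
      have y: "x 0 ^ 0 * (x 1 ^ b' * x m) \<in> S_mons d" by (rule S_monsI) (use t Suc in auto)
      then have y: "x 1 ^ b' * x m \<in> S_mons d" by simp
      have "x i * (x 1 * (x 1 ^ b' * x m)) \<in> ?N (Suc (Suc d))"
        unfolding x_swap[of i 1]
        by (intro U.span_add U.span_scale B Suc.IH y S_mons_mono[OF _ Suc.IH[OF y]]) simp
      then show ?thesis unfolding t using False Suc by (simp add: mult.assoc)
    qed
  qed
qed

text \<open>The value 1 at index 0 lets one formula cover monomials with and without a last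
  factor.\<close>

definition e' :: "nat \<Rightarrow> 'k::field UW" where "e' n = (if n = 0 then 1 else e n)"

text \<open>The gap in \<open>n\<close> removes duplicates: a last factor \<open>e 2\<close> is
  absorbed into the power of \<open>x 1\<close>, and a last factor \<open>e 1\<close>, which occurs
  only for \<open>b = 0\<close>, into the power of \<open>x 0\<close>.\<close>

definition phi_mons :: "'k::field UW set" where
  "phi_mons = {x 0 ^ a * (x 1 ^ b * e' n) | a b n. n = 0 \<or> n \<ge> 3}"

lemma span_phi_mons:
  fixes I :: "'k::field_char_0 UW set"
  assumes I: "two_sided_ideal I" and h2: "h2 \<in> I"
  shows "z \<in> U.span (phi_mons \<union> I)"
proof -
  let ?S = "{1} \<union> (\<Union>d. S_mons d) \<union> I"
  have sub: "y \<in> U.span ?S" if "y \<in> U.span (S_mons d \<union> I)" for y d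
    by (rule subsetD[OF U.span_mono that]) auto
  have x: "x i \<in> S_mons 0" for i using S_monsI[of 0 0 0 i] by simp
  have cl: "x i * t \<in> U.span ?S" if t: "t \<in> ?S" for t i
  proof -
    consider "t = 1" | d where "t \<in> S_mons d" | "t \<in> I" using t by blast
    then show ?thesis
    proof cases
      case 1 then show ?thesis using x[of i] by (auto intro!: U.span_base)
    next
      case 2 then show ?thesis by (intro sub) (rule x_mult_S_mons[OF I h2])
    next
      case 3 then show ?thesis by (intro U.span_base UnI2 ideal_closed(3)[OF I])
    qed
  qed
  have "z \<in> U.span ?S" by (rule span_UNIV) (rule U.span_base, simp, (erule cl)+)
  moreover have "?S \<subseteq> phi_mons \<union> I"
  proof -
    have "x 0 ^ a * (x 1 ^ b * x m) \<in> phi_mons" if bm: "b = 0 \<or> m \<ge> 1" for a b m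
    proof -
      consider "m \<ge> 2" | "m = 1" | "m = 0" "b = 0" using bm by linarith
      then have "\<exists>a' b' n. x 0 ^ a * (x 1 ^ b * x m) = x 0 ^ a' * (x 1 ^ b' * e' n) \<and> (n = 0 \<or> n \<ge> 3)"
      proof cases
        case 1 then show ?thesis by (intro exI[of _ a] exI[of _ b] exI[of _ "Suc m"]) (simp add: e'_def)
      next
        case 2 then show ?thesis by (intro exI[of _ a] exI[of _ "Suc b"] exI[of _ 0]) (simp add: e'_def power_commutes)
      next
        case 3 then show ?thesis by (intro exI[of _ "Suc a"] exI[of _ 0]) (simp add: e'_def power_commutes)
      qed
      then show ?thesis unfolding phi_mons_def by blast
    qed
    moreover have "1 \<in> phi_mons" unfolding phi_mons_def
      by (auto intro!: exI[of _ 0] simp: e'_def)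
    ultimately show ?thesis unfolding S_mons_def by blast
  qed
  ultimately show ?thesis using U.span_mono by blast
qed

text \<open>The set \<open>J\<close> holds additional normal forms: it is empty for \<open>a\<close>
  in \<open>{0, 1}\<close>, where all \<open>G i j\<close> lie in the ideal, and consists of the
  elements \<open>G 1 m\<close> with \<open>m >= 1\<close> for the other \<open>a\<close>.\<close>

lemma span_lam_mons:
  fixes I J :: "'k::field_char_0 UW set"
  defines "S \<equiv> {1} \<union> {x 0 ^ k * x m | k m. True} \<union> J \<union> I"
  assumes I: "two_sided_ideal I" and J: "\<And>t. t \<in> J \<Longrightarrow> x 0 * t \<in> U.span S"  "\<And>t. t \<in> J \<Longrightarrow> x 1 * t \<in> U.span S"
    and G: "\<And>i j. G i j \<in> U.span S"
  shows "z \<in> U.span S"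
proof -
  have m: "x 0 ^ k * x m \<in> U.span S" for k m
    unfolding S_def by (rule U.span_base) blast
  have x: "x m \<in> U.span S" for m using m[of 0 m] by simp
  have x0: "x 0 * t \<in> U.span S" if t: "t \<in> S" for t
  proof -
    consider "t = 1" | k m where "t = x 0 ^ k * x m" | "t \<in> J" | "t \<in> I" using t unfolding S_def by blast
    then show ?thesis
    proof cases
      case (2 k m) then show ?thesis using m[of "Suc k" m] by (simp add: mult.assoc)
    next
      case 4 then show ?thesis unfolding S_def by (intro U.span_base UnI2 ideal_closed(3)[OF I])
    qed (use J x in simp_all)
  qed
  have "x i * (x 0 ^ k * x m) \<in> U.span S" for i k m
  proof (induction k arbitrary: i)
    case 0
    have "x 0 * x (i + m) \<in> U.span S" using m[of 1] by simp
    then have "x i * x m \<in> U.span S"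
      by (subst x_mult) (intro U.span_add U.span_diff U.span_scale G x)
    then show ?case by simp
  next
    case (Suc k)
    show ?case unfolding power_Suc mult.assoc x_swap[of i 0]
      by (intro U.span_add U.span_scale Suc.IH U_span_mult[OF Suc.IH x0])
  qed
  note x_mons = this
  have x1: "x 1 * t \<in> U.span S" if t: "t \<in> S" for t
  proof -
    consider "t = 1" | k m where "t = x 0 ^ k * x m" | "t \<in> J" | "t \<in> I" using t unfolding S_def by blast
    then show ?thesis
    proof cases
      case 1 then show ?thesis using x[of 1] by simp
    next
      case (2 k m) then show ?thesis using x_mons by blast
    next
      case 4 then show ?thesis unfolding S_def by (intro U.span_base UnI2 ideal_closed(3)[OF I])
    qed (use J in simp)
  qed
  show ?thesis by (rule span_UNIV) (rule U.span_base, simp add: S_def, erule x0, erule x1)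
qed

section \<open>Products of \<open>x 0\<close> and \<open>x 1\<close> with the elements
  \<open>Q\<close>\<close>

abbreviation Q :: "nat \<Rightarrow> 'k::field UW" where "Q m \<equiv> G 1 m"

text \<open>The derivation gives \<open>G 2 m + m Q (m + 1)\<close>, and \<open>h2\<close>
  identifies \<open>G 2 m\<close> with \<open>2 m / (m + 1)\<close> times \<open>Q (m + 1)\<close>;
  the two coefficients add up to \<open>m (m + 3) / (m + 1)\<close>.\<close>

lemma ad_x0_Q:
  fixes I :: "'k::field_char_0 UW set"
  assumes I: "two_sided_ideal I" and h2: "h2 \<in> I"
  shows "ad (x 0) (Q m) - (of_nat (m * (m + 3)) / of_nat (m + 1)) \<cdot> Q (m + 1) \<in> I"
proof -
  let ?M = "of_nat m :: 'k"
  have 0: "?M + 1 \<noteq> 0" using of_nat_neq_0[of m, where 'a='k] by (simp add: add.commute)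
  have E: "(?M + 1) \<cdot> G 2 m - (2 * ?M) \<cdot> Q (m + 1) \<in> I"
    using G_multiple_mem[OF I h2, of 2 m "m + 2"] by (simp add: add.commute)
  have "ad (x 0) (Q m) = G 2 m + ?M \<cdot> Q (m + 1)"
    using ad_x0_G[of 1 m] by (simp add: U_const_simps numeral_2_eq_2)
  note adQ = this
  define r where "r = of_nat (m * (m + 3)) / (of_nat (m + 1) :: 'k)"
  have "(?M + 1) * r = ?M * (?M + 3)" unfolding r_def using 0 by (simp add: add.commute)
  then have r: "(?M + 1) * ?M - (?M + 1) * r = - (2 * ?M)" by (simp add: algebra_simps)
  have "(?M + 1) \<cdot> (ad (x 0) (Q m) - r \<cdot> Q (m + 1)) =
      (?M + 1) \<cdot> G 2 m + ((?M + 1) * ?M - (?M + 1) * r) \<cdot> Q (m + 1)"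
    by (simp only: adQ right_diff_distrib distrib_left[of "U_const _"] U_scale_simps(4) U.scale_left_diff_distrib add_diff_eq)
  also have "\<dots> = (?M + 1) \<cdot> G 2 m + (- (2 * ?M)) \<cdot> Q (m + 1)" by (simp only: r)
  also have "\<dots> = (?M + 1) \<cdot> G 2 m - (2 * ?M) \<cdot> Q (m + 1)" by (simp only: U.scale_minus_left) simp
  finally show ?thesis using ideal_scl_cancel[OF I _ 0] E unfolding r_def by metis
qed

lemma ad_x1_Q:
  fixes I :: "'k::field_char_0 UW set"
  assumes I: "two_sided_ideal I" and h2: "h2 \<in> I"
  obtains r where "ad (x 1) (Q m) - r \<cdot> Q (m + 2) \<in> I"
proof -
  let ?M = "of_nat m :: 'k"
  have 0: "?M + 2 \<noteq> 0" using of_nat_neq_0[of "Suc m", where 'a='k] by (simp add: add.commute)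
  have E: "(?M + 2) \<cdot> G 2 (m + 1) - (2 * (?M + 1)) \<cdot> Q (m + 2) \<in> I"
    using G_multiple_mem[OF I h2, of 2 "m + 1" "m + 3"] by (simp add: add.commute)
  have "inverse (?M + 2) \<cdot> ((?M + 2) \<cdot> G 2 (m + 1) - (2 * (?M + 1)) \<cdot> Q (m + 2)) \<in> I"
    using E by (rule ideal_closed[OF I])
  then have "G 2 (m + 1) - (inverse (?M + 2) * (2 * (?M + 1))) \<cdot> Q (m + 2) \<in> I"
    by (simp only: right_diff_distrib U_scale_simps left_inverse[OF 0] U_const_simps(1) mult_1_left)
  moreover have "ad (x 1) (Q m) = (?M - 1) \<cdot> Q (m + 2) + G 2 (m + 1)"
    using ad_x1_G[of 1 m] by (simp add: U_const_simps)
  ultimately have "ad (x 1) (Q m) - ((?M - 1) + inverse (?M + 2) * (2 * (?M + 1))) \<cdot> Q (m + 2) \<in> I"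
    by (simp only: U.scale_left_distrib) (simp add: algebra_simps)
  then show thesis by (rule that)
qed

lemma U_span_ad: "z \<in> U.span T \<Longrightarrow> (\<And>t. t \<in> T \<Longrightarrow> ad w t \<in> U.span S) \<Longrightarrow> ad w z \<in> U.span S"
proof (induction z rule: U.span_induct_alt)
  case base show ?case by (simp add: U.span_zero ad_def)
next
  case (step r t z)
  then show ?case by (simp add: ad_simps(1) ad_scl U.span_add U.span_scale)
qed

lemma U_span_cancel: "r \<cdot> z \<in> U.span S \<Longrightarrow> r \<noteq> 0 \<Longrightarrow> z \<in> U.span S"
  using U.span_scale[of "r \<cdot> z" S "inverse r"] by (simp add: U_scale_simps U_const_simps(1))

context
  fixes I :: "'k::field_char_0 UW set"
  assumes I: "two_sided_ideal I" and h2: "h2 \<in> I"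
begin

text \<open>Both generators have weight \<open>m + 3\<close>, because
  \<open>x (m + 2) = e (m + 3)\<close>. These spans are the targets to which products of
  \<open>x 0\<close> or \<open>x 1\<close> with some \<open>Q\<close> are to be reduced;
  \<open>ad (x 0)\<close> and \<open>ad (x 1)\<close> raise the index by 1 and 2.\<close>

definition T :: "nat \<Rightarrow> 'k UW set" where "T m = U.span ({x (m + 2), Q m} \<union> I)"

lemma T_I: "z \<in> I \<Longrightarrow> z \<in> T m" and T_Q: "Q m \<in> T m" and T_x: "x (m + 2) \<in> T m"
  and T_add: "y \<in> T m \<Longrightarrow> z \<in> T m \<Longrightarrow> y + z \<in> T m"
  and T_diff: "y \<in> T m \<Longrightarrow> z \<in> T m \<Longrightarrow> y - z \<in> T m"
  and T_scl: "z \<in> T m \<Longrightarrow> r \<cdot> z \<in> T m"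
  and T_cancel: "r \<cdot> z \<in> T m \<Longrightarrow> r \<noteq> 0 \<Longrightarrow> z \<in> T m"
  unfolding T_def by (blast intro: U.span_base U.span_add U.span_diff U.span_scale U_span_cancel)+

lemma T_diff_scl: "z - r \<cdot> y \<in> T m \<Longrightarrow> y \<in> T m \<Longrightarrow> z \<in> T m"
  using T_add[OF _ T_scl, of "z - r \<cdot> y" m y r] by simp

lemma T_ad0: "z \<in> T m \<Longrightarrow> ad (x 0) z \<in> T (m + 1)"
  unfolding T_def
proof (erule U_span_ad, fold T_def)
  fix t assume "t \<in> {x (m + 2), Q m} \<union> I"
  then consider "t = x (m + 2)" | "t = Q m" | "t \<in> I" by blast
  then show "ad (x 0) t \<in> T (m + 1)"
  proof cases
    case 1 then show ?thesis using T_scl[OF T_x[of "m + 1"]] by (simp add: ad_x)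
  next
    case 2
    show ?thesis unfolding 2 by (rule T_diff_scl[OF T_I[OF ad_x0_Q[OF I h2]] T_Q])
  next
    case 3 then show ?thesis by (intro T_I ideal_closed(7)[OF I])
  qed
qed

lemma T_ad1: "z \<in> T m \<Longrightarrow> ad (x 1) z \<in> T (m + 2)"
  unfolding T_def
proof (erule U_span_ad, fold T_def)
  fix t assume "t \<in> {x (m + 2), Q m} \<union> I"
  then consider "t = x (m + 2)" | "t = Q m" | "t \<in> I" by blast
  then show "ad (x 1) t \<in> T (m + 2)"
  proof cases
    case 1 then show ?thesis using T_scl[OF T_x[of "m + 2"]] by (simp add: ad_x)
  next
    case 2
    obtain r where "ad (x 1) (Q m) - r \<cdot> Q (m + 2) \<in> I" using ad_x1_Q[OF I h2] .
    then show ?thesis unfolding 2 by (rule T_diff_scl[OF T_I T_Q])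
  next
    case 3 then show ?thesis by (intro T_I ideal_closed(7)[OF I])
  qed
qed

text \<open>Modulo \<open>I\<close>, the derivation \<open>ad (x 0)\<close> sends \<open>Q m\<close> to a nonzero multiple of \<open>Q (m + 1)\<close>,
  so membership propagates from \<open>m = 1\<close> to all \<open>m\<close>.\<close>

lemma T_shift:
  assumes "y * ad (x 0) (Q m) \<in> T n" "m \<ge> 1"
  shows "y * Q (m + 1) \<in> T n"
proof -
  let ?r = "of_nat (m * (m + 3)) / of_nat (m + 1) :: 'k"
  have "y * (ad (x 0) (Q m) - ?r \<cdot> Q (m + 1)) \<in> T n"
    by (intro T_I ideal_closed(3)[OF I] ad_x0_Q[OF I h2])
  from T_diff[OF assms(1) this] have "?r \<cdot> (y * Q (m + 1)) \<in> T n"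
    by (simp add: right_diff_distrib U_comm2)
  moreover have "?r \<noteq> 0" using assms(2) by (simp del: of_nat_add of_nat_mult of_nat_Suc)
  ultimately show ?thesis by (rule T_cancel)
qed

text \<open>As \<open>x 0\<close> commutes with itself, \<open>ad (x 0)\<close> acts only on the
  factor \<open>Q m\<close>, and so climbs from \<open>m\<close> to \<open>m + 1\<close>.\<close>

lemma x0_Q:
  assumes "x 0 * Q 1 \<in> T 2" "m \<ge> 1"
  shows "x 0 * Q m \<in> T (m + 1)"
  using assms(2)
proof (induction m rule: dec_induct)
  case base then show ?case using assms(1) by (simp add: numeral_2_eq_2)
next
  case (step m)
  have "ad (x 0) (x 0 * Q m) = (x 0 * ad (x 0) (Q m) :: 'k UW)" by (simp add: ad_def algebra_simps)
  then have "x 0 * ad (x 0) (Q m) \<in> T (m + 2)" using T_ad0[OF step.IH] by simp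
  then show ?case using T_shift step(1) by simp
qed

text \<open>The Leibniz rule for \<open>ad (x 1)\<close> on \<open>x 0 * Q m\<close> produces
  \<open>- x 2 * Q m\<close> together with \<open>x 0 * ad (x 1) (Q m)\<close>, and the latter is a
  multiple of \<open>x 0 * Q (m + 2)\<close> modulo the ideal. The result feeds the induction for
  \<open>x 1 * Q m\<close>.\<close>

lemma x2_Q:
  assumes "x 0 * Q 1 \<in> T 2" "m \<ge> 1"
  shows "x 2 * Q m \<in> T (m + 3)"
proof -
  obtain r where "ad (x 1) (Q m) - r \<cdot> Q (m + 2) \<in> I" using ad_x1_Q[OF I h2] .
  then have "x 0 * (ad (x 1) (Q m) - r \<cdot> Q (m + 2)) \<in> T (m + 3)" by (intro T_I ideal_closed(3)[OF I])
  then have "x 0 * ad (x 1) (Q m) - r \<cdot> (x 0 * Q (m + 2)) \<in> T (m + 3)"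
    by (simp add: right_diff_distrib U_comm2)
  moreover have "x 0 * Q (m + 2) \<in> T (m + 3)"
    using x0_Q[OF assms(1), of "m + 2"] by (simp add: eval_nat_numeral)
  ultimately have 1: "x 0 * ad (x 1) (Q m) \<in> T (m + 3)" by (rule T_diff_scl)
  have "ad (x 1) (x 0 * Q m) = (x 0 * ad (x 1) (Q m) - x 2 * Q m :: 'k UW)"
    by (simp add: ad_simps(3) ad_x U_const_simps numeral_2_eq_2)
  moreover have "ad (x 1) (x 0 * Q m) \<in> T (m + 3)"
    using T_ad1[OF x0_Q[OF assms]] by (simp add: eval_nat_numeral)
  ultimately have "x 0 * ad (x 1) (Q m) - x 2 * Q m \<in> T (m + 3)" by (simp only:)
  from T_diff[OF 1 this] have "x 0 * ad (x 1) (Q m) - (x 0 * ad (x 1) (Q m) - x 2 * Q m) \<in> T (m + 3)" .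
  then show ?thesis by simp
qed

text \<open>Applying \<open>ad (x 0)\<close> to \<open>x 1 * Q m\<close> gives
  \<open>x 1 * ad (x 0) (Q m)\<close> up to \<open>x 2 * Q m\<close>, which is already
  reduced.\<close>

lemma x1_Q:
  assumes "x 0 * Q 1 \<in> T 2" "x 1 * Q 1 \<in> T 3" "m \<ge> 1"
  shows "x 1 * Q m \<in> T (m + 2)"
  using assms(3)
proof (induction m rule: dec_induct)
  case base then show ?case using assms(2) by (simp add: eval_nat_numeral)
next
  case (step m)
  have "ad (x 0) (x 1 * Q m) = (x 2 * Q m + x 1 * ad (x 0) (Q m) :: 'k UW)"
    by (simp add: ad_simps(3) ad_x U_const_simps numeral_2_eq_2)
  moreover have "ad (x 0) (x 1 * Q m) \<in> T (m + 3)" using T_ad0[OF step.IH] by (simp add: eval_nat_numeral)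
  ultimately have "x 2 * Q m + x 1 * ad (x 0) (Q m) \<in> T (m + 3)" by (simp only:)
  from T_diff[OF this x2_Q[OF assms(1) step(1)]]
  have "x 2 * Q m + x 1 * ad (x 0) (Q m) - x 2 * Q m \<in> T (m + 3)" .
  then have "x 1 * ad (x 0) (Q m) \<in> T (m + 3)" by simp
  then show ?case using T_shift step(1) by (simp add: eval_nat_numeral)
qed

end

section \<open>The elements \<open>h1\<close> and \<open>h3\<close> as reduction rules for products
  with \<open>Q 1\<close>\<close>

lemma e_swap_21: "e 2 * (e 1 * z) = e 1 * (e 2 * z) - e 3 * z"
  using x_swap[of 1 0 z] by (simp add: U_const_simps eval_nat_numeral)

lemma Q_e: "Q 1 = e 2 * e 2 - e 1 * e 3 + e 4" "Q 2 = e 2 * e 3 - e 1 * e 4 + e 5"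
  "Q 3 = e 2 * e 4 - e 1 * e 5 + e 6"
  by (simp_all add: G_def U_const_simps eval_nat_numeral)

text \<open>The images explain the coefficients. With \<open>c = a (a - 1)\<close>, the element
  \<open>x 0 * Q 1\<close> maps to \<open>c u v^4\<close>, \<open>x 4\<close> to
  \<open>u v^4 - 4 a v^5\<close>, and \<open>Q 2\<close> to \<open>2 c v^5\<close>. So
  \<open>c\<close> removes \<open>u v^4\<close>, and \<open>2 a\<close> removes the remaining
  \<open>v^5\<close>.\<close>

lemma h1_Q: "h1 a = x 0 * Q 1 - (a * (a - 1)) \<cdot> x 4 - (2 * a) \<cdot> Q 2"
proof -
  have x: "x 0 = e 1" "x 4 = e 5" by simp_all
  have a: "a * (a - 1) = a^2 + a - 2 * a" by (simp add: algebra_simps power2_eq_square)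
  show ?thesis unfolding h1_def Q_e x a
    by (simp only: U.scale_left_distrib U.scale_left_diff_distrib U.scale_right_distrib U.scale_right_diff_distrib
      U_const_simps(1) mult_1_left) (simp add: algebra_simps power2_eq_square U_const_simps)
qed

text \<open>The multiple of \<open>x 0 * h1 a\<close> cancels the words of length 4 in
  \<open>h3 a\<close>, the multiple of \<open>x 1 * Q 1\<close> cancels \<open>e 2 ^ 3\<close>, and
  that of \<open>x 0 * Q 2\<close> the other words of length 3. The square of \<open>e 3\<close> is
  then traded by means of \<open>h2\<close>, where it has coefficient 3; the outer factor 3 clears
  this denominator.\<close>

lemma h3_Q:
  "3 \<cdot> (h3 a + 4 \<cdot> (x 0 * h1 a) + 4 \<cdot> (x 1 * Q 1) + (4 + 8 * a) \<cdot> (x 0 * Q 2)) =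
    (20 * a^2 + 14 * a - 3) \<cdot> h2 + (80 * a^2 + 56 * a) \<cdot> Q 3 + (48 * a^3 - 12 * a^2 - 36 * a) \<cdot> x 5"
proof -
  \<comment> \<open>Nine words of weight 6 with indices in increasing order. Only
    \<open>x 1 * Q 1\<close> has to be reordered to be expressed in them, which is what
    \<open>e_swap_21\<close> does.\<close>
  define W1 W2 W3 W4 W5 W6 W7 W8 W9 where W_defs: "W1 = e 1 * (e 1 * (e 2 * (e 2 :: 'a UW)))" "W2 = e 1 * (e 1 * (e 1 * (e 3 :: 'a UW)))"
    "W3 = e 1 * (e 2 * (e 3 :: 'a UW))" "W4 = e 1 * (e 1 * (e 4 :: 'a UW))" "W5 = e 1 * (e 5 :: 'a UW)"
    "W6 = e 2 * (e 2 * (e 2 :: 'a UW))" "W7 = e 2 * (e 4 :: 'a UW)" "W8 = e 3 * (e 3 :: 'a UW)" "W9 = (e 6 :: 'a UW)"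
  have x: "x 0 = e 1" "x 1 = e 2" "x 5 = e 6" by (simp_all add: eval_nat_numeral)
  have n: "4 * z = 4 \<cdot> z" "3 * z = 3 \<cdot> z" "2 * z = 2 \<cdot> z" "- 4 * z = (-4) \<cdot> z" for z :: "'a UW"
    by (simp_all add: U_const_numeral U_const_simps)
  have 1: "x 0 * h1 a = W1 - W2 - (2 * a) \<cdot> W3 + (1 + 2 * a) \<cdot> W4 - (a^2 + a) \<cdot> W5"
    unfolding h1_def W_defs x by (simp only: right_diff_distrib distrib_left U_scale_simps mult.assoc power2_eq_square)
  have 2: "h3 a = (-4) \<cdot> W1 - 4 \<cdot> W6 + 4 \<cdot> W2 + (20 * a ^ 2 + 14 * a - 7) \<cdot> W8
     - (16 * a ^ 2 + 18 * a + 5) \<cdot> W5 + (16 * a ^ 3 + 36 * a ^ 2 + 16 * a - 2) \<cdot> W9"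
    unfolding h3_def W_defs n mult.assoc power2_eq_square power3_eq_cube ..
  have 3: "h2 = W5 - 4 \<cdot> W7 + 3 \<cdot> W8 + 2 \<cdot> W9"
    unfolding h2_def W_defs n mult.assoc power2_eq_square ..
  have 4: "x 1 * Q 1 = W6 - W3 + W8 + W7"
    unfolding Q_e x W_defs by (simp only: right_diff_distrib distrib_left e_swap_21) simp
  have 5: "x 0 * Q 2 = W3 - W4 + W5"
    unfolding Q_e x W_defs by (simp only: right_diff_distrib distrib_left)
  have 6: "Q 3 = W7 - W5 + W9" unfolding Q_e W_defs ..
  define gs where "gs = [W1, W2, W3, W4, W5, W6, W7, W8, W9]"
  obtain V :: "'a list \<Rightarrow> 'a UW" where V: "\<And>as bs. length as = length bs \<Longrightarrow> V as + V bs = V (map2 (+) as bs)"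
    "\<And>as bs. length as = length bs \<Longrightarrow> V as - V bs = V (map2 (-) as bs)"
    "\<And>r as. r \<cdot> V as = V (map ((*) r) as)"
    and g: "\<And>k. k < length gs \<Longrightarrow> gs ! k = V (map (\<lambda>l. if l = k then 1 else 0) [0..<length gs])"
    by (rule coefficient_lists[of gs]) blast
  have W: "W1 = V [1,0,0,0,0,0,0,0,0]" "W2 = V [0,1,0,0,0,0,0,0,0]" "W3 = V [0,0,1,0,0,0,0,0,0]"
     "W4 = V [0,0,0,1,0,0,0,0,0]" "W5 = V [0,0,0,0,1,0,0,0,0]" "W6 = V [0,0,0,0,0,1,0,0,0]"
     "W7 = V [0,0,0,0,0,0,1,0,0]" "W8 = V [0,0,0,0,0,0,0,1,0]" "W9 = V [0,0,0,0,0,0,0,0,1]"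
    using g[of 0] g[of 1] g[of 2] g[of 3] g[of 4] g[of 5] g[of 6] g[of 7] g[of 8]
    by (simp_all add: gs_def upt_rec)
  have x5: "x 5 = W9" unfolding W_defs x ..
  show ?thesis unfolding 1 2 3 4 5 6 x5 W
    by (simp only: V list.map zip.simps list.case prod.case length_Cons list.size refl)
      (simp add: algebra_simps power2_eq_square power3_eq_cube)
qed

section \<open>Representations on sequences and linear independence\<close>

text \<open>Linear operators form a type of their own so that they are a ring and can be the target
  of an algebra homomorphism. Linearity is encoded by the single law for
  \<open>g + r h\<close>.\<close>

typedef (overloaded) 'k endo =
  "{f :: (nat \<Rightarrow> 'k::field) \<Rightarrow> nat \<Rightarrow> 'k. \<forall>g h r. f (\<lambda>m. g m + r * h m) = (\<lambda>m. f g m + r * f h m)}"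
  morphisms app Endo
  by (rule exI[of _ "\<lambda>g. g"]) simp

setup_lifting type_definition_endo

lemma app_linear: "app f (\<lambda>m. g m + r * h m) = (\<lambda>m. app f g m + r * app f h m)"
  using app[of f] by blast

lemma app_0: "app f (\<lambda>m. 0) = (\<lambda>m. 0)"
proof
  fix m
  show "app f (\<lambda>m. 0) m = 0"
    using fun_cong[OF app_linear[of f "\<lambda>m. 0" 1 "\<lambda>m. 0"], of m]
    by (simp only: mult_1_left mult_zero_right add_0_right) (metis add_cancel_right_right)
qed

lemma app_add: "app f (\<lambda>m. g m + h m) = (\<lambda>m. app f g m + app f h m)"
  using app_linear[of f g 1 h] by simp

lemma app_scale: "app f (\<lambda>m. r * h m) = (\<lambda>m. r * app f h m)"
  using app_linear[of f "\<lambda>m. 0" r h] by (simp add: app_0)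

instantiation endo :: (field) ring_1
begin
lift_definition zero_endo :: "'a endo" is "\<lambda>g m. 0" by simp
lift_definition one_endo :: "'a endo" is "\<lambda>g. g" by simp
lift_definition plus_endo :: "'a endo \<Rightarrow> 'a endo \<Rightarrow> 'a endo" is "\<lambda>f f' g m. f g m + f' g m"
  by (simp add: algebra_simps)
lift_definition minus_endo :: "'a endo \<Rightarrow> 'a endo \<Rightarrow> 'a endo" is "\<lambda>f f' g m. f g m - f' g m"
  by (simp add: algebra_simps)
lift_definition uminus_endo :: "'a endo \<Rightarrow> 'a endo" is "\<lambda>f g m. - f g m"
  by (simp add: algebra_simps)
lift_definition times_endo :: "'a endo \<Rightarrow> 'a endo \<Rightarrow> 'a endo" is "\<lambda>f f' g. f (f' g)"
  by simp
instance
proof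
  fix a b c :: "'a endo"
  show "a * b * c = a * (b * c)" "1 * a = a" "a * 1 = a" "(a + b) * c = a * c + b * c" "a + b + c = a + (b + c)"
    "a + b = b + a" "0 + a = a" "- a + a = 0" "a - b = a + - b"
    by (transfer; simp add: algebra_simps)+
  show "a * (b + c) = a * b + a * c"
    by (rule app_inject[THEN iffD1]) (simp add: times_endo.rep_eq plus_endo.rep_eq app_add fun_eq_iff)
  have "app 0 (\<lambda>_. 1) 0 \<noteq> (app 1 (\<lambda>_. 1) 0 :: 'a)" by (simp add: zero_endo.rep_eq one_endo.rep_eq)
  then show "(0 :: 'a endo) \<noteq> 1" by metis
qed
end

lift_definition endo_const :: "'k::field \<Rightarrow> 'k endo" is "\<lambda>r g m. r * g m"
  by (simp add: algebra_simps)

lift_definition wshift :: "(nat \<Rightarrow> 'k::field) \<Rightarrow> 'k endo" is "\<lambda>p g m. p m * g (Suc m)"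
  by (simp add: algebra_simps)

lemmas app_simps = zero_endo.rep_eq one_endo.rep_eq plus_endo.rep_eq minus_endo.rep_eq uminus_endo.rep_eq
  times_endo.rep_eq endo_const.rep_eq wshift.rep_eq

lemma endo_eqI: "(\<And>g m. app a g m = app b g m) \<Longrightarrow> a = b"
  by (metis app_inject ext)

lemma algebra_over_endo: "algebra_over endo_const"
  unfolding algebra_over_def
  by (auto intro!: endo_eqI simp: app_simps algebra_simps app_scale)

text \<open>Composing two weighted shifts multiplies the first weight by the second one moved by one
  place. Moving \<open>X - m\<close> by one place changes it by 1, which accounts for
  \<open>v ^ 2\<close> in the first relation and \<open>v * w\<close> in the second.\<close>

lemma wshift_relations:
  "wshift (\<lambda>m. X - of_nat m) * wshift (\<lambda>_. 1) - wshift (\<lambda>_. 1) * wshift (\<lambda>m. X - of_nat m) - wshift (\<lambda>_. 1) ^ 2 = 0"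
  "wshift (\<lambda>m. X - of_nat m) * wshift (\<lambda>_. Y) - wshift (\<lambda>_. Y) * wshift (\<lambda>m. X - of_nat m)
    - wshift (\<lambda>_. 1) * wshift (\<lambda>_. Y) = 0"
  "wshift (\<lambda>_. 1) * wshift (\<lambda>_. Y) - wshift (\<lambda>_. Y) * wshift (\<lambda>_. 1) = 0"
  by (auto intro!: endo_eqI simp: app_simps algebra_simps power2_eq_square)

lift_definition rep_S :: "'k::field \<Rightarrow> 'k \<Rightarrow> 'k salg \<Rightarrow> 'k endo" is
  "\<lambda>X Y. free_eval endo_const (case_sgen (wshift (\<lambda>m. X - of_nat m)) (wshift (\<lambda>_. 1)) (wshift (\<lambda>_. Y)))"
  by (rule free_eval_ideal_rel[OF algebra_over_endo])
    (auto simp: S_rels_def free_eval_simps[OF algebra_over_endo] power2_eq_square wshift_relations[unfolded power2_eq_square])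

lift_definition rep_R :: "'k::field \<Rightarrow> 'k jordan \<Rightarrow> 'k endo" is
  "\<lambda>X. free_eval endo_const (case_jgen (wshift (\<lambda>m. X - of_nat m)) (wshift (\<lambda>_. 1)))"
  by (rule free_eval_ideal_rel[OF algebra_over_endo])
    (auto simp: jordan_rels_def free_eval_simps[OF algebra_over_endo] power2_eq_square wshift_relations[unfolded power2_eq_square])

lemma algebra_hom_rep_S: "algebra_hom S_const endo_const (rep_S X Y)"
proof -
  note [simp] = free_eval_simps[OF algebra_over_endo]
  have "rep_S X Y (x + y) = rep_S X Y x + rep_S X Y y" for x y
    by (induct x rule: salg.abs_induct, induct y rule: salg.abs_induct) (simp add: plus_salg.abs_eq rep_S.abs_eq)
  moreover have "rep_S X Y (x * y) = rep_S X Y x * rep_S X Y y" for x y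
    by (induct x rule: salg.abs_induct, induct y rule: salg.abs_induct) (simp add: times_salg.abs_eq rep_S.abs_eq)
  moreover have "rep_S X Y 1 = 1" "rep_S X Y (S_const r) = endo_const r" for r
    by (simp_all add: one_salg.abs_eq S_const.abs_eq rep_S.abs_eq)
  ultimately show ?thesis by (simp only: algebra_hom_def) blast
qed

lemma algebra_hom_rep_R: "algebra_hom R_const endo_const (rep_R X)"
proof -
  note [simp] = free_eval_simps[OF algebra_over_endo]
  have "rep_R X (x + y) = rep_R X x + rep_R X y" for x y
    by (induct x rule: jordan.abs_induct, induct y rule: jordan.abs_induct) (simp add: plus_jordan.abs_eq rep_R.abs_eq)
  moreover have "rep_R X (x * y) = rep_R X x * rep_R X y" for x y
    by (induct x rule: jordan.abs_induct, induct y rule: jordan.abs_induct) (simp add: times_jordan.abs_eq rep_R.abs_eq)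
  moreover have "rep_R X 1 = 1" "rep_R X (R_const r) = endo_const r" for r
    by (simp_all add: one_jordan.abs_eq R_const.abs_eq rep_R.abs_eq)
  ultimately show ?thesis by (simp only: algebra_hom_def) blast
qed

lemma rep_gens: "rep_S X Y S_u = wshift (\<lambda>m. X - of_nat m)" "rep_S X Y S_v = wshift (\<lambda>_. 1)"
  "rep_S X Y S_w = wshift (\<lambda>_. Y)" "rep_R X R_u = wshift (\<lambda>m. X - of_nat m)" "rep_R X R_v = wshift (\<lambda>_. 1)"
  by (simp_all add: S_u.abs_eq S_v.abs_eq S_w.abs_eq R_u.abs_eq R_v.abs_eq rep_S.abs_eq rep_R.abs_eq
      free_eval_simps[OF algebra_over_endo])

lemma algebra_homD:
  assumes "algebra_hom c d f"
  shows "f 1 = 1" "f (p + q) = f p + f q" "f (p * q) = f p * f q" "f (c r) = d r" "f 0 = 0" "f (- p) = - f p"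
    "f (p - q) = f p - f q" "f (p ^ n) = f p ^ n" "f (sum h A) = (\<Sum>i\<in>A. f (h i))" "f (of_nat n) = of_nat n"
    "f (numeral k) = numeral k"
proof -
  show 1: "f 1 = 1" "f (x + y) = f x + f y" "f (x * y) = f x * f y" "f (c r) = d r" for x y r
    using assms by (auto simp: algebra_hom_def)
  show 0: "f 0 = 0" using 1(2)[of 0 0] by simp
  show m: "f (- x) = - f x" for x using 1(2)[of x "- x"] 0 by (simp add: eq_neg_iff_add_eq_0 add.commute)
  show "f (p - q) = f p - f q" using 1(2)[of p "- q"] m by simp
  show "f (p ^ n) = f p ^ n" by (induction n) (simp_all add: 1)
  show "f (sum h A) = (\<Sum>i\<in>A. f (h i))" by (induction A rule: infinite_finite_induct) (simp_all add: 1 0)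
  show n: "f (of_nat n) = of_nat n" for n by (induction n) (simp_all add: 1 0)
  show "f (numeral k) = numeral k" using n[of "numeral k"] by simp
qed

lemma algebra_hom_comp: "algebra_hom c d f \<Longrightarrow> algebra_hom d d' g \<Longrightarrow> algebra_hom c d' (\<lambda>z. g (f z))"
  by (simp add: algebra_hom_def)

lemma app_wshift_1_power: "app (wshift (\<lambda>_. 1) ^ n) g m = g (m + n)"
  by (induction n arbitrary: m) (simp_all add: app_simps)

lemma app_of_nat: "app (of_nat n) g m = of_nat n * g m"
  by (induction n) (simp_all add: app_simps algebra_simps)

text \<open>Common interface to both families of representations: \<open>Y\<close> is a free
  parameter for \<open>phi\<close>, whereas for \<open>lam a\<close> it is fixed at
  \<open>a\<close>.\<close>

definition acts :: "'k::field \<Rightarrow> 'k \<Rightarrow> ('k UW \<Rightarrow> 'k endo) \<Rightarrow> bool" where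
  "acts X Y \<rho> \<longleftrightarrow> algebra_hom U_const endo_const \<rho> \<and>
    (\<forall>i g m. app (\<rho> (x i)) g m = (X - of_nat m - of_nat i * Y) * g (m + i + 1))"

lemma acts_phi: "acts X Y (\<lambda>z. rep_S X Y (phi z))"
proof -
  have "app (rep_S X Y (phi (x i))) g m = (X - of_nat m - of_nat i * Y) * g (m + i + 1)" for i g m
    by (simp add: phi_e algebra_homD[OF algebra_hom_rep_S] rep_gens app_simps app_wshift_1_power app_of_nat
        algebra_simps)
  then show ?thesis unfolding acts_def using algebra_hom_comp[OF algebra_hom_phi algebra_hom_rep_S] by blast
qed

lemma acts_lam: "acts X a (\<lambda>z. rep_R X (lam a z))"
proof -
  have "app (rep_R X (lam a (x i))) g m = (X - of_nat m - of_nat i * a) * g (m + i + 1)" for i g m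
    by (simp add: lam_e algebra_homD[OF algebra_hom_rep_R] rep_gens app_simps app_wshift_1_power app_of_nat
        algebra_simps)
  then show ?thesis unfolding acts_def using algebra_hom_comp[OF algebra_hom_lam algebra_hom_rep_R] by blast
qed

context
  fixes X Y :: "'k::field" and \<rho>
  assumes acts: "acts X Y \<rho>"
begin

lemma acts_hom: "algebra_hom U_const endo_const \<rho>"
  and acts_x: "app (\<rho> (x i)) g m = (X - of_nat m - of_nat i * Y) * g (m + i + 1)"
  using acts by (auto simp: acts_def)

lemma acts_x0_power: "app (\<rho> (x 0 ^ a)) g m = (\<Prod>s<a. X - of_nat m - of_nat s) * g (m + a)"
  by (induction a arbitrary: m)
    (simp_all add: algebra_homD[OF acts_hom] app_simps acts_x prod.lessThan_Suc_shift algebra_simps del: prod.lessThan_Suc)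

lemma acts_x1_power: "app (\<rho> (x 1 ^ b)) g m = (\<Prod>t<b. X - of_nat m - 2 * of_nat t - Y) * g (m + 2 * b)"
  by (induction b arbitrary: m)
    (simp_all add: algebra_homD[OF acts_hom] app_simps acts_x prod.lessThan_Suc_shift algebra_simps del: prod.lessThan_Suc)

lemma acts_e': "app (\<rho> (e' n)) g m = (if n = 0 then 1 else X - of_nat m - of_nat (n - 1) * Y) * g (m + n)"
  using acts_x[of "n - 1"] by (cases n) (simp_all add: e'_def algebra_homD[OF acts_hom] app_simps)

end

section \<open>Independence through distinct degrees\<close>

lemma poly_family_independent:
  fixes P :: "'i \<Rightarrow> 'k::field_char_0 poly"
  assumes "finite K" "\<And>k. k \<in> K \<Longrightarrow> P k \<noteq> 0" "inj_on (\<lambda>k. degree (P k)) K"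
    and 0: "(\<Sum>k\<in>K. smult (r k) (P k)) = 0"
  shows "\<forall>k\<in>K. r k = 0"
proof (rule ccontr)
  assume nz: "\<not> (\<forall>k\<in>K. r k = 0)"
  define K' where "K' = {k \<in> K. r k \<noteq> 0}"
  have K': "finite K'" "K' \<noteq> {}" using assms(1) nz by (auto simp: K'_def)
  have "Max ((\<lambda>k. degree (P k)) ` K') \<in> (\<lambda>k. degree (P k)) ` K'" using K' by (intro Max_in) auto
  then obtain k where "k \<in> K'" "Max ((\<lambda>k. degree (P k)) ` K') = degree (P k)" by blast
  with K' have k: "k \<in> K'" "\<And>l. l \<in> K' \<Longrightarrow> degree (P l) \<le> degree (P k)"
    using Max_ge[of "(\<lambda>k. degree (P k)) ` K'"] by fastforce+
  have less: "degree (P l) < degree (P k)" if "l \<in> K'" "l \<noteq> k" for l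
    using k that inj_onD[OF assms(3), of l k] by (fastforce simp: K'_def le_less)
  have "0 = coeff (\<Sum>l\<in>K. smult (r l) (P l)) (degree (P k))" by (simp add: 0)
  also have "\<dots> = (\<Sum>l\<in>K. r l * coeff (P l) (degree (P k)))" by (simp add: coeff_sum)
  also have "\<dots> = (\<Sum>l\<in>{k}. r l * coeff (P l) (degree (P k)))"
  proof (rule sum.mono_neutral_right[OF assms(1)])
    show "\<forall>l\<in>K - {k}. r l * coeff (P l) (degree (P k)) = 0"
      using coeff_eq_0[OF less] by (fastforce simp: K'_def)
  qed (use k(1) in \<open>auto simp: K'_def\<close>)
  also have "\<dots> \<noteq> 0" using k(1) assms(2) by (auto simp: K'_def)
  finally show False by simp
qed

text \<open>Taking for \<open>g\<close> the indicator of one position isolates a single weight; the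
  combination of polynomials left over vanishes at every point of an infinite field.\<close>

lemma weighted_independent:
  fixes P :: "'i \<Rightarrow> 'k::field_char_0 poly"
  assumes "finite K" "\<And>k. k \<in> K \<Longrightarrow> P k \<noteq> 0" "inj_on (\<lambda>k. (N k :: nat, degree (P k))) K"
    and 0: "\<And>X g. (\<Sum>k\<in>K. r k * (poly (P k) X * g (N k))) = 0"
  shows "\<forall>k\<in>K. r k = 0"
proof
  fix k assume k: "k \<in> K"
  let ?K = "{l \<in> K. N l = N k}"
  have "poly (\<Sum>l\<in>?K. smult (r l) (P l)) X = 0" for X
  proof -
    have "poly (\<Sum>l\<in>?K. smult (r l) (P l)) X = (\<Sum>l\<in>?K. r l * (poly (P l) X * (if N l = N k then 1 else 0)))"
      by (simp add: poly_sum)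
    also have "\<dots> = (\<Sum>l\<in>K. r l * (poly (P l) X * (if N l = N k then 1 else 0)))"
      using assms(1) by (intro sum.mono_neutral_left) auto
    also have "\<dots> = 0" by (rule 0)
    finally show ?thesis .
  qed
  then have "(\<Sum>l\<in>?K. smult (r l) (P l)) = 0" using poly_all_0_iff_0 by blast
  then have "\<forall>l\<in>?K. r l = 0"
    using assms(1-3) by (intro poly_family_independent) (auto simp: inj_on_def)
  then show "r k = 0" using k by simp
qed


lemma span_decompose:
  fixes M :: "'i \<Rightarrow> 'k::field UW"
  assumes I: "two_sided_ideal I" and "z \<in> U.span (M ` A \<union> I)"
  obtains K r where "finite K" "K \<subseteq> A" "z - (\<Sum>k\<in>K. r k \<cdot> M k) \<in> I"
proof -
  have "\<exists>K r. finite K \<and> K \<subseteq> A \<and> z - (\<Sum>k\<in>K. r k \<cdot> M k) \<in> I"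
    using assms(2)
  proof (induction z rule: U.span_induct_alt)
    case base show ?case by (rule exI[of _ "{}"]) (simp add: ideal_closed(1)[OF I])
  next
    case (step s t z)
    then obtain K r where K: "finite K" "K \<subseteq> A" "z - (\<Sum>k\<in>K. r k \<cdot> M k) \<in> I" by blast
    from step(1) show ?case
    proof
      assume "t \<in> I"
      then have "s \<cdot> t + (z - (\<Sum>k\<in>K. r k \<cdot> M k)) \<in> I" using K by (intro ideal_closed(2)[OF I ideal_closed(3)[OF I]])
      then show ?thesis using K by (intro exI[of _ K] exI[of _ r]) (simp add: add_diff_eq)
    next
      assume "t \<in> M ` A"
      then obtain l where l: "l \<in> A" "t = M l" by blast
      define r' where "r' k = (if k \<in> K then r k else 0) + (if k = l then s else 0)" for k
      have "(\<Sum>k\<in>insert l K. r' k \<cdot> M k) =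
          (\<Sum>k\<in>insert l K. if k \<in> K then r k \<cdot> M k else 0) + (\<Sum>k\<in>insert l K. if k = l then s \<cdot> M k else 0)"
        unfolding sum.distrib[symmetric] by (rule sum.cong) (auto simp: r'_def U_const_simps distrib_right)
      also have "(\<Sum>k\<in>insert l K. if k \<in> K then r k \<cdot> M k else 0) = (\<Sum>k\<in>K. r k \<cdot> M k)"
        using K(1) by (intro sum.mono_neutral_cong_right) auto
      also have "(\<Sum>k\<in>insert l K. if k = l then s \<cdot> M k else 0) = s \<cdot> M l" using K(1) by simp
      finally have "s \<cdot> t + z - (\<Sum>k\<in>insert l K. r' k \<cdot> M k) = z - (\<Sum>k\<in>K. r k \<cdot> M k)"
        using l by simp
      then have "s \<cdot> t + z - (\<Sum>k\<in>insert l K. r' k \<cdot> M k) \<in> I" using K(3) by (simp only:)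
      moreover have "finite (insert l K)" "insert l K \<subseteq> A" using K l by auto
      ultimately show ?thesis by blast
    qed
  qed
  then show thesis using that by blast
qed

text \<open>The representations annihilate \<open>z\<close> and \<open>I\<close>, hence also the
  combination of monomials congruent to \<open>z\<close>; independence makes that combination
  zero.\<close>

lemma mem_of_independent:
  fixes M :: "'i \<Rightarrow> 'k::field UW"
  assumes I: "two_sided_ideal I" and z: "z \<in> U.span (M ` A \<union> I)"
    and \<rho>: "\<And>s. algebra_hom U_const endo_const (\<rho> s)" "\<And>s i. i \<in> I \<Longrightarrow> \<rho> s i = 0" "\<And>s. \<rho> s z = 0"
    and ind: "\<And>K r. finite K \<Longrightarrow> K \<subseteq> A \<Longrightarrow> (\<And>s g. (\<Sum>k\<in>K. r k * app (\<rho> s (M k)) g 0) = 0) \<Longrightarrow> \<forall>k\<in>K. r k = 0"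
  shows "z \<in> I"
proof -
  obtain K r where K: "finite K" "K \<subseteq> A" "z - (\<Sum>k\<in>K. r k \<cdot> M k) \<in> I"
    by (rule span_decompose[OF I z])
  have "\<forall>k\<in>K. r k = 0"
  proof (rule ind[OF K(1,2)])
    fix s g
    have app_sum: "app (sum f L) g 0 = (\<Sum>k\<in>L. app (f k) g 0)" for f :: "'i \<Rightarrow> 'k endo" and L
      by (induction L rule: infinite_finite_induct) (simp_all add: app_simps)
    have "\<rho> s (\<Sum>k\<in>K. r k \<cdot> M k) = 0"
      using \<rho>(2)[OF K(3), of s] \<rho>(3)[of s] by (simp add: algebra_homD(7)[OF \<rho>(1)])
    then have "app (\<Sum>k\<in>K. endo_const (r k) * \<rho> s (M k)) g 0 = app 0 g 0"
      by (simp add: algebra_homD[OF \<rho>(1)])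
    then show "(\<Sum>k\<in>K. r k * app (\<rho> s (M k)) g 0) = 0" by (simp add: app_sum app_simps)
  qed
  then have "(\<Sum>k\<in>K. r k \<cdot> M k) = 0" by (simp add: U_const_simps)
  then show ?thesis using K(3) by simp
qed

definition phi_mon :: "nat \<times> nat \<times> nat \<Rightarrow> 'k::field UW" where
  "phi_mon = (\<lambda>(a, b, n). x 0 ^ a * (x 1 ^ b * e' n))"

lemma degree_linear_prod:
  fixes f :: "nat \<Rightarrow> 'k::field_char_0"
  assumes "s \<noteq> 0"
  shows "degree (\<Prod>t<b. [:f t, s:]) = b" "(\<Prod>t<b. [:f t, s:]) \<noteq> 0"
  using assms by (auto simp: degree_prod_eq_sum_degree prod_zero_iff)

text \<open>At \<open>X = a\<close> only monomials with at most \<open>a\<close> factors \<open>x\<^sub>0\<close> survive, so one can induct on \<open>a\<close>; the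
  surviving polynomials in \<open>Y\<close> have distinct degrees.\<close>

lemma phi_mon_independent:
  fixes r :: "nat \<times> nat \<times> nat \<Rightarrow> 'k::field_char_0"
  assumes \<rho>: "\<And>X Y. acts X Y (\<rho> X Y)" and K: "finite K" "K \<subseteq> {(a, b, n). n = 0 \<or> n \<ge> 3}"
    and 0: "\<And>X Y g. (\<Sum>k\<in>K. r k * app (\<rho> X Y (phi_mon k)) g 0) = 0"
  shows "\<forall>k\<in>K. r k = 0"
proof -
  define V where "V X k = (\<Prod>s<fst k. X - of_nat s)" for X :: 'k and k :: "nat \<times> nat \<times> nat"
  \<comment> \<open>After \<open>x 0 ^ a\<close> the position is \<open>a\<close>, which equals the
    chosen \<open>X\<close>. So \<open>X\<close> cancels from all later factors, and a polynomial in
    \<open>Y\<close> remains.\<close>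
  define P where "P = (\<lambda>(a :: nat, b, n). (\<Prod>t<b. [:- 2 * of_nat t, -1 :: 'k:]) *
    (if n = 0 then 1 else [:- 2 * of_nat b, - of_nat (n - 1):]))"
  define N where "N = (\<lambda>(a, b, n :: nat). a + 2 * b + n :: nat)"
  have val: "app (\<rho> X Y (phi_mon k)) g 0 = V X k * (poly (P k) Y * g (N k))" if "X = of_nat (fst k)" for X Y g k
  proof -
    obtain a b n where k: "k = (a, b, n)" by (cases k)
    have neg: "- (of_nat t * (2::'k)) - Y = - Y - of_nat t * 2" for t by simp
    show ?thesis using that unfolding k
      by (simp add: neg phi_mon_def algebra_homD(3)[OF acts_hom[OF \<rho>]] app_simps acts_x0_power[OF \<rho>] acts_x1_power[OF \<rho>, unfolded One_nat_def]
        acts_e'[OF \<rho>] V_def P_def N_def poly_prod algebra_simps)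
  qed
  have val0: "app (\<rho> X Y (phi_mon k)) g 0 = 0" if "X = of_nat a" "a < fst k" for X Y g k a
  proof -
    obtain a' b n where k: "k = (a', b, n)" by (cases k)
    have "(\<Prod>s<a'. of_nat a - of_nat s :: 'k) = 0" using that k by auto
    then show ?thesis using that unfolding k
      by (simp add: phi_mon_def algebra_homD(3)[OF acts_hom[OF \<rho>]] app_simps acts_x0_power[OF \<rho>])
  qed
  have P0: "P k \<noteq> 0" and degP: "degree (P k) = (case k of (a, b, n) \<Rightarrow> b + (if n = 0 then 0 else 1))" if "k \<in> K" for k
  proof -
    obtain a b n where k: "k = (a, b, n)" by (cases k)
    then have n: "n = 0 \<or> n \<ge> 3" using that K by blast
    have l: "n \<noteq> 0 \<Longrightarrow> (of_nat (n - 1) :: 'k) \<noteq> 0" using n by (simp only: of_nat_eq_0_iff) auto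
    then show "P k \<noteq> 0" unfolding k by (simp add: P_def degree_linear_prod(2))
    show "degree (P k) = (case k of (a, b, n) \<Rightarrow> b + (if n = 0 then 0 else 1))" unfolding k using l
      by (simp add: P_def degree_mult_eq degree_linear_prod)
  qed
  have "\<forall>k\<in>K. fst k = a \<longrightarrow> r k = 0" for a
  proof (induction a rule: less_induct)
    case (less a)
    let ?K = "{k \<in> K. fst k = a}"
    have fact: "(\<Prod>s<a. of_nat a - of_nat s :: 'k) \<noteq> 0" by auto
    have "\<forall>k\<in>?K. r k = 0"
    proof (rule weighted_independent[of ?K P N])
      show "finite ?K" using K by simp
      show "P k \<noteq> 0" if "k \<in> ?K" for k using P0 that by blast
      show "inj_on (\<lambda>k. (N k, degree (P k))) ?K"
      proof (rule inj_onI)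
        fix k l assume kl: "k \<in> ?K" "l \<in> ?K" "(N k, degree (P k)) = (N l, degree (P l))"
        obtain b n b' n' where k: "k = (a, b, n)" "l = (a, b', n')" using kl by (metis (mono_tags) mem_Collect_eq prod.collapse)
        \<comment> \<open>Between an empty and a nonempty tail, equal weight and equal degree would
          force \<open>n = 2\<close> for the nonempty one; this is what the gap in \<open>n\<close>
          rules out.\<close>
        have "n = 0 \<or> n \<ge> 3" "n' = 0 \<or> n' \<ge> 3" using kl K k by blast+
        then show "k = l" using kl degP[of k] degP[of l] unfolding k by (auto simp: N_def split: if_splits)
      qed
      fix Y g
      have "(\<Sum>k\<in>K. r k * app (\<rho> (of_nat a) Y (phi_mon k)) g 0) =
          (\<Sum>k\<in>?K. r k * app (\<rho> (of_nat a) Y (phi_mon k)) g 0)"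
      proof (rule sum.mono_neutral_right[OF K(1)])
        show "\<forall>k\<in>K - ?K. r k * app (\<rho> (of_nat a) Y (phi_mon k)) g 0 = 0"
        proof
          fix k assume k: "k \<in> K - ?K"
          then consider "fst k < a" | "a < fst k" by fastforce
          then show "r k * app (\<rho> (of_nat a) Y (phi_mon k)) g 0 = 0"
            by cases (use less.IH k val0[OF refl] in auto)
        qed
      qed auto
      also have "\<dots> = (\<Sum>k\<in>?K. (\<Prod>s<a. of_nat a - of_nat s) * (r k * (poly (P k) Y * g (N k))))"
        by (rule sum.cong[OF refl]) (auto simp: val V_def)
      finally show "(\<Sum>k\<in>?K. r k * (poly (P k) Y * g (N k))) = 0"
        using 0 fact by (simp flip: sum_distrib_left)
    qed
    then show ?case by blast
  qed
  then show ?thesis by blast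
qed

text \<open>The flag selects the extra family \<open>Q n\<close>. The first component is then kept
  at 0 in the index sets, so that each element has only one index.\<close>

definition lam_mon :: "nat \<times> nat \<times> bool \<Rightarrow> 'k::field UW" where
  "lam_mon = (\<lambda>(k, n, q). if q then Q n else x 0 ^ k * e' n)"

lemma lam_mon_independent:
  fixes r :: "nat \<times> nat \<times> bool \<Rightarrow> 'k::field_char_0"
  assumes \<rho>: "\<And>X. acts X a (\<rho> X)" and K: "finite K" "K \<subseteq> A"
    and A: "A = {(k, n, False) | k n. n \<noteq> 1} \<or>
      A = {(k, n, False) | k n. n \<noteq> 1} \<union> {(0, n, True) | n. n \<ge> 1} \<and> a \<notin> {0, 1}"
    and Q: "\<And>X m g. app (\<rho> X (Q m)) g 0 = of_nat m * (a * (a - 1)) * g (m + 3)"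
    and 0: "\<And>X g. (\<Sum>k\<in>K. r k * app (\<rho> X (lam_mon k)) g 0) = 0"
  shows "\<forall>k\<in>K. r k = 0"
proof -
  define P where "P = (\<lambda>(k, n, q). if q then [:of_nat n * (a * (a - 1)):] else (\<Prod>s<k. [:- of_nat s, 1 :: 'k:]) *
    (if n = 0 then 1 else [:- of_nat k - of_nat (n - 1) * a, 1:]))"
  define N where "N = (\<lambda>(k, n :: nat, q). if q then n + 3 else k + n)"
  have val: "app (\<rho> X (lam_mon i)) g 0 = poly (P i) X * g (N i)" for X g i
  proof -
    obtain k n q where i: "i = (k, n, q)" by (cases i)
    have neg: "- of_nat s + X = X - of_nat s" for s by simp
    show ?thesis unfolding i
      by (simp add: neg lam_mon_def Q[unfolded One_nat_def] algebra_homD(3)[OF acts_hom[OF \<rho>]] app_simps acts_x0_power[OF \<rho>]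
        acts_e'[OF \<rho>] P_def N_def poly_prod algebra_simps)
  qed
  have P0: "P i \<noteq> 0" and degP: "degree (P i) = (case i of (k, n, q) \<Rightarrow> if q then 0 else k + (if n = 0 then 0 else 1))"
    if "i \<in> A" for i
  proof -
    obtain k n q where i: "i = (k, n, q)" by (cases i)
    have q: "q \<Longrightarrow> n \<ge> 1 \<and> a \<notin> {0, 1}" using that A unfolding i by auto
    then show "P i \<noteq> 0" unfolding i by (auto simp: P_def degree_linear_prod(2))
    show "degree (P i) = (case i of (k, n, q) \<Rightarrow> if q then 0 else k + (if n = 0 then 0 else 1))" unfolding i
      by (auto simp: P_def degree_mult_eq degree_linear_prod)
  qed
  show ?thesis
  proof (rule weighted_independent[of K P N])
    show "finite K" by (rule K)
    show "P i \<noteq> 0" if "i \<in> K" for i using P0 that K by blast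
    show "inj_on (\<lambda>k. (N k, degree (P k))) K"
    proof (rule inj_onI)
      fix i j assume ij: "i \<in> K" "j \<in> K" "(N i, degree (P i)) = (N j, degree (P j))"
      obtain k n q k' n' q' where i: "i = (k, n, q)" "j = (k', n', q')" by (metis prod.exhaust)
      have ijA: "i \<in> A" "j \<in> A" using ij K by blast+
      \<comment> \<open>Two unflagged monomials could collide only if one tail is empty and the
        other is \<open>e 1\<close>. The constant polynomials come from 1, in weight 0, and from the
        \<open>Q n\<close>, in the distinct weights \<open>n + 3\<close>.\<close>
      have "q \<Longrightarrow> k = 0" "q' \<Longrightarrow> k' = 0" "\<not> q \<Longrightarrow> n \<noteq> 1" "\<not> q' \<Longrightarrow> n' \<noteq> 1" using ijA A unfolding i by auto
      then show "i = j" using ij(3) degP[OF ijA(1)] degP[OF ijA(2)] unfolding i by (auto simp: N_def split: if_splits)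
    qed
    fix X g
    show "(\<Sum>k\<in>K. r k * (poly (P k) X * g (N k))) = 0" using 0 unfolding val .
  qed
qed

text \<open>As for the Witt relations, \<open>\<lambda>\<^sub>a\<close> is the case \<open>w = a v\<close>.\<close>

lemma G_image:
  fixes u v w :: "'a::ring_1"
  assumes uv: "u * v - v * u - v ^ 2 = 0" and uw: "u * w - w * u - v * w = 0"
    and vw: "v * w - w * v = 0"
  defines "t \<equiv> \<lambda>i::nat. (u - of_nat i * w) * v ^ i"
  shows "t i * t j - t 0 * t (i + j) + of_nat i * t (i + j + 1) = of_nat (i * j) * ((w * w - w * v) * v ^ (i + j))"
proof -
  have vw': "v ^ i * w = w * v ^ i" for i
    using vw by (simp add: power_commuting_commutes)
  have vu: "v ^ i * u = u * v ^ i - of_nat i * v ^ Suc i" for i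
  proof (induction i)
    case (Suc i)
    have "v ^ Suc i * u = v * (u * v ^ i - of_nat i * v ^ Suc i)" by (simp add: mult.assoc Suc)
    also have "\<dots> = (v * u) * v ^ i - of_nat i * v ^ Suc (Suc i)"
    proof -
      have "v * (of_nat i * v ^ Suc i) = of_nat i * v ^ Suc (Suc i)"
        by (metis mult.assoc mult_of_nat_commute power_Suc)
      then show ?thesis by (simp only: right_diff_distrib mult.assoc)
    qed
    also have "v * u = u * v - v * v" using uv by (simp add: power2_eq_square algebra_simps)
    finally show ?case by (simp add: algebra_simps)
  qed simp
  have tt: "t i * t j = ((u - of_nat i * w) * (u - of_nat j * w - of_nat i * v)) * v ^ (i + j)" for i j
  proof -
    have "v ^ i * (of_nat j * w) = of_nat j * w * v ^ i"
      using vw'[of i] by (metis mult.assoc mult_of_nat_commute)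
    then have "v ^ i * (u - of_nat j * w) = (u - of_nat j * w - of_nat i * v) * v ^ i"
      by (simp add: algebra_simps vu)
    then have "t i * t j = (u - of_nat i * w) * ((u - of_nat j * w - of_nat i * v) * v ^ i) * v ^ j"
      unfolding t_def by (metis mult.assoc)
    then show ?thesis by (simp add: mult.assoc power_add)
  qed
  \<comment> \<open>Abstracting the numerals to elements commuting with \<open>u\<close>,
    \<open>v\<close>, \<open>w\<close> leaves an identity between short words in these
    three.\<close>
  define I J where "I = (of_nat i :: 'a)" and "J = (of_nat j :: 'a)"
  have comm0: "y * I = I * y" "y * J = J * y" for y
    unfolding I_def J_def by (rule mult_of_nat_commute[symmetric])+
  have comm1: "y * (I * z) = I * (y * z)" "y * (J * z) = J * (y * z)" for y z
    by (metis comm0 mult.assoc)+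
  note comm = comm0[of u] comm0[of v] comm0[of w] comm0(1)[of J]
    comm1[of u] comm1[of v] comm1[of w] comm1(1)[of J]
  have uw': "u * w = w * u + w * v" and vw'': "v * w = w * v" and uv': "u * v = v * u + v * v"
    using uw vw uv by (simp_all add: algebra_simps power2_eq_square)
  have key: "(u - I * w) * (u - J * w - I * v) - u * (u - (I + J) * w) + I * ((u - (I + J + 1) * w) * v) =
      I * J * (w * w - w * v)"
    by (simp add: left_diff_distrib right_diff_distrib distrib_left distrib_right mult.assoc comm uw' vw'' uv')
  have "t i * t j - t 0 * t (i + j) + I * t (i + j + 1) =
    ((u - I * w) * (u - J * w - I * v) - u * (u - (I + J) * w) + I * ((u - (I + J + 1) * w) * v)) * v ^ (i + j)"
    unfolding tt by (simp add: t_def I_def J_def distrib_right left_diff_distrib[of _ _ "v ^ (i + j)"] mult.assoc add_ac)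
  also have "\<dots> = I * J * (w * w - w * v) * v ^ (i + j)" by (simp only: key)
  finally show ?thesis unfolding I_def J_def by (simp add: mult.assoc)
qed

lemma phi_G: "phi (G i j) = of_nat (i * j) * ((S_w * S_w - S_w * S_v) * S_v ^ (i + j) :: 'k::field salg)"
  using G_image[OF S_relations, of i j]
  by (simp add: G_def algebra_homD[OF algebra_hom_phi] phi_e algebra_over_of_nat[OF algebra_over_S])

lemma R_comm: "y * (R_const r * z) = R_const r * (y * z)"
  by (metis algebra_overD(4)[OF algebra_over_R] mult.assoc)

lemma lam_G: "lam a (G i j) = R_const (of_nat (i * j) * (a * (a - 1))) * (R_v ^ (i + j + 2) :: 'k::field jordan)"
proof -
  let ?w = "R_const a * (R_v :: 'k jordan)"
  have "R_u * ?w - ?w * R_u - R_v * ?w = R_const a * (R_u * R_v - R_v * R_u - R_v ^ 2)"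
    unfolding R_comm by (simp only: right_diff_distrib power2_eq_square mult.assoc)
  then have 1: "R_u * ?w - ?w * R_u - R_v * ?w = 0" by (simp only: R_relation mult_zero_right)
  have 2: "R_v * ?w - ?w * R_v = 0" unfolding R_comm by (simp only: mult.assoc diff_self)
  have "lam a (G i j) = of_nat (i * j) * ((?w * ?w - ?w * R_v) * R_v ^ (i + j))"
    using G_image[OF R_relation 1 2, of i j]
    by (simp add: G_def algebra_homD[OF algebra_hom_lam] lam_e algebra_over_of_nat[OF algebra_over_R] mult.assoc)
  also have "?w * ?w - ?w * R_v = R_const (a * (a - 1)) * R_v ^ 2"
    by (simp add: algebra_overD(1,3,7)[OF algebra_over_R] right_diff_distrib left_diff_distrib power2_eq_square mult.assoc R_comm[of R_v])
  finally show ?thesis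
    by (simp add: algebra_over_of_nat[OF algebra_over_R] algebra_overD(3)[OF algebra_over_R] mult.assoc power_add power2_eq_square power_commutes)
qed

text \<open>The image of \<open>G i j\<close> carries the factor \<open>i * j\<close>, and
  \<open>3 * (2 * 2) = 4 * (1 * 3)\<close>.\<close>

lemma phi_h2: "phi h2 = 0"
  by (simp add: h2_G algebra_homD[OF algebra_hom_phi] phi_G)

lemma numeral_R_const:
  fixes r :: "'k::field"
  shows "numeral k * (R_const r * z) = R_const (numeral k * r) * z"
  using algebra_over_of_nat[OF algebra_over_R[where 'k='k], of "numeral k"]
  by (simp add: algebra_overD(3)[OF algebra_over_R] mult.assoc)

lemma lam_h2: "lam a h2 = 0"
  by (simp add: h2_G algebra_homD[OF algebra_hom_lam] lam_G numeral_R_const)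

section \<open>The kernel of \<open>phi\<close>\<close>

lemma two_sided_ideal_kernel:
  assumes "algebra_hom c d f" shows "two_sided_ideal {z. f z = 0}"
  using algebra_homD[OF assms] by (auto simp: two_sided_ideal_def)

lemma ideal_gen_subset_kernel:
  assumes "algebra_hom c d f" "\<And>s. s \<in> B \<Longrightarrow> f s = 0" 
  shows "ideal_gen B \<subseteq> {z. f z = 0}"
  by (rule ideal_gen_minimal[OF _ two_sided_ideal_kernel[OF assms(1)]]) (use assms(2) in blast)

theorem kernel_phi: "{z :: 'k::field_char_0 UW. phi z = 0} = ideal_gen {h2}"
proof
  show sub: "ideal_gen {h2} \<subseteq> {z :: 'k UW. phi z = 0}"
    by (rule ideal_gen_subset_kernel[OF algebra_hom_phi]) (simp add: phi_h2)
  show "{z :: 'k UW. phi z = 0} \<subseteq> ideal_gen {h2}"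
  proof
    fix z :: "'k UW" assume "z \<in> {z. phi z = 0}"
    then have z: "phi z = 0" by simp
    let ?I = "ideal_gen {h2 :: 'k UW}"
    have I: "two_sided_ideal ?I" "h2 \<in> ?I" by (simp_all add: two_sided_ideal_ideal_gen ideal_gen_inc)
    have "phi_mons = phi_mon ` {(a, b, n). n = 0 \<or> n \<ge> 3}"
      unfolding phi_mons_def phi_mon_def by (auto simp: image_def)
    then have "z \<in> U.span (phi_mon ` {(a, b, n). n = 0 \<or> n \<ge> 3} \<union> ?I)" using span_phi_mons[OF I] by metis
    then show "z \<in> ?I"
    proof (rule mem_of_independent[OF I(1), where \<rho>="\<lambda>s z. rep_S (fst s) (snd s) (phi z)"])
      show "algebra_hom U_const endo_const (\<lambda>z. rep_S (fst s) (snd s) (phi z))" for s :: "'k \<times> 'k"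
        by (rule algebra_hom_comp[OF algebra_hom_phi algebra_hom_rep_S])
      show "rep_S (fst s) (snd s) (phi i) = 0" if "i \<in> ?I" for s :: "'k \<times> 'k" and i
      proof -
        have "phi i = 0" using that sub by auto
        then show ?thesis by (simp add: algebra_homD(5)[OF algebra_hom_rep_S])
      qed
      show "rep_S (fst s) (snd s) (phi z) = 0" for s :: "'k \<times> 'k"
        by (simp add: z algebra_homD(5)[OF algebra_hom_rep_S])
      fix K and r :: "nat \<times> nat \<times> nat \<Rightarrow> 'k"
      assume K: "finite K" "K \<subseteq> {(a, b, n). n = 0 \<or> n \<ge> 3}"
        and 0: "\<And>s g. (\<Sum>k\<in>K. r k * app (rep_S (fst s) (snd s) (phi (phi_mon k))) g 0) = 0"
      show "\<forall>k\<in>K. r k = 0"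
        by (rule phi_mon_independent[of "\<lambda>X Y z. rep_S X Y (phi z)", OF acts_phi K])
          (use 0[of "(_, _)"] in simp)
    qed
  qed
qed


lemma lam_x: "lam a (x i) = R_u * R_v ^ i - R_const (of_nat i * a) * (R_v ^ (i + 1) :: 'k::field jordan)"
  by (simp add: lam_e left_diff_distrib algebra_overD(3)[OF algebra_over_R] algebra_over_of_nat[OF algebra_over_R] mult.assoc)

lemma R_vu: "R_v ^ n * R_u = R_u * R_v ^ n - R_const (of_nat n) * (R_v ^ Suc n :: 'k::field jordan)"
proof (induction n)
  case (Suc n)
  have "R_v * R_u = R_u * R_v - R_v * (R_v :: 'k jordan)"
    using R_relation[where 'k='k] by (simp add: power2_eq_square algebra_simps)
  then have 1: "R_v * (R_u * z) = R_u * (R_v * z) - R_v * (R_v * z)" for z :: "'k jordan"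
    by (metis left_diff_distrib mult.assoc)
  have "R_v ^ Suc n * R_u = R_v * (R_u * R_v ^ n - R_const (of_nat n) * (R_v ^ Suc n :: 'k jordan))"
    by (simp add: mult.assoc Suc)
  also have "\<dots> = R_u * R_v ^ Suc n - R_const (of_nat (Suc n)) * R_v ^ Suc (Suc n)"
    by (simp add: right_diff_distrib 1 R_comm[of R_v] algebra_overD(1,2)[OF algebra_over_R] distrib_right)
  finally show ?case .
qed (simp add: algebra_overD(5)[OF algebra_over_R])

section \<open>The kernels of \<open>\<lambda>\<^sub>a\<close>\<close>

lemmas R_const_simps = algebra_overD(1,2,5-7)[OF algebra_over_R]

lemma R_const_mult: "R_const r * (R_const s * z) = R_const (r * s) * z"
  by (simp add: algebra_overD(3)[OF algebra_over_R] mult.assoc)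

lemma lam_h1: "lam a (h1 a) = (0 :: 'k::field jordan)"
proof -
  define c where "c = a * (a - 1)"
  have "lam a (x 0 * Q 1) = R_const c * (R_u * (R_v ^ 4 :: 'k jordan))"
    unfolding c_def by (simp add: algebra_homD(3)[OF algebra_hom_lam] lam_x[of _ 0, simplified] lam_G R_comm[of R_u] R_const_simps eval_nat_numeral)
  moreover have "lam a (c \<cdot> x 4) = R_const c * (R_u * (R_v ^ 4 :: 'k jordan)) - R_const (c * (4 * a)) * R_v ^ 5"
    unfolding algebra_homD(3,4)[OF algebra_hom_lam] lam_x by (simp add: right_diff_distrib R_const_mult)
  moreover have "lam a ((2 * a) \<cdot> Q 2) = R_const ((2 * a) * (2 * c)) * R_v ^ 5"
    unfolding algebra_homD(3,4)[OF algebra_hom_lam] lam_G by (simp add: R_const_mult c_def eval_nat_numeral)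
  moreover have "c * (4 * a) = (2 * a) * (2 * c)" by simp
  ultimately show ?thesis unfolding h1_Q c_def[symmetric] by (simp only: algebra_homD(7)[OF algebra_hom_lam]) simp
qed

text \<open>All other terms of \<open>h3_Q\<close> have known images, so that identity determines
  the image of \<open>h3 a\<close>; the coefficients of \<open>u v^5\<close> and \<open>v^6\<close>
  are compared.\<close>

lemma lam_h3: "lam a (h3 a) = (0 :: 'k::field_char_0 jordan)"
proof -
  define c where "c = a * (a - 1)"
  define P W where "P = R_u * (R_v ^ 5 :: 'k jordan)" and "W = (R_v ^ 6 :: 'k jordan)"
  note hom = algebra_homD(2-4,7)[OF algebra_hom_lam]
  have Q: "lam a (Q m) = R_const (of_nat m * c) * (R_v ^ (m + 3) :: 'k jordan)" for m
    unfolding lam_G c_def by (simp add: eval_nat_numeral)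
  have "lam a (x 1 * Q 1) = (R_u * R_v - R_const a * R_v ^ 2) * (R_const c * R_v ^ 4)"
    unfolding hom(2) lam_x Q by (simp add: numeral_2_eq_2)
  also have "\<dots> = R_u * (R_v * (R_const c * R_v ^ 4)) - R_const a * (R_v ^ 2 * (R_const c * R_v ^ 4))"
    by (simp only: left_diff_distrib mult.assoc)
  also have "\<dots> = R_const c * P - R_const (a * c) * W"
    unfolding R_comm[of R_u] R_comm[of R_v] R_comm[of "R_v ^ 2"] R_const_mult P_def W_def by (simp flip: power_Suc power_add)
  finally have x1Q1: "lam a (x 1 * Q 1) = R_const c * P - R_const (a * c) * W" .
  have x0Q2: "lam a (x 0 * Q 2) = R_const (2 * c) * P"
    unfolding hom(2) lam_x Q P_def by (simp add: R_const_simps R_comm[of R_u])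
  have Q3: "lam a (Q 3) = R_const (3 * c) * W"
    unfolding Q W_def by simp
  have x5: "lam a (x 5) = P - R_const (5 * a) * W"
    unfolding lam_x W_def P_def by simp
  \<comment> \<open>The coefficients of \<open>P\<close> and \<open>W\<close> contributed by the
    terms next to \<open>h3 a\<close>, before the outer factor 3.\<close>
  define \<alpha> \<beta> where "\<alpha> = 4 * c + (4 + 8 * a) * (2 * c)" and "\<beta> = - 4 * (a * c)"
  have "lam a (3 \<cdot> (h3 a + 4 \<cdot> (x 0 * h1 a) + 4 \<cdot> (x 1 * Q 1) + (4 + 8 * a) \<cdot> (x 0 * Q 2))) =
      lam a ((20 * a^2 + 14 * a - 3) \<cdot> h2 + (80 * a^2 + 56 * a) \<cdot> Q 3 + (48 * a^3 - 12 * a^2 - 36 * a) \<cdot> x 5)"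
    by (rule arg_cong[OF h3_Q])
  then have "R_const 3 * (lam a (h3 a) + R_const 4 * (R_const c * P - R_const (a * c) * W) + R_const (4 + 8 * a) * (R_const (2 * c) * P)) =
     R_const (80 * a^2 + 56 * a) * (R_const (3 * c) * W) + R_const (48 * a^3 - 12 * a^2 - 36 * a) * (P - R_const (5 * a) * W)"
    unfolding hom(1,3,4) hom(2)[of _ "U_const _" "_ + _"] hom(2)[of _ "U_const _" h2] 
      hom(2)[of _ "U_const _" "x 5"] hom(2)[of _ "U_const _" "Q 3"] hom(2)[of _ "U_const _" "_ * _"]
      x1Q1 x0Q2 Q3 x5 hom(2)[of _ "x 0" "h1 a"] lam_h1 lam_h2 by simp
  then have "R_const 3 * lam a (h3 a) + R_const (3 * \<alpha>) * P + R_const (3 * \<beta>) * W =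
     R_const (48 * a^3 - 12 * a^2 - 36 * a) * P + R_const ((80 * a^2 + 56 * a) * (3 * c) - (48 * a^3 - 12 * a^2 - 36 * a) * (5 * a)) * W"
    unfolding \<alpha>_def \<beta>_def
    by (simp only: distrib_left right_diff_distrib R_const_mult) (simp only: R_const_simps distrib_left distrib_right left_diff_distrib right_diff_distrib mult_minus_left mult_minus_right, simp add: algebra_simps R_const_simps)
  moreover have "3 * \<alpha> = 48 * a^3 - 12 * a^2 - 36 * a"
    "3 * \<beta> = (80 * a^2 + 56 * a) * (3 * c) - (48 * a^3 - 12 * a^2 - 36 * a) * (5 * a)"
    unfolding \<alpha>_def \<beta>_def c_def by (simp_all add: algebra_simps power2_eq_square power3_eq_cube)
  ultimately have "R_const 3 * lam a (h3 a) = 0" by simp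
  then have "R_const (inverse 3) * (R_const 3 * lam a (h3 a)) = 0" by simp
  then show ?thesis unfolding R_const_mult by (simp add: R_const_simps)
qed

lemma lam_independent_mem:
  fixes I :: "'k::field_char_0 UW set"
  assumes I: "two_sided_ideal I" "I \<subseteq> {z. lam a z = 0}" and z: "lam a z = 0" "z \<in> U.span (lam_mon ` A \<union> I)"
    and A: "A = {(k, n, False) | k n. n \<noteq> 1} \<or>
      A = {(k, n, False) | k n. n \<noteq> 1} \<union> {(0, n, True) | n. n \<ge> 1} \<and> a \<notin> {0, 1}"
  shows "z \<in> I"
  using I(1) z(2)
proof (rule mem_of_independent[where \<rho>="\<lambda>X z. rep_R X (lam a z)"])
  show "algebra_hom U_const endo_const (\<lambda>z. rep_R X (lam a z))" for X :: 'k
    by (rule algebra_hom_comp[OF algebra_hom_lam algebra_hom_rep_R])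
  show "rep_R X (lam a i) = 0" if "i \<in> I" for X i
  proof -
    have "lam a i = 0" using that I(2) by auto
    then show ?thesis by (simp add: algebra_homD(5)[OF algebra_hom_rep_R])
  qed
  show "rep_R X (lam a z) = 0" for X by (simp add: z algebra_homD(5)[OF algebra_hom_rep_R])
  fix K and r :: "nat \<times> nat \<times> bool \<Rightarrow> 'k"
  assume K: "finite K" "K \<subseteq> A" and 0: "\<And>X g. (\<Sum>k\<in>K. r k * app (rep_R X (lam a (lam_mon k))) g 0) = 0"
  show "\<forall>k\<in>K. r k = 0"
  proof (rule lam_mon_independent[of a "\<lambda>X z. rep_R X (lam a z)", OF acts_lam K A _ 0])
    show "app (rep_R X (lam a (Q m))) g 0 = of_nat m * (a * (a - 1)) * g (m + 3)" for X m g
      unfolding lam_G by (simp add: algebra_homD[OF algebra_hom_rep_R] rep_gens app_simps app_wshift_1_power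
        eval_nat_numeral)
  qed
qed

lemma lam_mons_image: "{1} \<union> {x 0 ^ k * x m | k m. True} \<subseteq> lam_mon ` {(k, n, False) | k n. n \<noteq> 1}"
proof -
  have "1 = lam_mon (0, 0, False)" by (simp add: lam_mon_def e'_def)
  then have "1 \<in> lam_mon ` {(k, n, False) | k n. n \<noteq> 1}" by (rule image_eqI) simp
  moreover have *: "x 0 ^ k * x m = (if m = 0 then lam_mon (Suc k, 0, False) else lam_mon (k, Suc m, False))" for k m
    by (simp add: lam_mon_def e'_def power_commutes)
  have "x 0 ^ k * x m \<in> lam_mon ` {(k, n, False) | k n. n \<noteq> 1}" for k m
    unfolding * by (cases "m = 0") (auto intro!: imageI)
  ultimately show ?thesis by blast
qed

text \<open>The generator is \<open>- Q 1\<close>, whose image has the factor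
  \<open>a (a - 1)\<close>. It forces all \<open>G i j\<close> into the ideal, and then the
  monomials \<open>x 0 ^ k * x m\<close> together with 1 span the quotient.\<close>

theorem kernel_lam_01:
  assumes "a \<in> {0, 1 :: 'k::field_char_0}"
  shows "{z. lam a z = 0} = ideal_gen {e 1 * e 3 - e 2 ^ 2 - e 4}"
proof
  let ?g = "e 1 * e 3 - e 2 ^ 2 - e 4 :: 'k UW" let ?I = "ideal_gen {?g}"
  have g: "?g = - Q 1" by (simp add: G_def U_const_simps power2_eq_square eval_nat_numeral)
  have "lam a ?g = 0" unfolding g using assms by (auto simp: algebra_homD[OF algebra_hom_lam] lam_G R_const_simps)
  then show sub: "?I \<subseteq> {z. lam a z = 0}" by (intro ideal_gen_subset_kernel[OF algebra_hom_lam]) simp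
  have I: "two_sided_ideal ?I" by (rule two_sided_ideal_ideal_gen)
  have "- ?g \<in> ?I" by (intro ideal_gen_minus ideal_gen_inc) simp
  moreover have "Q 1 = - ?g" by (metis g minus_minus)
  ultimately have "Q 1 \<in> ?I" by metis
  then have G: "G i j \<in> ?I" for i j by (rule G_mem[OF I])
  show "{z. lam a z = 0} \<subseteq> ?I"
  proof
    fix z assume z: "z \<in> {z. lam a z = 0}"
    have "z \<in> U.span ({1} \<union> {x 0 ^ k * x m | k m. True} \<union> {} \<union> ?I)"
      by (rule span_lam_mons[OF I]) (simp, simp, blast intro: U.span_base G)
    also have "\<dots> \<subseteq> U.span (lam_mon ` {(k, n, False) | k n. n \<noteq> 1} \<union> ?I)"
      using lam_mons_image by (intro U.span_mono) blast
    finally show "z \<in> ?I" by (intro lam_independent_mem[OF I sub]) (use z in auto)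
  qed
qed

text \<open>Here \<open>h1 a\<close> reduces \<open>x 0 * Q 1\<close>, and on that basis
  \<open>h3 a\<close> reduces \<open>x 1 * Q 1\<close>. Hence the \<open>Q m\<close> enter the
  spanning family only on their own, without powers of \<open>x 0\<close> in front.\<close>

theorem kernel_lam:
  assumes "a \<notin> {0, 1 :: 'k::field_char_0}"
  shows "{z. lam a z = 0} = ideal_gen {h1 a, h2, h3 a}"
proof
  let ?I = "ideal_gen {h1 a, h2, h3 a}"
  show sub: "?I \<subseteq> {z. lam a z = 0}"
    by (intro ideal_gen_subset_kernel[OF algebra_hom_lam]) (auto simp: lam_h1 lam_h2 lam_h3)
  have I: "two_sided_ideal ?I" by (rule two_sided_ideal_ideal_gen)
  have h: "h1 a \<in> ?I" "h2 \<in> ?I" "h3 a \<in> ?I" by (simp_all add: ideal_gen_inc)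
  have Q1: "x 0 * Q 1 \<in> T ?I 2"
  proof -
    have "h1 a + (a * (a - 1)) \<cdot> x (2 + 2) + (2 * a) \<cdot> Q 2 \<in> T ?I 2"
      by (intro T_add T_scl T_x T_Q T_I I h)
    then show ?thesis by (simp add: h1_Q)
  qed
  \<comment> \<open>The outer factor 3 of \<open>h3_Q\<close> times the coefficient 4 of
    \<open>x 1 * Q 1\<close> there.\<close>
  have "12 \<cdot> (x 1 * Q 1) = (20 * a^2 + 14 * a - 3) \<cdot> h2 + (80 * a^2 + 56 * a) \<cdot> Q 3 +
      (48 * a^3 - 12 * a^2 - 36 * a) \<cdot> x 5 - 3 \<cdot> (h3 a + 4 \<cdot> (x 0 * h1 a) + (4 + 8 * a) \<cdot> (x 0 * Q 2))"
    unfolding h3_Q[symmetric] by (simp add: distrib_left U_scale_simps)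
  also have "\<dots> \<in> T ?I 3"
  proof -
    have "x 0 * Q 2 \<in> T ?I 3" using x0_Q[OF I h(2) Q1, of 2] by simp
    moreover have "x (3 + 2) \<in> T ?I 3" by (rule T_x[OF I h(2)])
    then have "x 5 \<in> T ?I 3" by simp
    moreover have "h2 \<in> T ?I 3" "h3 a \<in> T ?I 3" "x 0 * h1 a \<in> T ?I 3"
      using h by (auto intro!: T_I[OF I h(2)] ideal_gen_lmult)
    ultimately show ?thesis by (intro T_add T_diff T_scl T_Q I h(2))
  qed
  finally have Q2: "x 1 * Q 1 \<in> T ?I 3" by (rule T_cancel[OF I h(2)]) simp
  let ?S = "{1} \<union> {x 0 ^ k * x m | k m. True} \<union> Q ` {1..} \<union> ?I"
  have T_sub: "z \<in> U.span ?S" if "z \<in> T ?I m" "m \<ge> 1" for z m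
  proof -
    have "x (m + 2) \<in> {x 0 ^ k * x m | k m. True}"
      by (intro CollectI exI[of _ 0] exI[of _ "m + 2"]) simp
    then have "T ?I m \<subseteq> U.span ?S" unfolding T_def[OF I h(2)] using that(2) by (intro U.span_mono) auto
    then show ?thesis using that by blast
  qed
  have G: "G i j \<in> U.span ?S" for i j
  proof (cases "i = 0 \<or> j = 0")
    case True then show ?thesis by (auto simp: G_0_left G_0_right U.span_zero)
  next
    case False
    let ?n = "i + j"
    have "(of_nat ?n - 1) \<cdot> G i j - (of_nat i * of_nat j) \<cdot> Q (?n - 1) \<in> T ?I (?n - 1)"
      by (intro T_I[OF I h(2)] G_multiple_mem[OF I h(2)]) (use False in auto)
    then have "(of_nat ?n - 1) \<cdot> G i j \<in> T ?I (?n - 1)" by (rule T_diff_scl[OF I h(2)]) (rule T_Q[OF I h(2)])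
    moreover have "(of_nat ?n - 1 :: 'k) \<noteq> 0"
      using False of_nat_eq_1_iff[of ?n, where 'a='k] by (simp del: of_nat_add)
    ultimately have "G i j \<in> T ?I (?n - 1)" by (rule T_cancel[OF I h(2)])
    then show ?thesis by (rule T_sub) (use False in linarith)
  qed
  show "{z. lam a z = 0} \<subseteq> ?I"
  proof
    fix z assume z: "z \<in> {z. lam a z = 0}"
    have "z \<in> U.span ?S"
    proof (rule span_lam_mons[OF I])
      fix t assume "t \<in> (Q ` {1..} :: 'k UW set)"
      then obtain m where t: "t = Q m" "m \<ge> 1" by auto
      show "x 0 * t \<in> U.span ?S" unfolding t by (rule T_sub[OF x0_Q[OF I h(2) Q1 t(2)]]) simp
      show "x 1 * t \<in> U.span ?S" unfolding t by (rule T_sub[OF x1_Q[OF I h(2) Q1 Q2 t(2)]]) simp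
    qed (rule G)
    also have "U.span ?S \<subseteq> U.span (lam_mon ` ({(k, n, False) | k n. n \<noteq> 1} \<union> {(0, n, True) | n. n \<ge> 1}) \<union> ?I)"
    proof (intro U.span_mono Un_least)
      have "Q m = lam_mon (0, m, True)" for m by (simp add: lam_mon_def)
      then show "Q ` {1..} \<subseteq> lam_mon ` ({(k, n, False) | k n. n \<noteq> 1} \<union> {(0, n, True) | n. n \<ge> 1}) \<union> ?I" by fastforce
    qed (use lam_mons_image in blast)+
    finally show "z \<in> ?I" by (intro lam_independent_mem[OF I sub]) (use z assms in auto)
  qed
qed

section \<open>One-sided ideals in quotients of the Jordan plane\<close>

lemma left_ideal_UNIVI:
  assumes "0 \<in> I" "\<And>y z. y \<in> I \<Longrightarrow> z \<in> I \<Longrightarrow> y + z \<in> I" "\<And>r z. z \<in> I \<Longrightarrow> r * z \<in> I"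
  shows "left_ideal_of UNIV I"
  using assms by (simp add: left_ideal_of_def)

lemma left_ideal_UNIV_hull: "left_ideal_of UNIV (left_ideal_of UNIV hull F)"
  by (rule hull_in) (auto simp: left_ideal_of_def)

lemma left_ideal_of_sum:
  assumes "left_ideal_of A I" "\<And>f. f \<in> F \<Longrightarrow> r f \<in> A" "F \<subseteq> I"
  shows "(\<Sum>f\<in>F. r f * f) \<in> I"
  using assms(2,3) by (induction F rule: infinite_finite_induct) (use assms(1) in \<open>auto simp: left_ideal_of_def\<close>)

lemma left_ideal_UNIV_hull_sum:
  assumes "finite F" "z \<in> left_ideal_of UNIV hull F"
  obtains r where "z = (\<Sum>f\<in>F. r f * f)"
proof -
  have "left_ideal_of UNIV hull F \<subseteq> {\<Sum>f\<in>F. r f * f | r. True}"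
  proof (rule hull_minimal)
    show "F \<subseteq> {\<Sum>f\<in>F. r f * f | r. True}"
    proof
      fix g assume "g \<in> F"
      then have "g = (\<Sum>f\<in>F. (if f = g then 1 else 0) * f)"
        using assms(1) by (simp add: if_distrib[of "\<lambda>r. r * _"] cong: if_cong)
      then show "g \<in> {\<Sum>f\<in>F. r f * f | r. True}" by (intro CollectI exI conjI TrueI)
    qed
    show "left_ideal_of UNIV {\<Sum>f\<in>F. r f * f | r. True}" (is "left_ideal_of UNIV ?S")
    proof (rule left_ideal_UNIVI)
      have "0 = (\<Sum>f\<in>F. 0 * f)" by simp
      then show "0 \<in> ?S" by (intro CollectI exI conjI TrueI)
    next
      fix y z assume "y \<in> ?S" "z \<in> ?S"
      then obtain r s where "y = (\<Sum>f\<in>F. r f * f)" "z = (\<Sum>f\<in>F. s f * f)" by blast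
      then have "y + z = (\<Sum>f\<in>F. (r f + s f) * f)" by (simp add: distrib_right sum.distrib)
      then show "y + z \<in> ?S" by (intro CollectI exI conjI TrueI)
    next
      fix t z assume "z \<in> ?S"
      then obtain r where "z = (\<Sum>f\<in>F. r f * f)" by blast
      then have "t * z = (\<Sum>f\<in>F. (t * r f) * f)" by (simp add: sum_distrib_left mult.assoc)
      then show "t * z \<in> ?S" by (intro CollectI exI conjI TrueI)
    qed
  qed
  then show thesis using assms(2) that by blast
qed

text \<open>Meant for sets that are not left ideals of the whole ring, such as left ideals of a
  subring: the generators must come from the set itself. What the finite subsets of \<open>X\<close>
  generate forms a left ideal, and finitely many of these subsets account for its
  generators.\<close>

lemma finitely_generated_subset:
  assumes noeth: "\<And>I :: 'a::ring_1 set. left_ideal_of UNIV I \<Longrightarrow> \<exists>F. finite F \<and> F \<subseteq> I \<and> I \<subseteq> left_ideal_of UNIV hull F"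
  shows "\<exists>F. finite F \<and> F \<subseteq> X \<and> X \<subseteq> left_ideal_of UNIV hull (F :: 'a set)"
proof -
  let ?h = "\<lambda>F. left_ideal_of UNIV hull (F :: 'a set)"
  let ?I = "{z. \<exists>F. finite F \<and> F \<subseteq> X \<and> z \<in> ?h F}"
  have h: "left_ideal_of UNIV (?h F)" for F by (rule left_ideal_UNIV_hull)
  have I: "left_ideal_of UNIV ?I"
  proof (rule left_ideal_UNIVI)
    show "0 \<in> ?I" using h[of "{}"] by (auto simp: left_ideal_of_def intro!: exI[of _ "{}"])
    fix r y assume "y \<in> ?I"
    then obtain F where F: "finite F" "F \<subseteq> X" "y \<in> ?h F" by blast
    then show "r * y \<in> ?I" using h[of F] by (auto simp: left_ideal_of_def)
  next
    fix y z assume "y \<in> ?I"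
    then obtain F where F: "finite F" "F \<subseteq> X" "y \<in> ?h F" by blast
    assume "z \<in> ?I"
    then obtain G where G: "finite G" "G \<subseteq> X" "z \<in> ?h G" by blast
    have "y \<in> ?h (F \<union> G)" "z \<in> ?h (F \<union> G)"
      using F(3) G(3) hull_mono[of F "F \<union> G"] hull_mono[of G "F \<union> G"] by blast+
    then have "y + z \<in> ?h (F \<union> G)" using h[of "F \<union> G"] by (auto simp: left_ideal_of_def)
    then show "y + z \<in> ?I" using F G by (intro CollectI exI[of _ "F \<union> G"]) auto
  qed
  obtain F0 where F0: "finite F0" "F0 \<subseteq> ?I" "?I \<subseteq> ?h F0" using noeth[OF I] by blast
  then have "\<forall>f\<in>F0. \<exists>F. finite F \<and> F \<subseteq> X \<and> f \<in> ?h F" by blast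
  then obtain \<F> where \<F>: "\<And>f. f \<in> F0 \<Longrightarrow> finite (\<F> f) \<and> \<F> f \<subseteq> X \<and> f \<in> ?h (\<F> f)" by metis
  let ?F = "\<Union>f\<in>F0. \<F> f"
  have "F0 \<subseteq> ?h ?F"
  proof
    fix f assume f: "f \<in> F0"
    then have "?h (\<F> f) \<subseteq> ?h ?F" by (intro hull_mono) blast
    then show "f \<in> ?h ?F" using \<F>[OF f] by blast
  qed
  then have "?h F0 \<subseteq> ?h ?F" using h by (intro hull_minimal)
  moreover have "X \<subseteq> ?I"
  proof
    fix z assume "z \<in> X" then show "z \<in> ?I" by (auto intro!: exI[of _ "{z}"] hull_inc)
  qed
  ultimately show ?thesis using F0 \<F> by (intro exI[of _ ?F]) blast
qed

lemma poly_ideal_principal: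
  fixes J :: "'k::field poly set"
  assumes 0: "0 \<in> J" and add: "\<And>f g. f \<in> J \<Longrightarrow> g \<in> J \<Longrightarrow> f + g \<in> J" and mult: "\<And>f g. g \<in> J \<Longrightarrow> f * g \<in> J"
  obtains g where "g \<in> J" "\<And>f. f \<in> J \<Longrightarrow> g dvd f"
proof (cases "J = {0}")
  case True then show thesis using that[of 0] by simp
next
  case False
  then obtain g0 where g0: "g0 \<in> J - {0}" using 0 by blast
  define g where "g = arg_min degree (\<lambda>f. f \<in> J - {0})"
  have g: "g \<in> J - {0}" "\<And>f. f \<in> J - {0} \<Longrightarrow> degree g \<le> degree f"
    unfolding g_def
    by (rule arg_min_natI[of "\<lambda>f. f \<in> J - {0}", OF g0], rule arg_min_nat_le)
  have "g dvd f" if "f \<in> J" for f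
  proof -
    have "f + (- (f div g)) * g \<in> J" by (intro add that mult) (use g in auto)
    then have "f mod g \<in> J" by (simp add: minus_div_mult_eq_mod)
    then have "f mod g = 0" using g degree_mod_less[of g f] by fastforce
    then show ?thesis by (simp add: dvd_eq_mod_eq_0)
  qed
  then show thesis using that g by blast
qed

text \<open>Abstract because it is used twice, for \<open>R\<close> and for its opposite ring. The
  assumption \<open>gens\<close> says that \<open>u\<close> and \<open>v\<close> generate the
  algebra by left multiplication.\<close>

locale jordan_like =
  fixes c :: "'k::field_char_0 \<Rightarrow> 'a::ring_1" and u v :: 'a
  assumes alg: "algebra_over c" and rel: "u * v = v * u + v * v"
    and gens: "\<And>P z. P 1 \<Longrightarrow> (\<And>y z. P y \<Longrightarrow> P z \<Longrightarrow> P (y + z)) \<Longrightarrow> (\<And>r z. P z \<Longrightarrow> P (c r * z)) \<Longrightarrow>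
      (\<And>z. P z \<Longrightarrow> P (u * z)) \<Longrightarrow> (\<And>z. P z \<Longrightarrow> P (v * z)) \<Longrightarrow> P z"
begin

sublocale V: vector_space "\<lambda>r z. c r * z"
  by (rule algebra_over_vector_space[OF alg])

lemmas c_simps = algebra_overD(1-3,5-7)[OF alg]
lemmas c_comm = algebra_overD(4)[OF alg, symmetric]

lemma c_comm2: "z * (c r * y) = c r * (z * y)"
  by (metis c_comm mult.assoc)

section \<open>Polynomials in \<open>v\<close> and the Hilbert basis argument\<close>

definition pev :: "'k poly \<Rightarrow> 'a" where
  "pev f = (\<Sum>i\<le>degree f. c (coeff f i) * v ^ i)"

lemma pev_le: "degree f \<le> n \<Longrightarrow> pev f = (\<Sum>i\<le>n. c (coeff f i) * v ^ i)"
  unfolding pev_def by (intro sum.mono_neutral_left) (auto simp: coeff_eq_0 c_simps)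

lemma pev_0 [simp]: "pev 0 = 0" by (simp add: pev_def c_simps)

lemma pev_add: "pev (f + g) = pev f + pev g"
proof -
  let ?n = "max (degree f) (degree g)"
  have "pev (f + g) = (\<Sum>i\<le>?n. c (coeff (f + g) i) * v ^ i)"
    by (rule pev_le) (simp add: degree_add_le_max)
  then show ?thesis by (simp add: pev_le[of f ?n] pev_le[of g ?n] c_simps distrib_right sum.distrib)
qed

lemma pev_smult: "pev (smult r f) = c r * pev f"
proof -
  have "pev (smult r f) = (\<Sum>i\<le>degree f. c (coeff (smult r f) i) * v ^ i)"
    by (rule pev_le) (rule degree_smult_le)
  then show ?thesis by (simp only: pev_def coeff_smult c_simps(3) sum_distrib_left mult.assoc)
qed

lemma pev_pCons: "pev (pCons a f) = c a + v * pev f"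
proof -
  have "pev (pCons a f) = (\<Sum>i\<le>Suc (degree f). c (coeff (pCons a f) i) * v ^ i)"
    by (rule pev_le) (rule degree_pCons_le)
  also have "\<dots> = c a + (\<Sum>i\<le>degree f. v * (c (coeff f i) * v ^ i))"
    by (subst sum.atMost_Suc_shift) (simp add: c_comm2)
  finally show ?thesis by (simp add: pev_def sum_distrib_left)
qed

lemma pev_1: "pev 1 = 1"
  by (simp add: one_pCons pev_pCons c_simps)

lemma pev_mult: "pev (f * g) = pev f * pev g"
  by (induction f) (simp_all add: pev_add pev_smult pev_pCons c_simps distrib_right mult.assoc)

lemma pev_X: "pev [:0, 1:] = v" by (simp add: pev_pCons c_simps)
lemma pev_const: "pev [:r:] = c r" by (simp add: pev_pCons)

text \<open>The commutator with \<open>u\<close> is a derivation of \<open>k[v]\<close> sending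
  \<open>v\<close> to \<open>v^2\<close>, hence \<open>v^2 d/dv\<close>; the list
  \<open>[:0,0,1:]\<close> is \<open>v^2\<close>.\<close>

lemma u_pev: "u * pev f = pev f * u + pev ([:0,0,1:] * pderiv f)"
proof (induction f)
  case (pCons a f)
  have vv: "pev ([:0,0,1:] * g) = v * (v * pev g)" for g
    by (simp only: pev_mult mult.assoc) (simp add: pev_pCons c_simps mult.assoc)
  have "u * (c a + v * pev f) = c a * u + (v * u + v * v) * pev f"
    by (simp add: distrib_left c_comm rel[symmetric] mult.assoc)
  also have "\<dots> = c a * u + v * (u * pev f) + v * (v * pev f)" by (simp add: distrib_right mult.assoc add_ac)
  also have "\<dots> = (c a + v * pev f) * u + v * (v * (pev f + v * pev (pderiv f)))"
    unfolding pCons.IH vv by (simp add: algebra_simps)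
  finally show ?case unfolding vv by (simp add: pev_pCons pderiv_pCons pev_add c_simps)
qed (simp add: c_simps)

lemma left_idealI:
  assumes "0 \<in> K" "\<And>y z. y \<in> K \<Longrightarrow> z \<in> K \<Longrightarrow> y + z \<in> K" "\<And>r z. z \<in> K \<Longrightarrow> c r * z \<in> K"
    "\<And>z. z \<in> K \<Longrightarrow> u * z \<in> K" "\<And>z. z \<in> K \<Longrightarrow> v * z \<in> K"
  shows "left_ideal_of UNIV K"
proof -
  have "\<forall>z\<in>K. r * z \<in> K" for r
    by (induction r rule: gens) (auto simp: distrib_right mult.assoc intro: assms)
  then show ?thesis using assms(1,2) by (simp add: left_ideal_of_def)
qed

lemma left_idealD:
  assumes "left_ideal_of UNIV K"
  shows "0 \<in> K" "y \<in> K \<Longrightarrow> z \<in> K \<Longrightarrow> y + z \<in> K" "z \<in> K \<Longrightarrow> r * z \<in> K" "z \<in> K \<Longrightarrow> - z \<in> K"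
    "y \<in> K \<Longrightarrow> z \<in> K \<Longrightarrow> y - z \<in> K"
proof -
  show 1: "0 \<in> K" "\<And>y z. y \<in> K \<Longrightarrow> z \<in> K \<Longrightarrow> y + z \<in> K" "\<And>z r. z \<in> K \<Longrightarrow> r * z \<in> K"
    using assms by (auto simp: left_ideal_of_def)
  show 2: "\<And>z. z \<in> K \<Longrightarrow> - z \<in> K" using 1(3)[of _ "- 1"] by simp
  show "y \<in> K \<Longrightarrow> z \<in> K \<Longrightarrow> y - z \<in> K" using 1(2)[of y "- z"] 2 by simp
qed

lemma left_ideal_subspace: "left_ideal_of UNIV K \<Longrightarrow> V.subspace K"
  by (auto simp: V.subspace_def left_idealD)

text \<open>The Hilbert basis argument, with coefficients in \<open>k[v]\<close> written to the left of powers of \<open>u\<close>.\<close>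

primrec lowdeg :: "nat \<Rightarrow> 'a set" where
  "lowdeg 0 = {0}"
| "lowdeg (Suc n) = {pev f * u ^ n + p | f p. p \<in> lowdeg n}"

lemma lowdeg_SucI: "p \<in> lowdeg n \<Longrightarrow> pev f * u ^ n + p \<in> lowdeg (Suc n)"
  by auto

lemma lowdeg_mono: "p \<in> lowdeg n \<Longrightarrow> p \<in> lowdeg (Suc n)"
  using lowdeg_SucI[of p n 0] by simp

lemma lowdeg_0: "0 \<in> lowdeg n" by (induction n) (auto intro: lowdeg_mono simp del: lowdeg.simps(2))

lemma lowdeg_add: "p \<in> lowdeg n \<Longrightarrow> q \<in> lowdeg n \<Longrightarrow> p + q \<in> lowdeg n"
proof (induction n arbitrary: p q)
  case (Suc n)
  then obtain f p' g q' where *: "p = pev f * u ^ n + p'" "p' \<in> lowdeg n" "q = pev g * u ^ n + q'" "q' \<in> lowdeg n" by auto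
  have "p + q = pev (f + g) * u ^ n + (p' + q')" by (simp add: * pev_add algebra_simps)
  then show ?case using Suc.IH * lowdeg_SucI by metis
qed simp

lemma lowdeg_pev: "p \<in> lowdeg n \<Longrightarrow> pev g * p \<in> lowdeg n"
proof (induction n arbitrary: p)
  case (Suc n)
  then obtain f p' where *: "p = pev f * u ^ n + p'" "p' \<in> lowdeg n" by auto
  have "pev g * p = pev (g * f) * u ^ n + pev g * p'" by (simp add: * pev_mult distrib_left mult.assoc)
  then show ?case using Suc.IH * lowdeg_SucI by metis
qed simp

lemma lowdeg_u: "p \<in> lowdeg n \<Longrightarrow> u * p \<in> lowdeg (Suc n)"
proof (induction n arbitrary: p)
  case 0 then show ?case using lowdeg_0[of "Suc 0"] by simp
next
  case (Suc n)
  then obtain f p' where *: "p = pev f * u ^ n + p'" "p' \<in> lowdeg n" by auto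
  have "u * p = (u * pev f) * u ^ n + u * p'" by (simp add: * distrib_left mult.assoc)
  also have "\<dots> = pev f * u ^ Suc n + (pev ([:0,0,1:] * pderiv f) * u ^ n + u * p')"
    unfolding u_pev by (simp add: distrib_right mult.assoc add_ac)
  finally have 1: "u * p = pev f * u ^ Suc n + (pev ([:0,0,1:] * pderiv f) * u ^ n + u * p')" .
  have "pev ([:0,0,1:] * pderiv f) * u ^ n + u * p' \<in> lowdeg (Suc n)"
    by (intro lowdeg_add Suc.IH *) (use lowdeg_SucI[OF lowdeg_0] in \<open>simp del: lowdeg.simps\<close>)
  then show ?case unfolding 1 by (rule lowdeg_SucI)
qed

lemma lowdeg_mono': "m \<le> n \<Longrightarrow> p \<in> lowdeg m \<Longrightarrow> p \<in> lowdeg n"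
  by (induction n rule: dec_induct) (auto intro: lowdeg_mono simp del: lowdeg.simps)

lemma lowdeg_UNIV: "\<exists>n. z \<in> lowdeg n"
proof (induction z rule: gens)
  case 1
  have "pev 1 * u ^ 0 + 0 \<in> lowdeg (Suc 0)" by (rule lowdeg_SucI) simp
  then have "1 \<in> lowdeg (Suc 0)" by (simp only: pev_1 power_0 mult_1_left add_0_right)
  then show ?case by blast
next
  case (2 y z)
  then obtain m n where "y \<in> lowdeg m" "z \<in> lowdeg n" by blast
  then have "y \<in> lowdeg (max m n)" "z \<in> lowdeg (max m n)"
    using lowdeg_mono'[of m "max m n" y] lowdeg_mono'[of n "max m n" z] by simp_all
  then show ?case using lowdeg_add by blast
next
  case (3 r z) then show ?case using lowdeg_pev[of z _ "[:r:]"] by (auto simp: pev_const)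
next
  case (4 z) then show ?case using lowdeg_u by blast
next
  case (5 z) then show ?case using lowdeg_pev[of z _ "[:0,1:]"] by (auto simp: pev_X)
qed

text \<open>The derivation term has lower order in \<open>u\<close>, so \<open>u ^ k\<close>
  preserves the leading coefficient. This makes the ideals of leading coefficients increase with the
  degree.\<close>

lemma u_power_leading: "p \<in> lowdeg n \<Longrightarrow> \<exists>q\<in>lowdeg (n + k). u ^ k * (pev f * u ^ n + p) = pev f * u ^ (n + k) + q"
proof (induction k)
  case (Suc k)
  then obtain q where q: "q \<in> lowdeg (n + k)" "u ^ k * (pev f * u ^ n + p) = pev f * u ^ (n + k) + q" by blast
  have "u ^ Suc k * (pev f * u ^ n + p) = u * (pev f * u ^ (n + k) + q)"
    by (simp add: mult.assoc q(2))
  also have "\<dots> = (u * pev f) * u ^ (n + k) + u * q" by (simp add: distrib_left mult.assoc)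
  also have "\<dots> = pev f * u ^ (n + Suc k) + (pev ([:0,0,1:] * pderiv f) * u ^ (n + k) + u * q)"
    unfolding u_pev by (simp add: distrib_right mult.assoc add_ac)
  finally show ?case
    using lowdeg_add[OF lowdeg_SucI[OF lowdeg_0, of "[:0,0,1:] * pderiv f" "n + k"] lowdeg_u[OF q(1)]] by (auto simp del: lowdeg.simps)
qed auto

theorem left_ideal_finitely_generated:
  assumes I: "left_ideal_of UNIV (I :: 'a set)"
  shows "\<exists>F. finite F \<and> F \<subseteq> I \<and> I \<subseteq> left_ideal_of UNIV hull F"
proof -
  define J where "J n = {f. \<exists>p\<in>lowdeg n. pev f * u ^ n + p \<in> I}" for n
  have J0: "0 \<in> J n" for n
    unfolding J_def using left_idealD(1)[OF I] by (auto intro!: bexI[of _ 0] lowdeg_0)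
  have J_add: "f + g \<in> J n" if fg: "f \<in> J n" "g \<in> J n" for f g n
  proof -
    obtain p q where pq: "p \<in> lowdeg n" "pev f * u ^ n + p \<in> I" "q \<in> lowdeg n" "pev g * u ^ n + q \<in> I"
      using fg unfolding J_def by blast
    have "pev (f + g) * u ^ n + (p + q) = (pev f * u ^ n + p) + (pev g * u ^ n + q)" by (simp add: pev_add algebra_simps)
    then show ?thesis unfolding J_def using pq left_idealD(2)[OF I] lowdeg_add by (metis (mono_tags, lifting) mem_Collect_eq)
  qed
  have J_mult: "g * f \<in> J n" if f: "f \<in> J n" for f g n
  proof -
    obtain p where p: "p \<in> lowdeg n" "pev f * u ^ n + p \<in> I" using f unfolding J_def by blast
    have "pev (g * f) * u ^ n + pev g * p = pev g * (pev f * u ^ n + p)" by (simp add: pev_mult distrib_left mult.assoc)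
    then show ?thesis unfolding J_def using p left_idealD(3)[OF I] lowdeg_pev by (metis (mono_tags, lifting) mem_Collect_eq)
  qed
  have J_shift: "f \<in> J (n + k)" if f: "f \<in> J n" for f n k
  proof -
    obtain p where p: "p \<in> lowdeg n" "pev f * u ^ n + p \<in> I" using f unfolding J_def by blast
    then show ?thesis unfolding J_def using u_power_leading[OF p(1), of k f] left_idealD(3)[OF I p(2), of "u ^ k"] by auto
  qed
  have "\<exists>g\<in>J n. \<forall>f\<in>J n. g dvd f" for n
    by (rule poly_ideal_principal[of "J n"]) (use J0 J_add J_mult in blast)+
  then obtain g where g: "\<And>n. g n \<in> J n" "\<And>n f. f \<in> J n \<Longrightarrow> g n dvd f" by metis
  then have "\<forall>n. \<exists>p. p \<in> lowdeg n \<and> pev (g n) * u ^ n + p \<in> I" unfolding J_def by blast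
  then obtain p where p: "\<And>n. p n \<in> lowdeg n" "\<And>n. pev (g n) * u ^ n + p n \<in> I" by metis
  have U0: "0 \<in> (\<Union>n. J n)" using J0 by blast
  have U_add: "f + h \<in> (\<Union>n. J n)" if fh: "f \<in> (\<Union>n. J n)" "h \<in> (\<Union>n. J n)" for f h
  proof -
    obtain m n where "f \<in> J m" "h \<in> J n" using fh by blast
    then have "f \<in> J (m + n)" "h \<in> J (m + n)" using J_shift[of f m n] J_shift[of h n m] by (simp_all add: add.commute)
    then show ?thesis using J_add by blast
  qed
  have U_mult: "f * h \<in> (\<Union>n. J n)" if "h \<in> (\<Union>n. J n)" for f h
    using that J_mult by blast
  obtain gg where gg: "gg \<in> (\<Union>n. J n)" "\<And>f. f \<in> (\<Union>n. J n) \<Longrightarrow> gg dvd f"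
    by (rule poly_ideal_principal[of "\<Union>n. J n", OF U0 U_add U_mult]) blast+
  obtain N where N: "gg \<in> J N" using gg(1) by blast
  define F where "F = (\<lambda>n. pev (g n) * u ^ n + p n) ` {..N}"
  have mem: "z \<in> left_ideal_of UNIV hull F" if "z \<in> I" "z \<in> lowdeg n" for z n
    using that
  proof (induction n arbitrary: z)
    case 0 then show ?case using left_idealD(1)[OF left_ideal_UNIV_hull] by simp
  next
    case (Suc n)
    let ?H = "left_ideal_of UNIV hull F"
    have H: "left_ideal_of UNIV ?H" by (rule left_ideal_UNIV_hull)
    obtain f q where z: "z = pev f * u ^ n + q" "q \<in> lowdeg n" using Suc.prems by auto
    then have f: "f \<in> J n" unfolding J_def using Suc.prems by blast
    obtain y h where y: "y \<in> ?H" "y \<in> I" "h \<in> lowdeg n" "y = pev f * u ^ n + h"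
    proof -
      \<comment> \<open>Up to degree \<open>N\<close> the generator of the same degree is used;
        above \<open>N\<close> the one of degree \<open>N\<close>, whose leading coefficient divides
        \<open>gg\<close> and therefore \<open>f\<close>.\<close>
      define m where "m = min n N"
      have "f \<in> J m \<or> gg dvd f \<and> m = N" using f gg(2) unfolding m_def by (cases "n \<le> N") auto
      then have "g m dvd f" using g(2)[of _ m] N dvd_trans by blast
      then obtain d where d: "f = d * g m" by (metis dvd_def mult.commute)
      let ?y = "pev d * (u ^ (n - m) * (pev (g m) * u ^ m + p m))"
      obtain q where q: "q \<in> lowdeg (m + (n - m))" "u ^ (n - m) * (pev (g m) * u ^ m + p m) = pev (g m) * u ^ (m + (n - m)) + q"
        using u_power_leading[OF p(1)[of m]] by blast
      have m: "m + (n - m) = n" "m \<le> N" by (auto simp: m_def)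
      have "?y = pev f * u ^ n + pev d * q" unfolding q m d by (simp add: pev_mult distrib_left mult.assoc)
      moreover have "pev d * q \<in> lowdeg n" using q m lowdeg_pev by simp
      moreover have "?y \<in> ?H"
        by (intro left_idealD(3)[OF H] hull_inc) (use m in \<open>auto simp: F_def\<close>)
      moreover have "?y \<in> I" by (intro left_idealD(3)[OF I] p)
      ultimately show thesis using that by blast
    qed
    have "z - y = q + pev [:- 1:] * h" by (simp add: z y(4) pev_const c_simps)
    then have "z - y \<in> lowdeg n" using z(2) y(3) lowdeg_add lowdeg_pev by metis
    then have "z - y \<in> ?H" using Suc.IH left_idealD(5)[OF I Suc.prems(1) y(2)] by blast
    then have "(z - y) + y \<in> ?H" using y(1) by (rule left_idealD(2)[OF H])
    then show ?case by simp
  qed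
  have "I \<subseteq> left_ideal_of UNIV hull F"
  proof
    fix z assume z: "z \<in> I"
    obtain n where "z \<in> lowdeg n" using lowdeg_UNIV by blast
    with z show "z \<in> left_ideal_of UNIV hull F" by (rule mem)
  qed
  moreover have "finite F" "F \<subseteq> I" using p(2) by (auto simp: F_def)
  ultimately show ?thesis by (intro exI[of _ F] conjI)
qed

lemma finitely_generated: "\<exists>F. finite F \<and> F \<subseteq> X \<and> X \<subseteq> left_ideal_of UNIV hull (F :: 'a set)"
  by (rule finitely_generated_subset) (erule left_ideal_finitely_generated)

end

section \<open>Finite-dimensional corrections and the annihilator of \<open>u\<close>\<close>

context jordan_like begin

text \<open>Ideal generators must lie in the ideal, while a finite set \<open>W\<close> describing
  it modulo \<open>N\<close> may lie outside; here the representatives are moved into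
  \<open>L\<close>. Removing one vector \<open>w0\<close> from \<open>W\<close> costs at most one
  element of \<open>L\<close>.\<close>

lemma subspace_finite_part:
  assumes "finite W" "V.subspace L" "V.subspace N" "\<And>z. z \<in> L \<Longrightarrow> \<exists>w\<in>V.span W. z - w \<in> N"
  shows "\<exists>F. finite F \<and> F \<subseteq> L \<and> (\<forall>z\<in>L. \<exists>w\<in>V.span F. z - w \<in> N)"
  using assms(1,2,4)
proof (induction W arbitrary: L rule: finite_induct)
  case empty
  then show ?case by (intro exI[of _ "{}"]) (auto simp: V.span_zero)
next
  case (insert w0 W)
  let ?L = "{z \<in> L. \<exists>w\<in>V.span W. z - w \<in> N}"
  have sub: "V.subspace ?L"
  proof (rule V.subspaceI)
    show "0 \<in> ?L" using insert.prems(1) assms(3) by (auto simp: V.subspace_0 V.span_zero intro!: bexI[of _ 0])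
    fix y z assume "y \<in> ?L" "z \<in> ?L"
    then obtain w w' where w: "y \<in> L" "z \<in> L" "w \<in> V.span W" "y - w \<in> N" "w' \<in> V.span W" "z - w' \<in> N" by blast
    then have "(y - w) + (z - w') \<in> N" using assms(3) V.subspace_add by blast
    moreover have "(y - w) + (z - w') = (y + z) - (w + w')" by simp
    ultimately show "y + z \<in> ?L" using w insert.prems(1) V.subspace_add V.span_add by (metis (mono_tags, lifting) mem_Collect_eq)
  next
    fix r z assume "z \<in> ?L"
    then obtain w where w: "z \<in> L" "w \<in> V.span W" "z - w \<in> N" by blast
    then have "c r * (z - w) \<in> N" using assms(3) V.subspace_scale by blast
    moreover have "c r * (z - w) = c r * z - c r * w" by (simp add: right_diff_distrib)
    ultimately show "c r * z \<in> ?L" using w insert.prems(1) V.subspace_scale V.span_scale by (metis (mono_tags, lifting) mem_Collect_eq)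
  qed
  obtain F where F: "finite F" "F \<subseteq> ?L" "\<forall>z\<in>?L. \<exists>w\<in>V.span F. z - w \<in> N"
    using insert.IH[OF sub] by blast
  show ?case
  proof (cases "L \<subseteq> ?L")
    case True
    then have eq: "?L = L" by blast
    show ?thesis using F unfolding eq by (intro exI[of _ F] conjI)
  next
    case False
    then obtain l where l: "l \<in> L" "l \<notin> ?L" by blast
    obtain a w where a: "w \<in> V.span W" "l - (c a * w0 + w) \<in> N"
    proof -
      obtain y where "y \<in> V.span (insert w0 W)" "l - y \<in> N" using insert.prems(2)[OF l(1)] by blast
      moreover then obtain a where "y - c a * w0 \<in> V.span W" using V.span_breakdown_eq by blast
      ultimately show thesis using that[of "y - c a * w0" a] by simp
    qed
    have "a \<noteq> 0"
    proof
      assume "a = 0"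
      then have "l - w \<in> N" using a(2) by (simp add: c_simps)
      then show False using l a(1) by blast
    qed
    have "\<exists>y\<in>V.span (insert l F). z - y \<in> N" if z: "z \<in> L" for z
    proof -
      obtain y where y: "y \<in> V.span (insert w0 W)" "z - y \<in> N" using insert.prems(2)[OF z] by blast
      then obtain b where b: "y - c b * w0 \<in> V.span W" using V.span_breakdown_eq by blast
      \<comment> \<open>With \<open>a\<close> and \<open>b\<close> the coefficients of
        \<open>w0\<close> in the representatives of \<open>l\<close> and \<open>z\<close>, this
        multiple of \<open>l\<close> removes \<open>w0\<close> from the representative of
        \<open>z\<close>.\<close>
      let ?z = "z - c (b / a) * l"
      have "(z - y) - c (b / a) * (l - (c a * w0 + w)) \<in> N"
        using y(2) a(2) assms(3) V.subspace_diff V.subspace_scale by blast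
      moreover have "(z - y) - c (b / a) * (l - (c a * w0 + w)) = ?z - ((y - c b * w0) - c (b / a) * w)"
        using \<open>a \<noteq> 0\<close> by (simp add: right_diff_distrib distrib_left mult.assoc[symmetric] c_simps(3)[symmetric])
      moreover have "(y - c b * w0) - c (b / a) * w \<in> V.span W" using a(1) b V.span_diff V.span_scale by blast
      moreover have "?z \<in> L" using z l(1) insert.prems(1) V.subspace_diff V.subspace_scale by blast
      ultimately have "?z \<in> ?L" by (metis (mono_tags, lifting) mem_Collect_eq)
      then obtain y' where y': "y' \<in> V.span F" "?z - y' \<in> N" using F(3) by blast
      have "y' + c (b / a) * l \<in> V.span (insert l F)"
      proof (rule V.span_add)
        show "y' \<in> V.span (insert l F)" using y'(1) V.span_mono[of F "insert l F"] by blast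
      qed (intro V.span_scale V.span_base, simp)
      moreover have "z - (y' + c (b / a) * l) = ?z - y'" by simp
      ultimately show ?thesis using y'(2) by metis
    qed
    then show ?thesis using F l(1) by (intro exI[of _ "insert l F"]) auto
  qed
qed

lemma pev_mult_span: "degree f \<le> n \<Longrightarrow> pev f * r \<in> V.span ((\<lambda>i. v ^ i * r) ` {..n})"
  by (simp only: pev_le sum_distrib_right mult.assoc) (intro V.span_sum V.span_scale V.span_base imageI)

text \<open>The left ideal \<open>K + \<Sum> k[v] r\<^sub>i\<close>; it absorbs left multiplication by \<open>u\<close> as soon as all \<open>u r\<^sub>i\<close> lie in \<open>K\<close>.\<close>

primrec pev_span :: "'a set \<Rightarrow> 'a list \<Rightarrow> 'a set" where
  "pev_span K [] = K"
| "pev_span K (r # rs) = {pev f * r + n | f n. n \<in> pev_span K rs}"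

lemma pev_span_ideal:
  assumes K: "left_ideal_of UNIV K"
  shows "\<forall>r\<in>set rs. u * r \<in> K \<Longrightarrow> left_ideal_of UNIV (pev_span K rs) \<and> K \<subseteq> pev_span K rs"
proof (induction rs)
  case (Cons r rs)
  then have IH: "left_ideal_of UNIV (pev_span K rs)" "K \<subseteq> pev_span K rs" and ur: "u * r \<in> K" by auto
  note D = left_idealD[OF IH(1)]
  have mem: "pev f * r + n \<in> pev_span K (r # rs)" if "n \<in> pev_span K rs" for f n using that by auto
  have pev_mem: "pev g * z \<in> pev_span K (r # rs)" if z: "z \<in> pev_span K (r # rs)" for g z
  proof -
    obtain f n where "z = pev f * r + n" "n \<in> pev_span K rs" using z by auto
    then show ?thesis using mem[OF D(3)[of n "pev g"], of "g * f"] by (simp add: pev_mult distrib_left mult.assoc)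
  qed
  have "left_ideal_of UNIV (pev_span K (r # rs))"
  proof (rule left_idealI)
    show "0 \<in> pev_span K (r # rs)" using mem[OF D(1), of 0] by simp
    fix z assume z: "z \<in> pev_span K (r # rs)"
    show "c s * z \<in> pev_span K (r # rs)" for s using pev_mem[OF z, of "[:s:]"] by (simp add: pev_const)
    show "v * z \<in> pev_span K (r # rs)" using pev_mem[OF z, of "[:0,1:]"] by (simp add: pev_X)
    obtain f n where z: "z = pev f * r + n" "n \<in> pev_span K rs" using z by auto
    have "u * z = pev ([:0,0,1:] * pderiv f) * r + (pev f * (u * r) + u * n)"
      unfolding z by (simp only: distrib_left mult.assoc[symmetric] u_pev distrib_right add_ac)
    moreover have "pev f * (u * r) + u * n \<in> pev_span K rs" using ur IH(2) z(2) by (intro D(2)[OF D(3) D(3)]) auto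
    ultimately show "u * z \<in> pev_span K (r # rs)" using mem by metis
  next
    fix y z assume "y \<in> pev_span K (r # rs)" "z \<in> pev_span K (r # rs)"
    then obtain f n g m where *: "y = pev f * r + n" "n \<in> pev_span K rs" "z = pev g * r + m" "m \<in> pev_span K rs" by auto
    have "y + z = pev (f + g) * r + (n + m)" by (simp add: * pev_add algebra_simps)
    then show "y + z \<in> pev_span K (r # rs)" using mem[OF D(2)[OF *(2,4)]] by metis
  qed
  moreover have "K \<subseteq> pev_span K (r # rs)" using mem[of _ 0] IH(2) by auto
  ultimately show ?case by blast
qed (use K in auto)

text \<open>On \<open>k[v]\<close>-combinations of elements killed by \<open>u\<close> in \<open>R/K\<close>, \<open>u\<close> acts as \<open>v\<^sup>2 d/dv\<close>, whose kernel
  in characteristic 0 consists of the constants.\<close>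

lemma u_annihilator_finite:
  assumes K: "left_ideal_of UNIV K"
  shows "\<exists>F. finite F \<and> (\<forall>z. u * z \<in> K \<longrightarrow> (\<exists>w\<in>V.span F. z - w \<in> K))"
proof -
  let ?L = "{z. u * z \<in> K}"
  have L: "V.subspace ?L"
    by (rule V.subspaceI) (auto simp: distrib_left c_comm2 left_idealD[OF K])
  have step: "\<exists>F. finite F \<and> F \<subseteq> ?L \<and> (\<forall>z\<in>?L \<inter> pev_span K rs. \<exists>w\<in>V.span F. z - w \<in> K)" if "\<forall>r\<in>set rs. r \<in> ?L" for rs
    using that
  proof (induction rs)
    case Nil
    show ?case by (rule exI[of _ "{}"]) (auto simp: V.span_zero)
  next
    case (Cons r rs)
    let ?N = "pev_span K rs"
    have N: "left_ideal_of UNIV ?N" "K \<subseteq> ?N" using pev_span_ideal[OF K, of rs] Cons.prems by auto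
    have M: "left_ideal_of UNIV (pev_span K (r # rs))" using pev_span_ideal[OF K, of "r # rs"] Cons.prems by auto
    note D = left_idealD[OF N(1)]
    have ur: "u * r \<in> K" using Cons.prems by simp
    have deriv: "pev ([:0,0,1:] * pderiv f) * r \<in> ?N" if z: "pev f * r + n \<in> ?L" "n \<in> ?N" for f n
    proof -
      have "u * (pev f * r + n) = pev ([:0,0,1:] * pderiv f) * r + (pev f * (u * r) + u * n)"
        by (simp only: distrib_left mult.assoc[symmetric] u_pev distrib_right add_ac)
      moreover have "u * (pev f * r + n) \<in> ?N" using z N(2) by auto
      moreover have "pev f * (u * r) + u * n \<in> ?N" using ur N(2) z(2) by (intro D(2)[OF D(3) D(3)]) auto
      ultimately show ?thesis using D(5) by (metis add_diff_cancel_right')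
    qed
    \<comment> \<open>Dichotomy for \<open>r\<close> modulo \<open>?N\<close> as a
      \<open>k[v]\<close>-module: if a nonzero polynomial annihilates it, division with remainder
      leaves finitely many powers of \<open>v\<close>; otherwise the derivative of \<open>f\<close>
      vanishes and \<open>f\<close> is constant.\<close>
    have "\<exists>W. finite W \<and> (\<forall>z\<in>?L \<inter> pev_span K (r # rs). \<exists>w\<in>V.span W. z - w \<in> ?N)"
    proof (cases "\<exists>g. g \<noteq> 0 \<and> pev g * r \<in> ?N")
      case True
      then obtain g where g: "g \<noteq> 0" "pev g * r \<in> ?N" by blast
      show ?thesis
      proof (intro exI[of _ "(\<lambda>i. v ^ i * r) ` {..degree g}"] conjI ballI)
        fix z assume "z \<in> ?L \<inter> pev_span K (r # rs)"
        then obtain f n where z: "z = pev f * r + n" "n \<in> ?N" by auto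
        have "pev f = pev (f div g) * pev g + pev (f mod g)"
          by (simp flip: pev_add pev_mult)
        then have "z - pev (f mod g) * r = pev (f div g) * (pev g * r) + n" by (simp add: z distrib_right mult.assoc)
        moreover have "pev (f div g) * (pev g * r) + n \<in> ?N" using g z by (intro D(2)[OF D(3)])
        moreover have "degree (f mod g) \<le> degree g" using degree_mod_less[OF g(1), of f] by auto
        ultimately show "\<exists>w\<in>V.span ((\<lambda>i. v ^ i * r) ` {..degree g}). z - w \<in> ?N"
          by (intro bexI[OF _ pev_mult_span[of "f mod g"]]) simp_all
      qed simp
    next
      case False
      show ?thesis
      proof (intro exI[of _ "{r}"] conjI ballI)
        fix z assume zL: "z \<in> ?L \<inter> pev_span K (r # rs)"
        then obtain f n where z: "z = pev f * r + n" "n \<in> ?N" by auto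
        then have "[:0,0,1:] * pderiv f = 0" using deriv[of f n] zL False by blast
        then have "pderiv f = 0" by (metis mult_eq_0_iff pCons_eq_0_iff zero_neq_one)
        then have "degree f = 0" by (simp add: pderiv_eq_0_iff)
        then obtain a where "f = [:a:]" by (metis degree_eq_zeroE)
        then have "z - c a * r = n" by (simp add: z pev_const)
        moreover have "c a * r \<in> V.span {r}" by (intro V.span_scale V.span_base) simp
        ultimately show "\<exists>w\<in>V.span {r}. z - w \<in> ?N" using z(2) by blast
      qed simp
    qed
    then obtain W where W: "finite W" "\<And>z. z \<in> ?L \<inter> pev_span K (r # rs) \<Longrightarrow> \<exists>w\<in>V.span W. z - w \<in> ?N" by blast
    have LM: "V.subspace (?L \<inter> pev_span K (r # rs))"
      by (intro V.subspace_inter L left_ideal_subspace M)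
    obtain F where F: "finite F" "F \<subseteq> ?L \<inter> pev_span K (r # rs)"
        "\<forall>z\<in>?L \<inter> pev_span K (r # rs). \<exists>w\<in>V.span F. z - w \<in> ?N"
      using subspace_finite_part[OF W(1) LM left_ideal_subspace[OF N(1)] W(2)] by metis
    obtain F' where F': "finite F'" "F' \<subseteq> ?L" "\<forall>z\<in>?L \<inter> ?N. \<exists>w\<in>V.span F'. z - w \<in> K" using Cons by auto
    show ?case
    proof (intro exI[of _ "F \<union> F'"] conjI ballI)
      fix z assume z: "z \<in> ?L \<inter> pev_span K (r # rs)"
      then obtain w where w: "w \<in> V.span F" "z - w \<in> ?N" using F(3) by blast
      have "V.span F \<subseteq> ?L" using F(2) by (intro V.span_minimal L) blast
      then have "z - w \<in> ?L \<inter> ?N" using w z V.subspace_diff[OF L, of z w] by blast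
      then obtain w' where w': "w' \<in> V.span F'" "z - w - w' \<in> K" using F'(3) by blast
      have "w + w' \<in> V.span (F \<union> F')"
        using w(1) w'(1) V.span_mono[of F "F \<union> F'"] V.span_mono[of F' "F \<union> F'"] by (intro V.span_add) blast+
      moreover have "z - (w + w') \<in> K" using w'(2) by (simp add: diff_diff_eq)
      ultimately show "\<exists>w\<in>V.span (F \<union> F'). z - w \<in> K" by blast
    qed (use F F' in auto)
  qed
  \<comment> \<open>The set \<open>?L\<close> is only known to be a subspace, so generators are
    chosen for the left ideal it generates. They are annihilated by \<open>u\<close> modulo
    \<open>K\<close>, hence their \<open>k[v]\<close>-combinations together with \<open>K\<close>
    form a left ideal containing \<open>?L\<close>.\<close>
  obtain F where F: "finite F" "F \<subseteq> ?L" "?L \<subseteq> left_ideal_of UNIV hull F" using finitely_generated[of ?L] by blast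
  obtain rs where rs: "set rs = F" using finite_list[OF F(1)] by blast
  have N: "left_ideal_of UNIV (pev_span K rs)" using pev_span_ideal[OF K, of rs] F rs by auto
  have "F \<subseteq> pev_span K rs"
  proof -
    have "r \<in> pev_span K rs" if "\<forall>r\<in>set rs. u * r \<in> K" "r \<in> set rs" for r rs
      using that
    proof (induction rs)
      case (Cons s rs)
      show ?case
      proof (cases "r = s")
        case True
        have "0 \<in> pev_span K rs" using pev_span_ideal[OF K, of rs] Cons.prems left_idealD(1) by auto
        then have "pev 1 * s + 0 \<in> pev_span K (s # rs)" unfolding pev_span.simps by blast
        then show ?thesis using True by (simp only: pev_1 mult_1_left add_0_right)
      next
        case False
        then have "r \<in> pev_span K rs" using Cons by auto
        then have "pev 0 * s + r \<in> pev_span K (s # rs)" unfolding pev_span.simps by blast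
        then show ?thesis by (simp only: pev_0 mult_zero_left add_0_left)
      qed
    qed simp
    then show ?thesis using F(2) rs by auto
  qed
  then have "?L \<subseteq> pev_span K rs" using F(3) hull_minimal[of F "pev_span K rs"] N by blast
  moreover obtain F' where "finite F'" "\<forall>z\<in>?L \<inter> pev_span K rs. \<exists>w\<in>V.span F'. z - w \<in> K"
    using step[of rs] F(2) rs by blast
  ultimately show ?thesis by blast
qed

section \<open>Noetherian criteria for subrings\<close>

lemma left_noetherianI:
  assumes B: "subring B" "range c \<subseteq> B"
    and *: "\<And>I. left_ideal_of B I \<Longrightarrow> \<exists>F W. finite F \<and> F \<subseteq> I \<and> finite W \<and>
      (\<forall>z\<in>I. \<exists>w\<in>V.span W. \<exists>r. (\<forall>f\<in>F. r f \<in> B) \<and> z = w + (\<Sum>f\<in>F. r f * f))"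
  shows "left_noetherian B"
  unfolding left_noetherian_def
proof (intro conjI allI impI B)
  fix I assume I: "left_ideal_of B I"
  then obtain F W where F: "finite F" "F \<subseteq> I" "finite W"
      "\<And>z. z \<in> I \<Longrightarrow> \<exists>w\<in>V.span W. \<exists>r. (\<forall>f\<in>F. r f \<in> B) \<and> z = w + (\<Sum>f\<in>F. r f * f)"
    using * by meson
  let ?J = "{\<Sum>f\<in>F. r f * f | r. \<forall>f\<in>F. r f \<in> B}"
  have Bcl: "0 \<in> B" "\<And>y z. y \<in> B \<Longrightarrow> z \<in> B \<Longrightarrow> y + z \<in> B" "\<And>y z. y \<in> B \<Longrightarrow> z \<in> B \<Longrightarrow> y * z \<in> B"
  proof -
    show 0: "0 \<in> B" using B(1) unfolding subring_def by (metis diff_self)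
    show "y + z \<in> B" if "y \<in> B" "z \<in> B" for y z
    proof -
      have "0 - z \<in> B" using B(1) 0 that unfolding subring_def by blast
      then have "y - (0 - z) \<in> B" using B(1) that unfolding subring_def by blast
      then show ?thesis by simp
    qed
    show "\<And>y z. y \<in> B \<Longrightarrow> z \<in> B \<Longrightarrow> y * z \<in> B" using B(1) unfolding subring_def by blast
  qed
  have cB: "c a \<in> B" for a using B(2) by blast
  have I_sub: "V.subspace I"
    using I cB unfolding left_ideal_of_def by (intro V.subspaceI) blast+
  have J: "V.subspace ?J"
  proof (rule V.subspaceI)
    show "0 \<in> ?J" using Bcl(1) by (intro CollectI exI[of _ "\<lambda>_. 0"]) simp
    fix y z assume "y \<in> ?J" "z \<in> ?J"
    then obtain r s where "\<forall>f\<in>F. r f \<in> B" "\<forall>f\<in>F. s f \<in> B" "y = (\<Sum>f\<in>F. r f * f)" "z = (\<Sum>f\<in>F. s f * f)" by blast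
    then show "y + z \<in> ?J"
      using Bcl(2) by (intro CollectI exI[of _ "\<lambda>f. r f + s f"]) (simp add: distrib_right sum.distrib)
  next
    fix a z assume "z \<in> ?J"
    then obtain r where "\<forall>f\<in>F. r f \<in> B" "z = (\<Sum>f\<in>F. r f * f)" by blast
    then show "c a * z \<in> ?J"
      using Bcl(3) cB by (intro CollectI exI[of _ "\<lambda>f. c a * r f"]) (simp add: sum_distrib_left mult.assoc)
  qed
  have "\<exists>w\<in>V.span W. z - w \<in> ?J" if z: "z \<in> I" for z
  proof -
    obtain w r where "w \<in> V.span W" "\<forall>f\<in>F. r f \<in> B" "z = w + (\<Sum>f\<in>F. r f * f)" using F(4)[OF z] by blast
    then show ?thesis by (intro bexI[of _ w]) auto
  qed
  \<comment> \<open>The finite-dimensional remainder is described by \<open>W\<close>, possibly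
    outside \<open>I\<close>; it is replaced by \<open>F'\<close> inside \<open>I\<close>.\<close>
  from subspace_finite_part[OF F(3) I_sub J this]
  obtain F' where "finite F' \<and> F' \<subseteq> I \<and> (\<forall>z\<in>I. \<exists>w\<in>V.span F'. z - w \<in> ?J)" ..
  then have F': "finite F'" "F' \<subseteq> I" "\<forall>z\<in>I. \<exists>w\<in>V.span F'. z - w \<in> ?J" by simp_all
  have "I = left_ideal_of B hull (F \<union> F')"
  proof
    show "left_ideal_of B hull (F \<union> F') \<subseteq> I" using F(2) F'(2) I by (intro hull_minimal) auto
    show "I \<subseteq> left_ideal_of B hull (F \<union> F')"
    proof
      fix z assume z: "z \<in> I"
      show "z \<in> left_ideal_of B hull (F \<union> F')"
        unfolding hull_def
      proof (intro InterI, clarify)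
        fix H assume H: "left_ideal_of B H" "F \<union> F' \<subseteq> H"
        obtain w where w: "w \<in> V.span F'" "z - w \<in> ?J" using F'(3) z by blast
        have "V.subspace H" using H(1) cB unfolding left_ideal_of_def by (intro V.subspaceI) blast+
        then have "w \<in> H" using w(1) H(2) V.span_minimal[of F' H] by blast
        moreover obtain r where r: "\<forall>f\<in>F. r f \<in> B" "z - w = (\<Sum>f\<in>F. r f * f)" using w(2) by blast
        have "z - w \<in> H" unfolding r(2) by (rule left_ideal_of_sum[OF H(1)]) (use r H in auto)
        ultimately have "w + (z - w) \<in> H" using H(1) unfolding left_ideal_of_def by blast
        then show "z \<in> H" by simp
      qed
    qed
  qed
  then show "\<exists>F. finite F \<and> F \<subseteq> I \<and> I = left_ideal_of B hull F"
    using F F' by (intro exI[of _ "F \<union> F'"]) auto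
qed

text \<open>Each coefficient over the full ring splits into a part in \<open>B\<close> and a part in
  the span of \<open>W\<close>; the latter contributes only combinations of the finitely many
  products \<open>w * f\<close>.\<close>

theorem left_noetherian_finite_codimension:
  assumes B: "subring B" "range c \<subseteq> B" and W: "finite W" "\<And>z. \<exists>w\<in>V.span W. z - w \<in> B"
  shows "left_noetherian B"
proof (rule left_noetherianI[OF B])
  fix I assume "left_ideal_of B I"
  obtain F where F: "finite F" "F \<subseteq> I" "I \<subseteq> left_ideal_of UNIV hull F" using finitely_generated[of I] by blast
  let ?W = "(\<lambda>(w, f). w * f) ` (W \<times> F)"
  have "\<exists>w\<in>V.span ?W. \<exists>r. (\<forall>f\<in>F. r f \<in> B) \<and> z = w + (\<Sum>f\<in>F. r f * f)" if z: "z \<in> I" for z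
  proof -
    obtain r where r: "z = (\<Sum>f\<in>F. r f * f)" using left_ideal_UNIV_hull_sum[OF F(1)] F(3) z by blast
    obtain w where w: "\<And>f. w f \<in> V.span W" "\<And>f. r f - w f \<in> B" using W(2) by metis
    have "(\<Sum>f\<in>F. w f * f) \<in> V.span ?W"
    proof (rule V.span_sum)
      fix f assume f: "f \<in> F"
      have "V.span W \<subseteq> {w. w * f \<in> V.span ?W}"
      proof (rule V.span_minimal)
        show "W \<subseteq> {w. w * f \<in> V.span ?W}" using f by (auto intro!: V.span_base)
        show "V.subspace {w. w * f \<in> V.span ?W}"
          by (rule V.subspaceI) (auto simp: V.span_zero distrib_right mult.assoc V.span_add V.span_scale)
      qed
      then show "w f * f \<in> V.span ?W" using w(1) by blast
    qed
    moreover have "z = (\<Sum>f\<in>F. w f * f) + (\<Sum>f\<in>F. (r f - w f) * f)"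
      by (simp add: r left_diff_distrib sum_subtractf)
    ultimately show ?thesis
      using w(2) by (intro bexI[of _ "\<Sum>f\<in>F. w f * f"] exI[of _ "\<lambda>f. r f - w f"] conjI ballI)
  qed
  then show "\<exists>F W. finite F \<and> F \<subseteq> I \<and> finite W \<and>
      (\<forall>z\<in>I. \<exists>w\<in>V.span W. \<exists>r. (\<forall>f\<in>F. r f \<in> B) \<and> z = w + (\<Sum>f\<in>F. r f * f))"
    using F W(1) by (intro exI[of _ F] exI[of _ ?W]) auto
qed

text \<open>Modulo finitely many elements of \<open>I\<close>, each member of \<open>I\<close> has
  the form \<open>u * r\<close>. The annihilator bound lets \<open>r\<close>, instead of
  \<open>u * r\<close>, be expanded in the generators up to finite dimension; multiplying back by
  \<open>u\<close> puts the coefficients into \<open>uR\<close>.\<close>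

theorem left_noetherian_uR: "left_noetherian {c a + u * r | a r. True}" (is "left_noetherian ?B")
proof (rule left_noetherianI)
  have B: "c a + u * r \<in> ?B" for a r by blast
  show "subring ?B"
    unfolding subring_def
  proof (intro conjI ballI)
    show "1 \<in> ?B" using B[of 1 0] by (simp add: c_simps)
    fix y z assume "y \<in> ?B" "z \<in> ?B"
    then obtain a r b s where *: "y = c a + u * r" "z = c b + u * s" by blast
    have "y - z = c (a - b) + u * (r - s)" by (simp add: * c_simps algebra_simps)
    then show "y - z \<in> ?B" using B by metis
    have "y * z = c (a * b) + u * (c a * s + r * (c b + u * s))"
      by (simp add: * c_simps distrib_left distrib_right mult.assoc c_comm2 add_ac)
    then show "y * z \<in> ?B" using B by metis
  qed
  show "range c \<subseteq> ?B"
  proof clarify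
    fix a show "\<exists>b r. c a = c b + u * r \<and> True" by (intro exI[of _ a] exI[of _ 0]) simp
  qed
  have uB: "u * r \<in> ?B" for r using B[of 0 r] by (simp add: c_simps)
  fix I assume I: "left_ideal_of ?B I"
  have I_sub: "V.subspace I"
    using I \<open>range c \<subseteq> ?B\<close> unfolding left_ideal_of_def by (intro V.subspaceI) blast+
  have uR: "V.subspace (range ((*) u))"
  proof (rule V.subspaceI)
    show "0 \<in> range ((*) u)" by (rule range_eqI[of _ _ 0]) simp
    fix y z assume "y \<in> range ((*) u)" "z \<in> range ((*) u)"
    then obtain r s where "y = u * r" "z = u * s" by blast
    then show "y + z \<in> range ((*) u)" by (intro range_eqI[of _ _ "r + s"]) (simp add: distrib_left)
  next
    fix a z assume "z \<in> range ((*) u)"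
    then obtain r where "z = u * r" by blast
    then show "c a * z \<in> range ((*) u)" by (intro range_eqI[of _ _ "c a * r"]) (simp add: c_comm2)
  qed
  have "\<exists>w\<in>V.span {1}. z - w \<in> range ((*) u)" if z: "z \<in> I" for z
  proof -
    have "z \<in> ?B" using I z unfolding left_ideal_of_def by blast
    then obtain a r where "z = c a + u * r" by blast
    then have "z - c a \<in> range ((*) u)" by (intro range_eqI[of _ _ r]) simp
    moreover have "c a * 1 \<in> V.span {1}" by (intro V.span_scale V.span_base) simp
    ultimately show ?thesis by (intro bexI[of _ "c a"]) simp_all
  qed
  then have "\<exists>F0. finite F0 \<and> F0 \<subseteq> I \<and> (\<forall>z\<in>I. \<exists>w\<in>V.span F0. z - w \<in> range ((*) u))"
    by (intro subspace_finite_part[OF _ I_sub uR, of "{1}"]) simp_all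
  then obtain F0 where "finite F0 \<and> F0 \<subseteq> I \<and> (\<forall>z\<in>I. \<exists>w\<in>V.span F0. z - w \<in> range ((*) u))" ..
  then have F0: "finite F0" "F0 \<subseteq> I" "\<forall>z\<in>I. \<exists>w\<in>V.span F0. z - w \<in> range ((*) u)" by simp_all
  obtain F where F: "finite F" "F \<subseteq> I" "I \<subseteq> left_ideal_of UNIV hull F" using finitely_generated[of I] by blast
  let ?K = "left_ideal_of UNIV hull F"
  obtain F2 where F2: "finite F2" "\<And>z. u * z \<in> ?K \<Longrightarrow> \<exists>w\<in>V.span F2. z - w \<in> ?K"
    using u_annihilator_finite[OF left_ideal_UNIV_hull] by blast
  let ?W = "F0 \<union> (*) u ` F2"
  have "\<exists>w\<in>V.span ?W. \<exists>r. (\<forall>f\<in>F. r f \<in> ?B) \<and> z = w + (\<Sum>f\<in>F. r f * f)" if z: "z \<in> I" for z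
  proof -
    obtain w r where w: "w \<in> V.span F0" "z - w = u * r" using F0(3) z by blast
    have "w \<in> I" using w(1) V.span_minimal[OF F0(2) I_sub] by blast
    then have "u * r \<in> ?K" using V.subspace_diff[OF I_sub z] w(2) F(3) by fastforce
    then obtain w' where w': "w' \<in> V.span F2" "r - w' \<in> ?K" using F2(2) by blast
    then obtain s where s: "r - w' = (\<Sum>f\<in>F. s f * f)" using left_ideal_UNIV_hull_sum[OF F(1)] by blast
    have "V.span F2 \<subseteq> {w. u * w \<in> V.span ?W}"
    proof (rule V.span_minimal)
      show "F2 \<subseteq> {w. u * w \<in> V.span ?W}" by (auto intro!: V.span_base)
      show "V.subspace {w. u * w \<in> V.span ?W}"
        by (rule V.subspaceI) (auto simp: V.span_zero distrib_left c_comm2 V.span_add V.span_scale)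
    qed
    then have "u * w' \<in> V.span ?W" using w'(1) by blast
    moreover have "w \<in> V.span ?W" using w(1) V.span_mono[of F0 ?W] by blast
    ultimately have "w + u * w' \<in> V.span ?W" by (intro V.span_add)
    moreover have "z = (w + u * w') + (\<Sum>f\<in>F. (u * s f) * f)"
    proof -
      have "(\<Sum>f\<in>F. (u * s f) * f) = u * (r - w')" by (simp add: s sum_distrib_left mult.assoc)
      then show ?thesis using w(2) by (simp add: right_diff_distrib algebra_simps)
    qed
    ultimately show ?thesis
      using uB by (intro bexI[of _ "w + u * w'"] exI[of _ "\<lambda>f. u * s f"] conjI ballI)
  qed
  then show "\<exists>F W. finite F \<and> F \<subseteq> I \<and> finite W \<and>
      (\<forall>z\<in>I. \<exists>w\<in>V.span W. \<exists>r. (\<forall>f\<in>F. r f \<in> ?B) \<and> z = w + (\<Sum>f\<in>F. r f * f))"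
    using F F0(1) F2(1) by (intro exI[of _ F] exI[of _ ?W]) auto
qed

text \<open>The generators \<open>F\<close> in \<open>I\<close> are chosen so that their multiples
  \<open>u * f\<close> generate the left ideal of \<open>u * I\<close> over the full ring. The
  annihilator bound puts \<open>z\<close> itself, up to finite dimension, into that ideal, so the
  coefficients of the \<open>f\<close> end in \<open>u\<close>.\<close>

theorem left_noetherian_Ru: "left_noetherian {c a + r * u | a r. True}" (is "left_noetherian ?B")
proof (rule left_noetherianI)
  have B: "c a + r * u \<in> ?B" for a r by blast
  show "subring ?B"
    unfolding subring_def
  proof (intro conjI ballI)
    show "1 \<in> ?B" using B[of 1 0] by (simp add: c_simps)
    fix y z assume "y \<in> ?B" "z \<in> ?B"
    then obtain a r b s where *: "y = c a + r * u" "z = c b + s * u" by blast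
    have "y - z = c (a - b) + (r - s) * u" by (simp add: * c_simps algebra_simps)
    then show "y - z \<in> ?B" using B by metis
    have "y * z = c (a * b) + (c b * r + (c a + r * u) * s) * u"
      by (simp add: * c_simps distrib_left distrib_right mult.assoc c_comm[of r] c_comm2[of r] c_comm[of u] c_comm2[of u] add_ac)
    then show "y * z \<in> ?B" using B by metis
  qed
  show "range c \<subseteq> ?B"
  proof clarify
    fix a show "\<exists>b r. c a = c b + r * u \<and> True" by (intro exI[of _ a] exI[of _ 0]) simp
  qed
  have uB: "r * u \<in> ?B" for r using B[of 0 r] by (simp add: c_simps)
  fix I assume I: "left_ideal_of ?B I"
  obtain G where G: "finite G" "G \<subseteq> (*) u ` I" "(*) u ` I \<subseteq> left_ideal_of UNIV hull G"
    using finitely_generated[of "(*) u ` I"] by blast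
  \<comment> \<open>Injectivity of left multiplication by \<open>u\<close> on \<open>F\<close>
    permits the sum over \<open>G\<close> to be reindexed by \<open>F\<close>.\<close>
  then obtain F where F: "F \<subseteq> I" "inj_on ((*) u) F" "G = (*) u ` F" using subset_image_inj[of G "(*) u" I] by blast
  have "finite F" using G(1) F finite_image_iff by blast
  let ?K = "left_ideal_of UNIV hull G"
  obtain F2 where F2: "finite F2" "\<And>z. u * z \<in> ?K \<Longrightarrow> \<exists>w\<in>V.span F2. z - w \<in> ?K"
    using u_annihilator_finite[OF left_ideal_UNIV_hull] by blast
  have "\<exists>w\<in>V.span F2. \<exists>r. (\<forall>f\<in>F. r f \<in> ?B) \<and> z = w + (\<Sum>f\<in>F. r f * f)" if z: "z \<in> I" for z
  proof -
    have "u * z \<in> ?K" using z G(3) by blast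
    then obtain w where w: "w \<in> V.span F2" "z - w \<in> ?K" using F2(2) by blast
    then obtain s where "z - w = (\<Sum>g\<in>G. s g * g)" using left_ideal_UNIV_hull_sum[OF G(1)] by blast
    also have "\<dots> = (\<Sum>f\<in>F. (s (u * f) * u) * f)" unfolding F(3) by (simp add: sum.reindex[OF F(2)] mult.assoc)
    finally have "z = w + (\<Sum>f\<in>F. (s (u * f) * u) * f)" by (simp add: algebra_simps)
    then show ?thesis
      using w(1) uB by (intro bexI[of _ w] exI[of _ "\<lambda>f. s (u * f) * u"] conjI ballI)
  qed
  then show "\<exists>F W. finite F \<and> F \<subseteq> I \<and> finite W \<and>
      (\<forall>z\<in>I. \<exists>w\<in>V.span W. \<exists>r. (\<forall>f\<in>F. r f \<in> ?B) \<and> z = w + (\<Sum>f\<in>F. r f * f))"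
    using F(1) \<open>finite F\<close> F2(1) by (intro exI[of _ F] exI[of _ F2]) auto
qed

end

section \<open>The opposite ring and the images of \<open>\<lambda>\<^sub>a\<close>\<close>

typedef 'a op = "UNIV :: 'a set" morphisms unop Op ..

setup_lifting type_definition_op

instantiation op :: (ring_1) ring_1
begin
lift_definition zero_op :: "'a op" is 0 .
lift_definition one_op :: "'a op" is 1 .
lift_definition plus_op :: "'a op \<Rightarrow> 'a op \<Rightarrow> 'a op" is "(+)" .
lift_definition minus_op :: "'a op \<Rightarrow> 'a op \<Rightarrow> 'a op" is "(-)" .
lift_definition uminus_op :: "'a op \<Rightarrow> 'a op" is uminus .
lift_definition times_op :: "'a op \<Rightarrow> 'a op \<Rightarrow> 'a op" is "\<lambda>x y. y * x" .
instance
  by standard (transfer; simp add: algebra_simps)+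
end

lemma Op_simps: "Op 0 = 0" "Op 1 = 1" "Op y + Op z = Op (y + z)" "Op y - Op z = Op (y - z)" "- Op z = Op (- z)"
  "Op y * Op z = Op (z * y)"
  by (simp_all add: zero_op.abs_eq one_op.abs_eq plus_op.abs_eq minus_op.abs_eq uminus_op.abs_eq times_op.abs_eq)

lemma Op_sum: "Op (sum f A) = (\<Sum>i\<in>A. Op (f i))"
  by (induction A rule: infinite_finite_induct) (simp_all add: Op_simps(1) flip: Op_simps(3))

lemma inj_Op: "inj Op" by (simp add: inj_on_def Op_inject)

lemma Op_image_iff [simp]: "Op z \<in> Op ` A \<longleftrightarrow> z \<in> A"
  by (rule inj_image_mem_iff[OF inj_Op])

lemma subring_Op: "subring A \<Longrightarrow> subring (Op ` A)"
  by (auto simp: subring_def Op_simps image_iff simp flip: Op_simps(2) intro: bexI[of _ 1])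

lemma left_ideal_of_Op: "right_ideal_of A I \<Longrightarrow> left_ideal_of (Op ` A) (Op ` I)"
  unfolding right_ideal_of_def left_ideal_of_def
  by (auto simp: Op_simps simp flip: Op_simps(1))

lemma right_noetherian_Op:
  assumes "left_noetherian (Op ` A)"
  shows "right_noetherian A"
  unfolding right_noetherian_def
proof (intro conjI allI impI)
  have A: "subring (Op ` A)" using assms by (simp add: left_noetherian_def)
  show "subring A"
    unfolding subring_def
  proof (intro conjI ballI)
    show "1 \<in> A" using A unfolding subring_def Op_simps(2)[symmetric] by simp
    fix y z assume "y \<in> A" "z \<in> A"
    then have "Op y \<in> Op ` A" "Op z \<in> Op ` A" by simp_all
    then have "Op y - Op z \<in> Op ` A" "Op z * Op y \<in> Op ` A" using A unfolding subring_def by blast+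
    then show "y - z \<in> A" "y * z \<in> A" by (simp_all add: Op_simps)
  qed
  fix I assume I: "right_ideal_of A I"
  then obtain F where F: "finite F" "F \<subseteq> Op ` I" "Op ` I = left_ideal_of (Op ` A) hull F"
    using assms left_ideal_of_Op unfolding left_noetherian_def by meson
  obtain F' where F': "F' \<subseteq> I" "F = Op ` F'" using F(2) by (meson subset_imageE)
  have "finite F'" using F(1) F'(2) finite_image_iff[OF inj_on_subset[OF inj_Op subset_UNIV], of F'] by simp
  moreover have "I = right_ideal_of A hull F'"
  proof
    show "right_ideal_of A hull F' \<subseteq> I" by (rule hull_minimal) (use F' I in auto)
    show "I \<subseteq> right_ideal_of A hull F'"
      unfolding hull_def
    proof (intro Inter_greatest, clarify)
      fix H z assume H: "right_ideal_of A H" "F' \<subseteq> H" and z: "z \<in> I"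
      have "left_ideal_of (Op ` A) hull F \<subseteq> Op ` H"
        by (rule hull_minimal) (use H F' left_ideal_of_Op in auto)
      moreover have "Op z \<in> left_ideal_of (Op ` A) hull F" unfolding F(3)[symmetric] using z by simp
      ultimately have "Op z \<in> Op ` H" by blast
      then show "z \<in> H" by simp
    qed
  qed
  ultimately show "\<exists>F. finite F \<and> F \<subseteq> I \<and> I = right_ideal_of A hull F" using F'(1) by (intro exI[of _ F'] conjI)
qed

section \<open>Induction principles and spanning monomials for \<open>R\<close>\<close>

lemma jordan_abs_sum: "abs_jordan (\<Sum>i\<in>A. f i) = (\<Sum>i\<in>A. abs_jordan (f i))"
  by (induction A rule: infinite_finite_induct) (simp_all flip: zero_jordan.abs_eq plus_jordan.abs_eq)

lemma jordan_induct_words: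
  assumes add: "\<And>y z. P y \<Longrightarrow> P z \<Longrightarrow> P (y + z)" and 0: "P 0"
    and word: "\<And>r ws. P (abs_jordan (Poly_Mapping.single ws r))"
  shows "P z"
proof (induction z rule: jordan.abs_induct)
  case (1 p)
  have "P (\<Sum>i\<in>A. f i)" if "\<And>i. P (f i)" for A and f :: "jgen list \<Rightarrow> _"
    using that by (induction A rule: infinite_finite_induct) (auto intro: 0 add)
  then show ?case by (subst poly_mapping_sum_single[of p]) (simp add: jordan_abs_sum word)
qed

lemma jordan_gen_cases: "abs_jordan (gen g) = R_u \<or> abs_jordan (gen g) = R_v"
  by (cases g) (simp_all add: R_u.abs_eq R_v.abs_eq)

lemma jordan_left_induct:
  fixes z :: "'k::field jordan"
  assumes 1: "P 1" and add: "\<And>y z. P y \<Longrightarrow> P z \<Longrightarrow> P (y + z)" and scl: "\<And>r z. P z \<Longrightarrow> P (R_const r * z)"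
    and u: "\<And>z. P z \<Longrightarrow> P (R_u * z)" and v: "\<And>z. P z \<Longrightarrow> P (R_v * z)"
  shows "P z"
proof (rule jordan_induct_words[of P])
  show "P 0" using scl[OF 1, of 0] by (simp add: R_const_simps)
  show "P (abs_jordan (Poly_Mapping.single ws r))" for r ws
  proof (induction ws)
    case Nil
    have "abs_jordan (Poly_Mapping.single [] r) = R_const r * 1" by (simp add: R_const.abs_eq const_def)
    then show ?case using scl[OF 1] by simp
  next
    case (Cons g ws)
    have "Poly_Mapping.single (g # ws) r = gen g * Poly_Mapping.single ws r"
      by (simp add: gen_def mult_single plus_list_def)
    then have "abs_jordan (Poly_Mapping.single (g # ws) r) = abs_jordan (gen g) * abs_jordan (Poly_Mapping.single ws r)"
      by (simp add: times_jordan.abs_eq)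
    then show ?case using jordan_gen_cases[of g] u v Cons by metis
  qed
qed (rule add)

text \<open>Right multiplication in \<open>R\<close> is left multiplication in the opposite ring, so
  this principle supplies the generation assumption there.\<close>

lemma jordan_right_induct:
  fixes z :: "'k::field jordan"
  assumes 1: "P 1" and add: "\<And>y z. P y \<Longrightarrow> P z \<Longrightarrow> P (y + z)" and scl: "\<And>r z. P z \<Longrightarrow> P (R_const r * z)"
    and u: "\<And>z. P z \<Longrightarrow> P (z * R_u)" and v: "\<And>z. P z \<Longrightarrow> P (z * R_v)"
  shows "P z"
proof (rule jordan_induct_words[of P])
  show "P 0" using scl[OF 1, of 0] by (simp add: R_const_simps)
  show "P (abs_jordan (Poly_Mapping.single ws r))" for r ws
  proof (induction ws rule: rev_induct)
    case Nil
    have "abs_jordan (Poly_Mapping.single [] r) = R_const r * 1" by (simp add: R_const.abs_eq const_def)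
    then show ?case using scl[OF 1] by simp
  next
    case (snoc g ws)
    have "Poly_Mapping.single (ws @ [g]) r = Poly_Mapping.single ws r * gen g"
      by (simp add: gen_def mult_single plus_list_def)
    then have "abs_jordan (Poly_Mapping.single (ws @ [g]) r) = abs_jordan (Poly_Mapping.single ws r) * abs_jordan (gen g)"
      by (simp add: times_jordan.abs_eq)
    then show ?case using jordan_gen_cases[of g] u v snoc by metis
  qed
qed (rule add)

lemma R_uv: "R_u * R_v = R_v * R_u + R_v * (R_v :: 'k::field jordan)"
  using R_relation[where 'k='k] by (simp add: power2_eq_square algebra_simps)

interpretation R: jordan_like R_const R_u "R_v :: 'k::field_char_0 jordan"
  by unfold_locales (rule algebra_over_R R_uv jordan_left_induct; assumption)+

text \<open>Reversed products satisfy \<open>u v = v u - v^2\<close>; replacing \<open>v\<close> by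
  \<open>- v\<close> restores the sign of the square.\<close>

interpretation Rop: jordan_like "\<lambda>r. Op (R_const r)" "Op R_u" "Op (- R_v :: 'k::field_char_0 jordan)"
proof unfold_locales
  show "algebra_over (\<lambda>r. Op (R_const r :: 'k jordan))"
    unfolding algebra_over_def
  proof (intro conjI allI)
    show "Op (R_const r) * z = z * Op (R_const r :: 'k jordan)" for r z
      by (cases z) (simp add: Op_simps algebra_overD(4)[OF algebra_over_R])
    show "Op (R_const (r * s)) = Op (R_const r) * Op (R_const s :: 'k jordan)" for r s
      by (simp only: Op_simps algebra_overD(3)[OF algebra_over_R, symmetric] mult.commute)
  qed (simp_all only: Op_simps R_const_simps)
  show "Op R_u * Op (- R_v) = Op (- R_v) * Op R_u + Op (- R_v) * Op (- R_v :: 'k jordan)"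
    using R_uv[where 'k='k] by (simp add: Op_simps)
  fix P :: "'k jordan op \<Rightarrow> bool" and z
  assume P: "P 1" "\<And>y z. P y \<Longrightarrow> P z \<Longrightarrow> P (y + z)" "\<And>r z. P z \<Longrightarrow> P (Op (R_const r) * z)"
    "\<And>z. P z \<Longrightarrow> P (Op R_u * z)" "\<And>z. P z \<Longrightarrow> P (Op (- R_v) * z)"
  have "P (Op y)" for y
  proof (induction y rule: jordan_right_induct)
    case 1 then show ?case using P(1) by (simp add: Op_simps)
  next
    case (2 y z) then show ?case using P(2) by (simp flip: Op_simps(3))
  next
    case (3 r z) then show ?case using P(3)[of "Op z" r] by (simp add: Op_simps algebra_overD(4)[OF algebra_over_R])
  next
    case (4 z) then show ?case using P(4)[of "Op z"] by (simp add: Op_simps)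
  next
    case (5 z)
    then have "P (Op (R_const (- 1)) * (Op (- R_v) * Op z))" by (intro P)
    then show ?case by (simp add: Op_simps R_const_simps)
  qed
  then show "P z" by (cases z) simp
qed

text \<open>Keeping \<open>u\<close> on the right suits the image of \<open>lam 1\<close>, made of
  constants and multiples \<open>r * u\<close>.\<close>

lemma R_span_left: "z \<in> R.V.span {R_v ^ j * R_u ^ i | i j. True}"
proof (induction z rule: jordan_left_induct)
  case 1
  have "(1 :: 'a jordan) = R_v ^ 0 * R_u ^ 0" by simp
  then show ?case by (intro R.V.span_base) blast
next
  case (4 z)
  let ?S = "{R_v ^ j * R_u ^ i | i j. True} :: 'a jordan set"
  have "?S \<subseteq> {z. R_u * z \<in> R.V.span ?S}"
  proof clarify
    fix i j
    have "R_u * R_v ^ j = R_v ^ j * R_u + R_const (of_nat j) * (R_v ^ Suc j :: 'a jordan)" by (simp add: R_vu)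
    then have "R_u * (R_v ^ j * R_u ^ i) = (R_v ^ j * R_u + R_const (of_nat j) * R_v ^ Suc j) * (R_u ^ i :: 'a jordan)"
      by (simp only: mult.assoc[symmetric])
    also have "\<dots> = R_v ^ j * R_u ^ Suc i + R_const (of_nat j) * (R_v ^ Suc j * R_u ^ i)"
      by (simp only: distrib_right mult.assoc power_Suc)
    finally have "R_u * (R_v ^ j * R_u ^ i) = R_v ^ j * R_u ^ Suc i + R_const (of_nat j) * (R_v ^ Suc j * (R_u ^ i :: 'a jordan))" .
    then show "R_u * (R_v ^ j * R_u ^ i) \<in> R.V.span ?S"
      by (simp only:) (intro R.V.span_add R.V.span_scale R.V.span_base; blast)
  qed
  moreover have "R.V.subspace {z. R_u * z \<in> R.V.span ?S}"
    by (rule R.V.subspaceI) (auto simp: R.V.span_zero distrib_left R_comm[of R_u] R.V.span_add R.V.span_scale)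
  ultimately show ?case using R.V.span_minimal 4 by blast
next
  case (5 z)
  let ?S = "{R_v ^ j * R_u ^ i | i j. True} :: 'a jordan set"
  have "?S \<subseteq> {z. R_v * z \<in> R.V.span ?S}"
  proof clarify
    fix i j
    have "R_v ^ Suc j * R_u ^ i \<in> R.V.span ?S" by (intro R.V.span_base) blast
    then show "R_v * (R_v ^ j * R_u ^ i) \<in> R.V.span ?S" by (simp add: mult.assoc)
  qed
  moreover have "R.V.subspace {z. R_v * z \<in> R.V.span ?S}"
    by (rule R.V.subspaceI) (auto simp: R.V.span_zero distrib_left R_comm[of R_v] R.V.span_add R.V.span_scale)
  ultimately show ?case using R.V.span_minimal 5 by blast
qed (auto intro: R.V.span_add R.V.span_scale)

text \<open>With \<open>u\<close> on the left the monomials suit \<open>uR\<close>; sorting them by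
  total degree allows the comparison with \<open>R_comp\<close>.\<close>

definition R_mons :: "nat \<Rightarrow> 'k::field jordan set" where
  "R_mons n = {R_u ^ i * R_v ^ j | i j. i + j = n}"

lemma R_mons_mult:
  fixes z :: "'k::field_char_0 jordan"
  assumes "z \<in> R.V.span (R_mons n)"
  shows "z * R_u \<in> R.V.span (R_mons (Suc n))" "z * R_v \<in> R.V.span (R_mons (Suc n))"
proof -
  have mem: "R_u ^ i * R_v ^ j \<in> R.V.span (R_mons (Suc n) :: 'k jordan set)" if "i + j = Suc n" for i j
    using that unfolding R_mons_def by (intro R.V.span_base) blast
  have sub: "R.V.subspace {z. z * y \<in> R.V.span (R_mons (Suc n))}" for y :: "'k jordan"
    by (rule R.V.subspaceI) (auto simp: R.V.span_zero distrib_right mult.assoc R.V.span_add R.V.span_scale)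
  have "R_mons n \<subseteq> {z :: 'k jordan. z * R_u \<in> R.V.span (R_mons (Suc n))}"
  proof
    fix t :: "'k jordan" assume "t \<in> R_mons n"
    then obtain i j where t: "t = R_u ^ i * R_v ^ j" "i + j = n" unfolding R_mons_def by blast
    have "t * R_u = R_u ^ Suc i * R_v ^ j - R_const (of_nat j) * (R_u ^ i * R_v ^ Suc j)"
    proof -
      have "t * R_u = R_u ^ i * (R_u * R_v ^ j) - R_u ^ i * (R_const (of_nat j) * R_v ^ Suc j)"
        unfolding t(1) mult.assoc R_vu right_diff_distrib ..
      then show ?thesis unfolding R_comm[of "R_u ^ i"] by (simp add: power_commutes flip: mult.assoc)
    qed
    moreover have "R_u ^ Suc i * R_v ^ j - R_const (of_nat j) * (R_u ^ i * R_v ^ Suc j) \<in> R.V.span (R_mons (Suc n) :: 'k jordan set)"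
      by (intro R.V.span_diff R.V.span_scale mem) (use t in auto)
    ultimately show "t \<in> {z. z * R_u \<in> R.V.span (R_mons (Suc n))}" by simp
  qed
  then show "z * R_u \<in> R.V.span (R_mons (Suc n))" using R.V.span_minimal[OF _ sub] assms by blast
  have "R_mons n \<subseteq> {z :: 'k jordan. z * R_v \<in> R.V.span (R_mons (Suc n))}"
  proof
    fix t :: "'k jordan" assume "t \<in> R_mons n"
    then obtain i j where t: "t = R_u ^ i * R_v ^ j" "i + j = n" unfolding R_mons_def by blast
    have "t * R_v = R_u ^ i * R_v ^ Suc j" unfolding t by (simp add: mult.assoc power_commutes)
    then show "t \<in> {z. z * R_v \<in> R.V.span (R_mons (Suc n))}" using mem[of i "Suc j"] t by simp
  qed
  then show "z * R_v \<in> R.V.span (R_mons (Suc n))" using R.V.span_minimal[OF _ sub] assms by blast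
qed

lemma R_span_mons: "z \<in> R.V.span (\<Union>n. R_mons n)"
proof -
  let ?S = "\<Union>n. R_mons n :: 'a jordan set"
  have mult: "z * R_u \<in> R.V.span ?S" "z * R_v \<in> R.V.span ?S" if z: "z \<in> R.V.span ?S" for z
  proof -
    have sub: "R.V.subspace {z. z * y \<in> R.V.span ?S}" for y
      by (rule R.V.subspaceI) (auto simp: R.V.span_zero distrib_right mult.assoc R.V.span_add R.V.span_scale)
    have up: "R.V.span (R_mons n) \<subseteq> R.V.span ?S" for n by (intro R.V.span_mono) blast
    have S: "?S \<subseteq> {z. z * R_u \<in> R.V.span ?S}" "?S \<subseteq> {z. z * R_v \<in> R.V.span ?S}"
      using R_mons_mult[OF R.V.span_base] up by blast+
    show "z * R_u \<in> R.V.span ?S" "z * R_v \<in> R.V.span ?S"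
      using subsetD[OF R.V.span_minimal[OF S(1) sub] z] subsetD[OF R.V.span_minimal[OF S(2) sub] z] by simp_all
  qed
  show ?thesis
  proof (induction z rule: jordan_right_induct)
    case 1
    have "(1 :: 'a jordan) = R_u ^ 0 * R_v ^ 0" by simp
    then have "1 \<in> (R_mons 0 :: 'a jordan set)" unfolding R_mons_def by blast
    then show ?case by (intro R.V.span_base) blast
  qed (auto intro: R.V.span_add R.V.span_scale mult)
qed

lemma R_comp_subset: "R_comp n \<subseteq> R.V.span (R_mons n)"
proof -
  have "prod_list xs \<in> R.V.span (R_mons (length xs))" if "set xs \<subseteq> {R_u, R_v}" for xs :: "'a jordan list"
    using that
  proof (induction xs rule: rev_induct)
    case Nil
    have "(1 :: 'a jordan) = R_u ^ 0 * R_v ^ 0" by simp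
    then have "1 \<in> (R_mons 0 :: 'a jordan set)" unfolding R_mons_def by blast
    then show ?case by (simp add: R.V.span_base)
  next
    case (snoc y xs)
    then have "prod_list xs \<in> R.V.span (R_mons (length xs))" "y = R_u \<or> y = R_v" by auto
    then show ?case using R_mons_mult by auto
  qed
  then show ?thesis unfolding R_comp_def span_over_def
    by (intro R.V.span_minimal R.V.subspace_span) auto
qed

section \<open>The images of the maps \<open>lam a\<close>\<close>

context
  fixes a :: "'k::field_char_0"
begin

lemmas lam_hom = algebra_homD[OF algebra_hom_lam[of a]]

lemma subring_range_lam: "subring (range (lam a))"
  unfolding subring_def
proof (intro conjI ballI)
  show "1 \<in> range (lam a)" by (rule range_eqI[of _ _ 1]) (simp add: lam_hom)
  fix y z assume "y \<in> range (lam a)" "z \<in> range (lam a)"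
  then obtain y' z' where "y = lam a y'" "z = lam a z'" by blast
  then show "y - z \<in> range (lam a)" "y * z \<in> range (lam a)"
    by (auto intro: range_eqI[of _ _ "y' - z'"] range_eqI[of _ _ "y' * z'"] simp: lam_hom(3,7))
qed

lemma range_lam_const: "R_const r \<in> range (lam a)"
  by (rule range_eqI[of _ _ "U_const r"]) (simp add: lam_hom)

lemma range_lam_subspace: "R.V.subspace (range (lam a))"
proof (rule R.V.subspaceI)
  show "0 \<in> range (lam a)" by (rule range_eqI[of _ _ 0]) (simp add: lam_hom)
  fix y z assume "y \<in> range (lam a)" "z \<in> range (lam a)"
  then obtain y' z' where "y = lam a y'" "z = lam a z'" by blast
  then show "y + z \<in> range (lam a)" by (intro range_eqI[of _ _ "y' + z'"]) (simp add: lam_hom(2))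
next
  fix r z assume "z \<in> range (lam a)"
  then show "R_const r * z \<in> range (lam a)"
    using subring_range_lam range_lam_const[of r] unfolding subring_def by blast
qed

lemma range_lam_subset:
  assumes "1 \<in> C" "\<And>y z. y \<in> C \<Longrightarrow> z \<in> C \<Longrightarrow> y + z \<in> C" "\<And>r z. z \<in> C \<Longrightarrow> R_const r * z \<in> C"
    "\<And>i z. z \<in> C \<Longrightarrow> lam a (x i) * z \<in> C"
  shows "range (lam a) \<subseteq> C"
proof -
  have "lam a z \<in> C" for z
    by (induction z rule: UW_induct) (simp_all add: lam_hom(1-4) assms)
  then show ?thesis by blast
qed

end

text \<open>For \<open>a = 0\<close> the image of \<open>x j\<close> is \<open>u v^j\<close>, so
  \<open>x 0 ^ i * x j\<close> hits \<open>u\<close> times the monomial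
  \<open>u^i v^j\<close>.\<close>

lemma range_lam_0: "range (lam (0 :: 'k::field_char_0)) = {R_const c + R_u * r | c r. True}" (is "_ = ?C")
proof
  have C: "R_const c + R_u * r \<in> ?C" for c :: 'k and r by blast
  have C': "R_u * r \<in> ?C" for r :: "'k jordan" using C[of 0 r] by (simp add: R_const_simps)
  show "range (lam 0) \<subseteq> ?C"
  proof (rule range_lam_subset)
    show "1 \<in> ?C" using C[of 1 0] by (simp add: R_const_simps)
    fix y z :: "'k jordan" assume "y \<in> ?C" "z \<in> ?C"
    then obtain c r c' r' where "y = R_const c + R_u * r" "z = R_const c' + R_u * r'" by blast
    then have "y + z = R_const (c + c') + R_u * (r + r')" by (simp add: R_const_simps distrib_left add_ac)
    then show "y + z \<in> ?C" using C by metis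
  next
    fix s and z :: "'k jordan" assume "z \<in> ?C"
    then obtain c r where "z = R_const c + R_u * r" by blast
    then have "R_const s * z = R_const (s * c) + R_u * (R_const s * r)"
      by (simp add: distrib_left R_comm[of R_u] algebra_overD(3)[OF algebra_over_R])
    then show "R_const s * z \<in> ?C" using C by metis
  next
    fix i and z :: "'k jordan"
    have "lam 0 (x i) * z = R_u * (R_v ^ i * z)" by (simp add: lam_x R_const_simps mult.assoc)
    then show "lam 0 (x i) * z \<in> ?C" using C' by metis
  qed
  show "?C \<subseteq> range (lam 0)"
  proof clarify
    fix c :: 'k and r :: "'k jordan"
    have S: "(\<Union>n. R_mons n) \<subseteq> {r. R_u * r \<in> range (lam (0 :: 'k))}"
    proof
      fix t :: "'k jordan" assume "t \<in> (\<Union>n. R_mons n)"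
      then obtain i j where t: "t = R_u ^ i * R_v ^ j" unfolding R_mons_def by blast
      have "R_u * t = lam 0 (x 0 ^ i * x j)"
        by (simp add: t algebra_homD[OF algebra_hom_lam] lam_x[unfolded One_nat_def] lam_x[of _ 0, simplified] R_const_simps power_commutes flip: mult.assoc)
      then show "t \<in> {r. R_u * r \<in> range (lam (0 :: 'k))}" by simp
    qed
    have sub: "R.V.subspace {r. R_u * r \<in> range (lam (0 :: 'k))}"
      using range_lam_subspace[of "0::'k"] by (intro R.V.subspaceI) (auto simp: distrib_left R_comm[of R_u] R.V.subspace_0 R.V.subspace_add R.V.subspace_scale)
    have "R_u * r \<in> range (lam 0)" using subsetD[OF R.V.span_minimal[OF S sub] R_span_mons[of r]] by simp
    then show "R_const c + R_u * r \<in> range (lam 0)"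
      using R.V.subspace_add[OF range_lam_subspace range_lam_const] by blast
  qed
qed

text \<open>For \<open>a = 1\<close> the correction term equals the commutator of \<open>u\<close>
  with \<open>v^i\<close>, so \<open>x i\<close> maps to \<open>v^i u\<close>.\<close>

lemma range_lam_1: "range (lam (1 :: 'k::field_char_0)) = {R_const c + r * R_u | c r. True}" (is "_ = ?C")
proof
  have C: "R_const c + r * R_u \<in> ?C" for c :: 'k and r by blast
  have x1: "lam 1 (x i) = R_v ^ i * (R_u :: 'k jordan)" for i by (simp add: lam_x R_vu)
  show "range (lam 1) \<subseteq> ?C"
  proof (rule range_lam_subset)
    show "1 \<in> ?C" using C[of 1 0] by (simp add: R_const_simps)
    fix y z :: "'k jordan" assume "y \<in> ?C" "z \<in> ?C"
    then obtain c r c' r' where "y = R_const c + r * R_u" "z = R_const c' + r' * R_u" by blast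
    then have "y + z = R_const (c + c') + (r + r') * R_u" by (simp add: R_const_simps distrib_right add_ac)
    then show "y + z \<in> ?C" using C by metis
  next
    fix s and z :: "'k jordan" assume "z \<in> ?C"
    then obtain c r where "z = R_const c + r * R_u" by blast
    then have "R_const s * z = R_const (s * c) + (R_const s * r) * R_u"
      by (simp add: distrib_left mult.assoc algebra_overD(3)[OF algebra_over_R])
    then show "R_const s * z \<in> ?C" using C by metis
  next
    fix i and z :: "'k jordan" assume "z \<in> ?C"
    then obtain c r where z: "z = R_const c + r * R_u" by blast
    have "lam 1 (x i) * z = R_v ^ i * (R_u * R_const c) + R_v ^ i * R_u * r * R_u"
      unfolding z x1 by (simp add: distrib_left mult.assoc)
    also have "R_u * R_const c = R_const c * R_u" by (rule algebra_overD(4)[OF algebra_over_R, symmetric])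
    finally have "lam 1 (x i) * z = R_const 0 + (R_v ^ i * R_const c + R_v ^ i * R_u * r) * R_u"
      by (simp add: R_const_simps distrib_right mult.assoc)
    then show "lam 1 (x i) * z \<in> ?C" using C by metis
  qed
  show "?C \<subseteq> range (lam 1)"
  proof clarify
    fix c :: 'k and r :: "'k jordan"
    have S: "{R_v ^ j * R_u ^ i | i j. True} \<subseteq> {r. r * R_u \<in> range (lam (1 :: 'k))}"
    proof clarify
      fix i j
      have "(R_v ^ j * R_u ^ i) * R_u = lam 1 (x j * x 0 ^ i :: 'k UW)"
        by (simp only: algebra_homD[OF algebra_hom_lam] x1) (simp add: power_commutes mult.assoc)
      then show "R_v ^ j * R_u ^ i * R_u \<in> range (lam (1 :: 'k))" by simp
    qed
    have sub: "R.V.subspace {r. r * R_u \<in> range (lam (1 :: 'k))}"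
      using range_lam_subspace[of "1::'k"] by (intro R.V.subspaceI) (auto simp: distrib_right mult.assoc R.V.subspace_0 R.V.subspace_add R.V.subspace_scale)
    have "r * R_u \<in> range (lam 1)" using subsetD[OF R.V.span_minimal[OF S sub] R_span_left[of r]] by simp
    then show "R_const c + r * R_u \<in> range (lam 1)"
      using R.V.subspace_add[OF range_lam_subspace range_lam_const] by blast
  qed
qed

text \<open>The power \<open>v^j\<close> comes from \<open>Q (j - 3)\<close>, whose image has the
  factor \<open>(j - 3) a (a - 1)\<close>; it is nonzero from \<open>j = 4\<close> on, which
  explains the bound. In the induction the correction term of \<open>x j\<close> has the same total
  degree but one \<open>u\<close> less.\<close>

lemma R_mons_range_lam:
  assumes a: "a \<notin> {0, 1 :: 'k::field_char_0}"
  shows "i + j \<ge> 4 \<Longrightarrow> R_u ^ i * R_v ^ j \<in> range (lam a)"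
proof (induction i arbitrary: j)
  case 0
  define m where "m = j - 3"
  have m: "j = m + 3" "m \<ge> 1" using 0 by (auto simp: m_def)
  define d where "d = of_nat m * (a * (a - 1))"
  have "d \<noteq> 0" using a m by (simp add: d_def)
  have "R_const (inverse d) * lam a (Q m) \<in> range (lam a)"
    by (intro R.V.subspace_scale[OF range_lam_subspace]) simp
  also have "lam a (Q m) = R_const d * R_v ^ j"
    unfolding lam_G m(1) d_def by (simp add: eval_nat_numeral)
  also have "R_const (inverse d) * (R_const d * R_v ^ j) = R_v ^ j"
    unfolding R_const_mult using \<open>d \<noteq> 0\<close> by (simp add: R_const_simps)
  finally show ?case by simp
next
  case (Suc i)
  have "R_u ^ i * lam a (x j) + R_const (of_nat j * a) * (R_u ^ i * R_v ^ Suc j) \<in> range (lam a)"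
  proof (intro R.V.subspace_add[OF range_lam_subspace] R.V.subspace_scale[OF range_lam_subspace] Suc.IH)
    have "R_u ^ i * lam a (x j) = lam a (x 0 ^ i * x j)"
      by (simp add: algebra_homD[OF algebra_hom_lam] lam_x[of _ 0, simplified] R_const_simps)
    then show "R_u ^ i * lam a (x j) \<in> range (lam a)" by simp
  qed (use Suc.prems in simp)
  moreover have "R_u ^ i * lam a (x j) + R_const (of_nat j * a) * (R_u ^ i * R_v ^ Suc j) = R_u ^ Suc i * R_v ^ j"
    unfolding lam_x right_diff_distrib R_comm[of "R_u ^ i"] by (simp add: power_commutes flip: mult.assoc)
  ultimately show ?case by simp
qed

lemma R_ge_4_range_lam:
  assumes a: "a \<notin> {0, 1 :: 'k::field_char_0}"
  shows "R_ge 4 \<subseteq> range (lam a)"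
  unfolding R_ge_def span_over_def
proof (rule R.V.span_minimal[OF _ range_lam_subspace])
  show "(\<Union>n\<in>{4..}. R_comp n) \<subseteq> range (lam a)"
  proof clarify
    fix n and z :: "'k jordan" assume n: "n \<ge> 4" "z \<in> R_comp n"
    have "R_mons n \<subseteq> range (lam a)" using R_mons_range_lam[OF a] n(1) unfolding R_mons_def by auto
    from R.V.span_minimal[OF this range_lam_subspace]
    show "z \<in> range (lam a)" using R_comp_subset[of n] n(2) by blast
  qed
qed

text \<open>The combination is written out as a sum, so that it can be carried over to the opposite
  ring with its own scalar structure.\<close>

lemma range_lam_finite_codimension:
  assumes a: "a \<notin> {0, 1 :: 'k::field_char_0}"
  defines "W \<equiv> (\<lambda>(i, j). R_u ^ i * R_v ^ j :: 'k jordan) ` ({..<4} \<times> {..<4})"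
  shows "\<exists>f. z - (\<Sum>w\<in>W. R_const (f w) * w) \<in> range (lam a)"
proof -
  have W: "finite W" unfolding W_def by simp
  let ?B = "range (lam a)" let ?S = "{z. \<exists>w\<in>R.V.span W. z - w \<in> ?B}"
  note B = range_lam_subspace[of a]
  have sub: "R.V.subspace ?S"
  proof (rule R.V.subspaceI)
    show "0 \<in> ?S" using R.V.subspace_0[OF B] by (auto intro!: bexI[of _ 0] R.V.span_zero)
    fix y z assume "y \<in> ?S" "z \<in> ?S"
    then obtain w w' where w: "w \<in> R.V.span W" "y - w \<in> ?B" "w' \<in> R.V.span W" "z - w' \<in> ?B" by blast
    have "(y - w) + (z - w') \<in> ?B" by (rule R.V.subspace_add[OF B w(2,4)])
    moreover have "(y - w) + (z - w') = (y + z) - (w + w')" by simp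
    ultimately show "y + z \<in> ?S" using R.V.span_add[OF w(1,3)] by (intro CollectI bexI[of _ "w + w'"]) simp_all
  next
    fix r z assume "z \<in> ?S"
    then obtain w where w: "w \<in> R.V.span W" "z - w \<in> ?B" by blast
    have "R_const r * (z - w) \<in> ?B" by (rule R.V.subspace_scale[OF B w(2)])
    then show "R_const r * z \<in> ?S"
      using R.V.span_scale[OF w(1), of r] by (intro CollectI bexI[of _ "R_const r * w"]) (simp_all only: right_diff_distrib)
  qed
  have mons: "(\<Union>n. R_mons n) \<subseteq> ?S"
  proof
    fix t :: "'k jordan" assume "t \<in> (\<Union>n. R_mons n)"
    then obtain i j where t: "t = R_u ^ i * R_v ^ j" unfolding R_mons_def by blast
    show "t \<in> ?S"
    proof (cases "i + j \<ge> 4")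
      case True
      then show ?thesis using R_mons_range_lam[OF a] t by (intro CollectI bexI[of _ 0]) (simp_all add: R.V.span_zero)
    next
      case False
      then have "t \<in> W" unfolding W_def t by force
      then show ?thesis using R.V.subspace_0[OF B] by (intro CollectI bexI[of _ t]) (simp_all add: R.V.span_base)
    qed
  qed
  obtain w where w: "w \<in> R.V.span W" "z - w \<in> ?B"
    using subsetD[OF R.V.span_minimal[OF mons sub] R_span_mons[of z]] by blast
  then obtain f where "w = (\<Sum>w\<in>W. R_const (f w) * w)" unfolding R.V.span_finite[OF W] by blast
  then show ?thesis using w(2) by blast
qed

text \<open>Passing to the opposite ring exchanges the shapes \<open>k + uR\<close> and
  \<open>k + Ru\<close>; so for \<open>a = 0\<close> and \<open>a = 1\<close> both left-sided
  results are used, one in \<open>R\<close> and the other in the opposite ring.\<close>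

theorem noetherian_range_lam:
  fixes a :: "'k::field_char_0"
  shows "left_noetherian (range (lam a)) \<and> right_noetherian (range (lam a))"
proof -
  consider "a = 0" | "a = 1" | "a \<notin> {0, 1}" by blast
  then show ?thesis
  proof cases
    case 1
    have "Op ` {R_const c + R_u * r | c r. True} = ({Op (R_const c) + r * Op R_u | c r. True} :: 'k jordan op set)" (is "?A = ?B")
    proof
      show "?A \<subseteq> ?B"
      proof clarify
        fix c :: 'k and r :: "'k jordan" show "\<exists>c' r'. Op (R_const c + R_u * r) = Op (R_const c') + r' * Op R_u \<and> True"
          by (intro exI[of _ c] exI[of _ "Op r"]) (simp flip: Op_simps)
      qed
      show "?B \<subseteq> ?A"
      proof clarify
        fix c :: 'k and r :: "'k jordan op"
        have "Op (R_const c) + r * Op R_u = Op (R_const c + R_u * unop r)" by (simp add: unop_inverse flip: Op_simps)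
        then show "Op (R_const c) + r * Op R_u \<in> ?A" by blast
      qed
    qed
    then have "left_noetherian (Op ` {R_const c + R_u * r | c r. True} :: 'k jordan op set)"
      using Rop.left_noetherian_Ru by (simp only:)
    then show ?thesis unfolding 1 range_lam_0 by (intro conjI R.left_noetherian_uR right_noetherian_Op)
  next
    case 2
    have "Op ` {R_const c + r * R_u | c r. True} = ({Op (R_const c) + Op R_u * r | c r. True} :: 'k jordan op set)" (is "?A = ?B")
    proof
      show "?A \<subseteq> ?B"
      proof clarify
        fix c :: 'k and r :: "'k jordan" show "\<exists>c' r'. Op (R_const c + r * R_u) = Op (R_const c') + Op R_u * r' \<and> True"
          by (intro exI[of _ c] exI[of _ "Op r"]) (simp flip: Op_simps)
      qed
      show "?B \<subseteq> ?A"
      proof clarify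
        fix c :: 'k and r :: "'k jordan op"
        have "Op (R_const c) + Op R_u * r = Op (R_const c + unop r * R_u)" by (simp add: unop_inverse flip: Op_simps)
        then show "Op (R_const c) + Op R_u * r \<in> ?A" by blast
      qed
    qed
    then have "left_noetherian (Op ` {R_const c + r * R_u | c r. True} :: 'k jordan op set)"
      using Rop.left_noetherian_uR by (simp only:)
    then show ?thesis unfolding 2 range_lam_1 by (intro conjI R.left_noetherian_Ru right_noetherian_Op)
  next
    case 3
    define W where "W = (\<lambda>(i, j). R_u ^ i * R_v ^ j :: 'k jordan) ` ({..<4} \<times> {..<4})"
    have W: "finite W" unfolding W_def by simp
    have codim: "\<exists>f. z - (\<Sum>w\<in>W. R_const (f w) * w) \<in> range (lam a)" for z
      unfolding W_def by (rule range_lam_finite_codimension[OF 3])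
    have "left_noetherian (range (lam a))"
    proof (rule R.left_noetherian_finite_codimension[OF subring_range_lam _ W])
      show "range R_const \<subseteq> range (lam a)" using range_lam_const by blast
      fix z
      obtain f where f: "z - (\<Sum>w\<in>W. R_const (f w) * w) \<in> range (lam a)" using codim by blast
      have "(\<Sum>w\<in>W. R_const (f w) * w) \<in> R.V.span W" by (intro R.V.span_sum R.V.span_scale R.V.span_base)
      then show "\<exists>w\<in>R.V.span W. z - w \<in> range (lam a)" using f by blast
    qed
    moreover have "left_noetherian (Op ` range (lam a))"
    proof (rule Rop.left_noetherian_finite_codimension[OF subring_Op[OF subring_range_lam] _ finite_imageI[OF W]])
      show "range (\<lambda>r. Op (R_const r)) \<subseteq> Op ` range (lam a)" using range_lam_const by blast
      fix z :: "'k jordan op"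
      obtain f where f: "unop z - (\<Sum>w\<in>W. R_const (f w) * w) \<in> range (lam a)" using codim by blast
      have "(\<Sum>w\<in>W. Op (R_const (f w)) * Op w) \<in> Rop.V.span (Op ` W)"
        by (intro Rop.V.span_sum Rop.V.span_scale Rop.V.span_base imageI)
      moreover have "(\<Sum>w\<in>W. Op (R_const (f w)) * Op w) = Op (\<Sum>w\<in>W. R_const (f w) * w)"
        unfolding Op_sum Op_simps by (intro sum.cong refl arg_cong[of _ _ Op] algebra_overD(4)[OF algebra_over_R, symmetric])
      moreover have "z - Op (\<Sum>w\<in>W. R_const (f w) * w) \<in> Op ` range (lam a)"
      proof -
        have "z - Op (\<Sum>w\<in>W. R_const (f w) * w) = Op (unop z - (\<Sum>w\<in>W. R_const (f w) * w))"
          by (simp add: unop_inverse flip: Op_simps)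
        then show ?thesis using f by (simp only: Op_image_iff)
      qed
      ultimately show "\<exists>w\<in>Rop.V.span (Op ` W). z - w \<in> Op ` range (lam a)" by metis
    qed
    ultimately show ?thesis using right_noetherian_Op by blast
  qed
qed

section \<open>Degrees of the kernel generators and conclusion\<close>

lemma U_comp_word: "\<forall>i\<in>set ns. i \<ge> 1 \<Longrightarrow> r \<cdot> prod_list (map e ns) \<in> U_comp (sum_list ns)"
  unfolding U_comp_def span_over_def by (intro U.span_scale U.span_base) blast

lemma U_comp_add: "y \<in> U_comp n \<Longrightarrow> z \<in> U_comp n \<Longrightarrow> y + z \<in> U_comp n"
  and U_comp_diff: "y \<in> U_comp n \<Longrightarrow> z \<in> U_comp n \<Longrightarrow> y - z \<in> U_comp n"
  unfolding U_comp_def span_over_def by (rule U.span_add U.span_diff; assumption)+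

lemma numeral_scl: "numeral k * z = numeral k \<cdot> (z :: 'k::field UW)" "- numeral k * z = (- numeral k) \<cdot> z"
  by (simp_all add: U_const_numeral U_const_simps)

lemma h_U_comp: "h1 a \<in> U_comp 5" "h2 \<in> U_comp 6" "h3 a \<in> U_comp 6"
proof -
  show "h1 a \<in> U_comp 5"
    unfolding h1_def
    using U_comp_word[of "[1,2,2]" 1] U_comp_word[of "[1,1,3]" 1] U_comp_word[of "[2,3]" "2 * a"]
      U_comp_word[of "[1,4]" "1 + 2 * a"] U_comp_word[of "[5]" "a^2 + a"]
    by (intro U_comp_add U_comp_diff) (simp_all add: U_const_simps(1) power2_eq_square mult.assoc)
  show "h2 \<in> U_comp 6"
    unfolding h2_def numeral_scl
    using U_comp_word[of "[1,5]" 1] U_comp_word[of "[2,4]" 4] U_comp_word[of "[3,3]" 3] U_comp_word[of "[6]" 2]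
    by (intro U_comp_add U_comp_diff) (simp_all add: U_const_simps(1) power2_eq_square mult.assoc)
  show "h3 a \<in> U_comp 6"
    unfolding h3_def numeral_scl
    using U_comp_word[of "[1,1,2,2]" "- 4"] U_comp_word[of "[2,2,2]" 4] U_comp_word[of "[1,1,1,3]" 4]
      U_comp_word[of "[3,3]" "20 * a ^ 2 + 14 * a - 7"] U_comp_word[of "[1,5]" "16 * a ^ 2 + 18 * a + 5"]
      U_comp_word[of "[6]" "16 * a ^ 3 + 36 * a ^ 2 + 16 * a - 2"]
    by (intro U_comp_add U_comp_diff) (simp_all only: list.map prod_list.Cons prod_list.Nil sum_list.Cons sum_list.Nil power2_eq_square power3_eq_cube mult.assoc mult_1_right, simp_all)
qed

theorem theorem0p6:
  shows "(\<forall>a :: 'k::field_char_0.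
           (a \<in> {0, 1} \<longrightarrow> {x. lam a x = 0} = ideal_gen {e 1 * e 3 - e 2 ^ 2 - e 4}) \<and>
           (a \<notin> {0, 1} \<longrightarrow>
              h1 a \<in> U_comp 5 \<and> h2 \<in> (U_comp 6 :: 'k UW set) \<and> h3 a \<in> U_comp 6 \<and>
              {x. lam a x = 0} = ideal_gen {h1 a, h2, h3 a})) \<and>
         (\<forall>a :: 'k.
           (a = 0 \<longrightarrow> range (lam a) = {R_const c + R_u * r | c r. True}) \<and>
           (a = 1 \<longrightarrow> range (lam a) = {R_const c + r * R_u | c r. True}) \<and>
           (a \<notin> {0, 1} \<longrightarrow> R_ge 4 \<subseteq> range (lam a)) \<and>
           left_noetherian (range (lam a)) \<and> right_noetherian (range (lam a))) \<and>
         {x :: 'k UW. phi x = 0} = ideal_gen {e 1 * e 5 - 4 * e 2 * e 4 + 3 * e 3 ^ 2 + 2 * e 6}"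
proof (intro conjI allI impI)
  fix a :: 'k
  show "a \<in> {0, 1} \<Longrightarrow> {x. lam a x = 0} = ideal_gen {e 1 * e 3 - e 2 ^ 2 - e 4}" by (rule kernel_lam_01)
  show "a \<notin> {0, 1} \<Longrightarrow> {x. lam a x = 0} = ideal_gen {h1 a, h2, h3 a}" by (rule kernel_lam)
  show "h1 a \<in> U_comp 5" "h2 \<in> (U_comp 6 :: 'k UW set)" "h3 a \<in> U_comp 6" by (rule h_U_comp)+
  show "a = 0 \<Longrightarrow> range (lam a) = {R_const c + R_u * r | c r. True}" using range_lam_0 by blast
  show "a = 1 \<Longrightarrow> range (lam a) = {R_const c + r * R_u | c r. True}" using range_lam_1 by blast
  show "a \<notin> {0, 1} \<Longrightarrow> R_ge 4 \<subseteq> range (lam a)" by (rule R_ge_4_range_lam)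
  show "left_noetherian (range (lam a))" "right_noetherian (range (lam a))" using noetherian_range_lam by blast+
  show "{x :: 'k UW. phi x = 0} = ideal_gen {e 1 * e 5 - 4 * e 2 * e 4 + 3 * e 3 ^ 2 + 2 * e 6}"
    using kernel_phi unfolding h2_def .
qed

end
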